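(* Let $\mathcal{E}$ be an origin symmetric ellipsoid in $\mathbb{R}^n$ and write $a_1\leqslant a_2\leqslant\cdots\leqslant a_n$ for the lengths and $e_1,e_2,\ldots,e_n$ for the corresponding (orthonormal) directions of its semi-axes. If $1\leqslant k\leqslant n-1$, then for any $H\in G_{n,k}$ and any $0\leqslant j<k$, $$W_j(\mathcal{E}\cap F_k)\leqslant W_j(\mathcal{E}\cap H)\leqslant W_j(P_H(\mathcal{E}))\leqslant W_j(\mathcal{E}\cap E_k),$$ where $F_k=\mathrm{span}\{e_1,\ldots,e_k\}$ and $E_k=\mathrm{span}\{e_{n-k+1},\ldots,e_n\}$. In particular, for every $\xi\in S^{n-1}$, $$S(\mathcal{E}\cap\xi^\perp)\leqslant S(P_{\xi^\perp}(\mathcal{E}))\leqslant S(\mathcal{E}\cap e_1^\perp).$$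
   Context: $G_{n,k}$ is the Grassmannian of $k$-dimensional linear subspaces of $\mathbb{R}^n$, $P_H$ is the orthogonal projection onto $H$, and $\xi^\perp=\{x\in\mathbb{R}^n:\langle x,\xi\rangle=0\}$. For a convex body $A$ in an $m$-dimensional Euclidean space $E$ with unit ball $B_E$, the quermassintegrals $W_0(A),\dots,W_m(A)$ (relative to $E$) are defined by $|A+tB_E|=\sum_{j=0}^m\binom{m}{j}W_j(A)\,t^j$ for $t\geqslant0$, with $|\cdot|$ being $m$-dimensional volume, and the surface area is $S(A)=mW_1(A)$. Quermassintegrals and surface areas of sections and projections are computed in the corresponding subspace ($F_k$, $H$, $E_k$, $\xi^\perp$, $e_1^\perp$). *)

theory Defs
  imports "HOL-Analysis.Analysis"
begin

definition grassmannian :: "nat \<Rightarrow> 'a::euclidean_space set set" where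
  "grassmannian k = {H. subspace H \<and> dim H = k}"

definition orth_proj :: "'a::euclidean_space set \<Rightarrow> 'a \<Rightarrow> 'a" where
  "orth_proj H x = (THE y. y \<in> H \<and> (\<forall>z\<in>H. orthogonal (x - y) z))"

definition perp :: "'a::euclidean_space \<Rightarrow> 'a set" where
  "perp \<xi> = {x. x \<bullet> \<xi> = 0}"

definition orthonormal_basis_of :: "'a::euclidean_space set \<Rightarrow> 'a set \<Rightarrow> bool" where
  "orthonormal_basis_of H B \<longleftrightarrow>
     pairwise orthogonal B \<and> (\<forall>b\<in>B. norm b = 1) \<and> span B = H"

text \<open>
  Lebesgue measure of dimension \<open>dim H\<close> on a linear subspace \<open>H\<close>, as a Borel measure on the
  ambient space that is concentrated on \<open>H\<close>. The construction is that of \<^const>\<open>lborel\<close>, with an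
  orthonormal basis of \<open>H\<close> in place of \<open>Basis\<close>; by rotation invariance of Lebesgue measure the
  choice of this basis is irrelevant.
\<close>

definition subspace_lborel :: "'a::euclidean_space set \<Rightarrow> 'a measure" where
  "subspace_lborel H =
     (let B = (SOME B. orthonormal_basis_of H B)
      in distr (\<Pi>\<^sub>M b\<in>B. lborel) borel (\<lambda>f. \<Sum>b\<in>B. f b *\<^sub>R b))"

definition parallel_body :: "'a::euclidean_space set \<Rightarrow> 'a set \<Rightarrow> real \<Rightarrow> 'a set" where
  "parallel_body H A t = {x + t *\<^sub>R y | x y. x \<in> A \<and> y \<in> H \<inter> cball 0 1}"

text \<open>
  \<open>W\<close> lists the coefficients of the Steiner polynomial of \<open>A\<close> relative to the subspace \<open>H\<close>. The
  entries beyond \<open>dim H\<close> do not occur in the polynomial; fixing them to be \<open>0\<close> makes \<open>W\<close> unique.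
\<close>

definition steiner_coeffs :: "'a::euclidean_space set \<Rightarrow> 'a set \<Rightarrow> (nat \<Rightarrow> real) \<Rightarrow> bool" where
  "steiner_coeffs H A W \<longleftrightarrow>
     (\<forall>t\<ge>0. measure (subspace_lborel H) (parallel_body H A t) =
        (\<Sum>j=0..dim H. real (dim H choose j) * W j * t ^ j)) \<and>
     (\<forall>j>dim H. W j = 0)"

definition quermassintegral :: "'a::euclidean_space set \<Rightarrow> nat \<Rightarrow> 'a set \<Rightarrow> real" where
  "quermassintegral H j A = (THE W. steiner_coeffs H A W) j"

definition surface_area :: "'a::euclidean_space set \<Rightarrow> 'a set \<Rightarrow> real" where
  "surface_area H A = real (dim H) * quermassintegral H 1 A"

definition ellipsoid :: "(nat \<Rightarrow> real ^ 'n) \<Rightarrow> (nat \<Rightarrow> real) \<Rightarrow> (real ^ 'n) set" where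
  "ellipsoid e a = {x. (\<Sum>i=1..CARD('n). ((x \<bullet> e i) / a i)\<^sup>2) \<le> 1}"

lemma ex_orthonormal_basis_of:
  assumes "subspace H"
  shows "\<exists>B. orthonormal_basis_of H B"
  using orthonormal_basis_subspace[OF assms] unfolding orthonormal_basis_of_def by metis

lemma orth_proj_eqI:
  assumes "subspace H" "y \<in> H" "\<And>z. z \<in> H \<Longrightarrow> orthogonal (x - y) z"
  shows "orth_proj H x = y"
  unfolding orth_proj_def
proof (rule the_equality)
  fix w assume w: "w \<in> H \<and> (\<forall>z\<in>H. orthogonal (x - w) z)"
  then have "w - y \<in> H" using assms by (simp add: subspace_diff)
  then have "(x - w) \<bullet> (w - y) = 0" "(x - y) \<bullet> (w - y) = 0"
    using w assms by (auto simp: orthogonal_def)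
  then have "(w - y) \<bullet> (w - y) = 0" by (simp add: inner_diff_left)
  then show "w = y" by simp
qed (use assms in auto)

lemma steiner_coeffs_unique:
  assumes V: "steiner_coeffs H A V" and W: "steiner_coeffs H A W"
  shows "V = W"
proof
  fix j
  define c where "c i = real (dim H choose i) * (V i - W i)" for i
  have "(\<Sum>i\<le>dim H. c i * t ^ i) = 0" if "t \<ge> 0" for t :: real
  proof -
    have "(\<Sum>i=0..dim H. real (dim H choose i) * V i * t ^ i) =
          (\<Sum>i=0..dim H. real (dim H choose i) * W i * t ^ i)"
      using V W that unfolding steiner_coeffs_def by metis
    then show ?thesis
      by (simp add: c_def atMost_atLeast0 algebra_simps sum_subtractf)
  qed
  then have "{0..} \<subseteq> {t. (\<Sum>i\<le>dim H. c i * t ^ i) = 0}" by auto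
  moreover have "infinite {0::real..}" by (rule infinite_Ici)
  ultimately have "infinite {t. (\<Sum>i\<le>dim H. c i * t ^ i) = 0}"
    using finite_subset by blast
  then have "\<forall>i\<le>dim H. c i = 0"
    using polyfun_finite_roots[of c "dim H"] by blast
  then show "V j = W j"
    using V W by (cases "j \<le> dim H") (auto simp: c_def steiner_coeffs_def)
qed

lemma quermassintegral_eqI:
  assumes "steiner_coeffs H A W"
  shows "quermassintegral H j A = W j"
  unfolding quermassintegral_def
  using the_equality[of "steiner_coeffs H A" W] assms steiner_coeffs_unique by metis

end

theory Submission
  imports Defs
begin

text \<open>
  Write the ellipsoid as \<open>{x. norm (S x) \<le> 1} = T ` cball 0 1\<close>, where \<open>T\<close> multiplies the
  coordinate along \<open>e i\<close> by \<open>a i\<close> and \<open>S\<close> is its inverse. Sections by and projections onto a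
  subspace \<open>H\<close> of dimension \<open>k\<close> are again ellipsoids: the semi-axes \<open>b 1 \<le> \<dots> \<le> b k\<close> of the section
  are the reciprocals of the singular values of \<open>S\<close> restricted to \<open>H\<close>, and the semi-axes
  \<open>c 1 \<le> \<dots> \<le> c k\<close> of the projection are the singular values of \<open>T\<close> restricted to \<open>H\<close>
  (\<open>unit_preimage_section\<close>, \<open>orth_proj_image_cball\<close>). Two subspaces of \<open>H\<close>, or of the whole space,
  whose dimensions add up to more than the dimension of the space around them share a nonzero
  vector; comparing the lengths of its images in the manner of Courant and Fischer yields
  \<open>a i \<le> b i \<le> c i \<le> a (n - k + i)\<close>. The theorem thus follows once the quermassintegrals of an
  ellipsoid are known to depend on its semi-axes only, and to increase with each of them
  (\<open>quermassintegral_axis_ell_mono\<close>).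

  For this, enlarge a single semi-axis, say the one with index \<open>l\<close>, and let \<open>s\<close> be its length in
  between. A point that is new in the parallel body at distance \<open>t\<close> lies on the boundary of the
  parallel body of exactly one intermediate ellipsoid, so the new region is parametrized
  injectively by \<open>s\<close> and the outer normal \<open>w\<close>, scaled so that its \<open>l\<close>-th coordinate is 1. The
  point is the gradient at \<open>w\<close> of \<open>h s w + t * norm w\<close>, where \<open>h s\<close> is the support function
  of the ellipsoid. The Jacobian determinant is the \<open>s\<close>-derivative of \<open>h s w\<close> times the
  determinant of a matrix \<open>P + t * Q\<close>, where \<open>P\<close> and \<open>Q\<close> are Hessian matrices of \<open>h s\<close> and of the
  norm with row and column \<open>l\<close> deleted. Both Hessians are nonnegative combinations of the same
  rank-one matrices, namely those of the vectors \<open>w q * axis p - w p * axis q\<close>. A formula of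
  Cauchy-Binet type (\<open>det_weighted_sum_rank_one\<close>) shows that the determinant is a polynomial in
  \<open>t\<close> with nonnegative coefficients. Integrating it, the volume gained is such a polynomial as
  well (\<open>cyl_vol_enlarge_axis\<close>). Enlarging one semi-axis after another, starting from a ball, gives
  at once the existence of the Steiner polynomial and the monotonicity of its coefficients.

  All volumes are computed in a model space \<open>real ^ 'm\<close>, where a \<open>k\<close>-dimensional body in the
  coordinate subspace of an index set \<open>I\<close> is replaced by its product with the unit cube in the
  remaining coordinates. This treats all \<open>k\<close> at once, although the dimension of the model space
  is fixed by a type.
\<close>

section \<open>Determinants of weighted sums of rank-one matrices\<close>

text \<open>
  Expanding every row gives a sum over all choices \<open>f\<close> of one rank-one matrix per row. The weights
  depend only on the multiset of values of \<open>f\<close>, so \<open>f\<close> may be averaged over all its rearrangements,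
  and the average of the diagonal products, taken with signs, is again a determinant. The squares
  on the right are what makes the determinant a polynomial with nonnegative coefficients in the
  weights.
\<close>

lemma det_weighted_sum_rank_one:
  fixes v :: "'m \<Rightarrow> real ^ 'n" and c :: "'m \<Rightarrow> real"
  assumes M: "finite M"
  shows "fact CARD('n) * det (\<chi> i j. \<Sum>m\<in>M. c m * v m $ i * v m $ j) =
    (\<Sum>f | \<forall>i. f i \<in> M. (\<Prod>i\<in>UNIV. c (f i)) * (det (\<chi> i. v (f i)))\<^sup>2)"
proof -
  define \<Phi> where "\<Phi> = {f :: 'n \<Rightarrow> 'm. \<forall>i. f i \<in> M}"
  let ?P = "{p. p permutes (UNIV :: 'n set)}"
  have \<Phi>: "\<Phi> = (UNIV \<rightarrow>\<^sub>E M)"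
    by (auto simp: \<Phi>_def)
  have D: "det (\<chi> i j. \<Sum>m\<in>M. c m * v m $ i * v m $ j) =
      (\<Sum>f\<in>\<Phi>. (\<Prod>i\<in>UNIV. c (f i)) * (\<Prod>i\<in>UNIV. v (f i) $ i) * det (\<chi> i. v (f i)))"
  proof -
    have "det (\<chi> i j. \<Sum>m\<in>M. c m * v m $ i * v m $ j) =
        (\<Sum>p\<in>?P. \<Sum>f\<in>\<Phi>. of_int (sign p) * (\<Prod>i\<in>UNIV. c (f i) * v (f i) $ i * v (f i) $ p i))"
      by (simp add: det_def prod_sum_PiE M \<Phi> sum_distrib_left)
    also have "\<dots> = (\<Sum>f\<in>\<Phi>. \<Sum>p\<in>?P. of_int (sign p) *
        (\<Prod>i\<in>UNIV. c (f i) * v (f i) $ i * v (f i) $ p i))"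
      by (rule sum.swap)
    also have "\<dots> = (\<Sum>f\<in>\<Phi>. (\<Prod>i\<in>UNIV. c (f i)) * (\<Prod>i\<in>UNIV. v (f i) $ i) *
        det (\<chi> i. v (f i)))"
      by (simp add: det_def sum_distrib_left prod.distrib ac_simps)
    finally show ?thesis .
  qed
  \<comment> \<open>Composing \<open>f\<close> with a permutation changes only the sign of the determinant and the diagonal
    product.\<close>
  have perm: "(\<Sum>f\<in>\<Phi>. (\<Prod>i\<in>UNIV. c (f i)) * (\<Prod>i\<in>UNIV. v (f i) $ i) * det (\<chi> i. v (f i))) =
      (\<Sum>f\<in>\<Phi>. (\<Prod>i\<in>UNIV. c (f i)) * det (\<chi> i. v (f i)) *
        (of_int (sign p) * (\<Prod>i\<in>UNIV. v (f (p i)) $ i)))" if p: "p permutes UNIV" for p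
  proof -
    have bij: "bij_betw (\<lambda>f. f \<circ> p) \<Phi> \<Phi>"
      using permutes_inv[OF p] permutes_inv_o[OF p]
      by (intro bij_betwI[where g="\<lambda>f. f \<circ> inv p"]) (auto simp: \<Phi>_def comp_assoc)
    have "(\<Sum>f\<in>\<Phi>. (\<Prod>i\<in>UNIV. c (f i)) * (\<Prod>i\<in>UNIV. v (f i) $ i) * det (\<chi> i. v (f i))) =
        (\<Sum>f\<in>\<Phi>. (\<Prod>i\<in>UNIV. c (f (p i))) * (\<Prod>i\<in>UNIV. v (f (p i)) $ i) *
          det (\<chi> i. v (f (p i))))"
      using sum.reindex_bij_betw[OF bij, of "\<lambda>f. (\<Prod>i\<in>UNIV. c (f i)) *
        (\<Prod>i\<in>UNIV. v (f i) $ i) * det (\<chi> i. v (f i))"] by simp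
    also have "\<dots> = (\<Sum>f\<in>\<Phi>. (\<Prod>i\<in>UNIV. c (f i)) * det (\<chi> i. v (f i)) *
        (of_int (sign p) * (\<Prod>i\<in>UNIV. v (f (p i)) $ i)))"
    proof (rule sum.cong[OF refl])
      fix f
      have "(\<Prod>i\<in>UNIV. c (f (p i))) = (\<Prod>i\<in>UNIV. c (f i))"
        using prod.permute[OF p, of "\<lambda>i. c (f i)"] by (simp add: comp_def)
      moreover have "det (\<chi> i. v (f (p i))) = of_int (sign p) * det (\<chi> i. v (f i))"
        using det_permute_rows[OF p, of "\<chi> i. v (f i)"] by simp
      ultimately show "(\<Prod>i\<in>UNIV. c (f (p i))) * (\<Prod>i\<in>UNIV. v (f (p i)) $ i) *
          det (\<chi> i. v (f (p i))) = (\<Prod>i\<in>UNIV. c (f i)) * det (\<chi> i. v (f i)) *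
        (of_int (sign p) * (\<Prod>i\<in>UNIV. v (f (p i)) $ i))" by simp
    qed
    finally show ?thesis .
  qed
  have "fact CARD('n) * det (\<chi> i j. \<Sum>m\<in>M. c m * v m $ i * v m $ j) =
      (\<Sum>p\<in>?P. \<Sum>f\<in>\<Phi>. (\<Prod>i\<in>UNIV. c (f i)) * det (\<chi> i. v (f i)) *
        (of_int (sign p) * (\<Prod>i\<in>UNIV. v (f (p i)) $ i)))"
    using sum.cong[OF refl, of ?P, OF perm] by (simp add: D card_permutations[OF refl])
  also have "\<dots> = (\<Sum>f\<in>\<Phi>. (\<Prod>i\<in>UNIV. c (f i)) * det (\<chi> i. v (f i)) *
      (\<Sum>p\<in>?P. of_int (sign p) * (\<Prod>i\<in>UNIV. v (f (p i)) $ i)))"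
    by (subst sum.swap) (simp add: sum_distrib_left)
  also have "\<dots> = (\<Sum>f\<in>\<Phi>. (\<Prod>i\<in>UNIV. c (f i)) * (det (\<chi> i. v (f i)))\<^sup>2)"
  proof (rule sum.cong[OF refl])
    fix f :: "'n \<Rightarrow> 'm"
    have "(\<Sum>p\<in>?P. of_int (sign p) * (\<Prod>i\<in>UNIV. v (f (p i)) $ i)) =
        det (transpose (\<chi> i. v (f i)))"
      unfolding det_def[of "transpose _"] by (simp add: transpose_def)
    then show "(\<Prod>i\<in>UNIV. c (f i)) * det (\<chi> i. v (f i)) *
      (\<Sum>p\<in>?P. of_int (sign p) * (\<Prod>i\<in>UNIV. v (f (p i)) $ i)) =
      (\<Prod>i\<in>UNIV. c (f i)) * (det (\<chi> i. v (f i)))\<^sup>2"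
      by (simp add: power2_eq_square)
  qed
  finally show ?thesis by (simp add: \<Phi>_def)
qed

section \<open>Support functions of parallel bodies of coaxial ellipsoids\<close>

definition res :: "'m set \<Rightarrow> real ^ 'm \<Rightarrow> real ^ 'm" where
  "res I x = (\<chi> i. if i \<in> I then x $ i else 0)"

definition scl :: "('m \<Rightarrow> real) \<Rightarrow> real ^ 'm \<Rightarrow> real ^ 'm" where
  "scl c x = (\<chi> i. c i * x $ i)"

text \<open>
  The ellipsoid with semi-axes \<open>c i\<close> along the coordinates in \<open>I\<close>, enlarged by \<open>t\<close> times the unit
  ball of the same coordinate subspace. The points \<open>z\<close> and \<open>v\<close> range over the unit ball of the whole
  space, as \<open>res I\<close> discards their other coordinates. At \<open>t = 0\<close> this is the ellipsoid itself.
\<close>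

definition par_ell :: "'m set \<Rightarrow> ('m \<Rightarrow> real) \<Rightarrow> real \<Rightarrow> (real ^ 'm) set" where
  "par_ell I c t = (\<lambda>(z, v). res I (scl c z + t *\<^sub>R v)) ` (cball 0 1 \<times> cball 0 1)"

definition supp_fun :: "'m set \<Rightarrow> ('m \<Rightarrow> real) \<Rightarrow> real \<Rightarrow> real ^ 'm \<Rightarrow> real" where
  "supp_fun I c t w = norm (res I (scl c w)) + t * norm (res I w)"

text \<open>
  The gradient of the support function at \<open>w\<close> where that is differentiable, hence the boundary
  point with outer normal \<open>w\<close>. At the other \<open>w\<close> the convention \<open>sgn 0 = 0\<close> still gives a point of
  the body.
\<close>

definition supp_pt :: "'m set \<Rightarrow> ('m \<Rightarrow> real) \<Rightarrow> real \<Rightarrow> real ^ 'm \<Rightarrow> real ^ 'm" where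
  "supp_pt I c t w = res I (scl c (sgn (res I (scl c w))) + t *\<^sub>R sgn (res I w))"

lemma res_nth [simp]: "res I x $ i = (if i \<in> I then x $ i else 0)"
  by (simp add: res_def)

lemma scl_nth [simp]: "scl c x $ i = c i * x $ i"
  by (simp add: scl_def)

lemma res_res [simp]: "res I (res I x) = res I x"
  by (simp add: vec_eq_iff)

lemma res_scl_res [simp]: "res I (scl c (res I x)) = res I (scl c x)"
  by (simp add: vec_eq_iff)

lemma linear_res: "linear (res I)"
  by (rule linearI) (simp_all add: vec_eq_iff)

lemma linear_scl: "linear (scl c)"
  by (rule linearI) (simp_all add: vec_eq_iff algebra_simps)

lemma res_scaleR: "res I (r *\<^sub>R x) = r *\<^sub>R res I x"
  by (simp add: vec_eq_iff)

lemma res_add: "res I (x + y) = res I x + res I y"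
  by (simp add: vec_eq_iff)

lemma scl_scaleR: "scl c (r *\<^sub>R x) = r *\<^sub>R scl c x"
  by (simp add: vec_eq_iff)

lemma scl_add: "scl c (x + y) = scl c x + scl c y"
  by (simp add: vec_eq_iff algebra_simps)

lemma inner_res: "res I x \<bullet> y = x \<bullet> res I y" for x y :: "real ^ 'm"
  by (simp add: inner_vec_def if_distrib[of "\<lambda>z. z * _"] if_distrib[of "\<lambda>z. _ * z"] cong: if_cong)

lemma inner_scl: "scl c x \<bullet> y = x \<bullet> scl c y" for x y :: "real ^ 'm"
  by (simp add: inner_vec_def ac_simps)

lemma inner_sgn_self: "sgn x \<bullet> x = norm x" for x :: "'a::real_inner"
  by (cases "x = 0") (simp_all add: sgn_div_norm dot_square_norm power2_eq_square)

lemma norm_res_scl: "norm (res I (scl c w)) = sqrt (\<Sum>i\<in>I. (c i * w $ i)\<^sup>2)" for w :: "real ^ 'm"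
proof -
  have "(\<Sum>i\<in>UNIV. (res I (scl c w) $ i)\<^sup>2) = (\<Sum>i\<in>I. (c i * w $ i)\<^sup>2)"
    by (intro sum.mono_neutral_cong_right) auto
  then show ?thesis by (simp add: norm_vec_def L2_set_def)
qed

lemma norm_res: "norm (res I w) = sqrt (\<Sum>i\<in>I. (w $ i)\<^sup>2)" for w :: "real ^ 'm"
  using norm_res_scl[of I "\<lambda>_. 1" w] by (simp add: scl_def)

lemma compact_par_ell: "compact (par_ell I c t)"
proof -
  have "continuous_on UNIV (\<lambda>x. res I (scl c (fst x) + t *\<^sub>R snd x))"
    by (intro linear_continuous_on_compose[OF _ linear_res] continuous_intros
        linear_continuous_on_compose[OF _ linear_scl])
  then show ?thesis unfolding par_ell_def case_prod_unfold
    by (intro compact_continuous_image compact_Times compact_cball)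
       (auto intro: continuous_on_subset)
qed

lemma convex_par_ell: "convex (par_ell I c t)"
proof -
  have "linear (\<lambda>(z, v). res I (scl c z + t *\<^sub>R v))"
    by (rule linearI) (auto simp: vec_eq_iff algebra_simps)
  then show ?thesis unfolding par_ell_def
    by (intro convex_linear_image convex_Times convex_cball)
qed

lemma supp_pt_mem: "supp_pt I c t w \<in> par_ell I c t"
  unfolding supp_pt_def par_ell_def
  by (rule image_eqI[where x="(sgn (res I (scl c w)), sgn (res I w))"]) (auto simp: norm_sgn)

lemma inner_res_scl_add:
  "res I (scl c z + t *\<^sub>R v) \<bullet> w = z \<bullet> res I (scl c w) + t * (v \<bullet> res I w)"
proof -
  have "scl c (res I w) = res I (scl c w)" by (simp add: vec_eq_iff)
  then show ?thesis by (simp add: inner_res inner_add_left inner_scl)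
qed

lemma supp_pt_inner: "supp_pt I c t w \<bullet> w = supp_fun I c t w"
  unfolding supp_pt_def supp_fun_def inner_res_scl_add by (simp add: inner_sgn_self)

lemma par_ell_le_supp_fun:
  assumes "x \<in> par_ell I c t" "0 \<le> t"
  shows "x \<bullet> w \<le> supp_fun I c t w"
proof -
  obtain z v where x: "x = res I (scl c z + t *\<^sub>R v)" and "norm z \<le> 1" "norm v \<le> 1"
    using assms(1) by (auto simp: par_ell_def)
  then have "z \<bullet> res I (scl c w) \<le> norm (res I (scl c w))" "v \<bullet> res I w \<le> norm (res I w)"
    by (smt (verit) norm_cauchy_schwarz mult_left_le_one_le norm_ge_zero)+
  then show ?thesis
    using assms(2) by (simp add: x inner_res_scl_add supp_fun_def add_mono mult_left_mono)
qed

lemma supp_fun_res [simp]: "supp_fun I c t (res I w) = supp_fun I c t w"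
  by (simp add: supp_fun_def)

lemma supp_fun_scaleR: "0 \<le> r \<Longrightarrow> supp_fun I c t (r *\<^sub>R w) = r * supp_fun I c t w"
  by (simp add: supp_fun_def scl_scaleR res_scaleR algebra_simps)

lemma supp_fun_nonneg: "0 \<le> t \<Longrightarrow> 0 \<le> supp_fun I c t w"
  by (simp add: supp_fun_def)

text \<open>
  A closed convex set is cut out by its support function; the separating normal can be taken in
  the coordinate subspace, because the point lies there, and then be scaled to length 1.
\<close>

lemma not_par_ell_separated:
  assumes "x \<notin> par_ell I c t" "res I x = x" "0 \<le> t"
  obtains w where "res I w = w" "norm w = 1" "supp_fun I c t w < x \<bullet> w"
proof -
  obtain a b where ab: "a \<bullet> x < b" "\<And>y. y \<in> par_ell I c t \<Longrightarrow> b < a \<bullet> y"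
    using separating_hyperplane_closed_point[OF convex_par_ell compact_imp_closed[OF
        compact_par_ell] assms(1)]
    by metis
  define u where "u = res I (- a)"
  have "x \<bullet> u = - (a \<bullet> x)"
    using assms(2) by (simp add: u_def flip: inner_res) (simp add: inner_commute)
  moreover have "supp_fun I c t u < - b"
    using ab(2)[OF supp_pt_mem[of I c t "- a"]] supp_pt_inner[of I c t "- a"]
    by (simp add: u_def inner_commute)
  ultimately have u: "supp_fun I c t u < x \<bullet> u" using ab(1) by linarith
  then have "u \<noteq> 0" using supp_fun_nonneg[OF assms(3), of I c u] by auto
  then have "supp_fun I c t (sgn u) < x \<bullet> sgn u"
    using u by (simp add: sgn_div_norm supp_fun_scaleR divide_strict_right_mono)
  moreover have "res I (sgn u) = sgn u" by (simp add: sgn_div_norm res_scaleR u_def)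
  ultimately show ?thesis using that[of "sgn u"] \<open>u \<noteq> 0\<close> by (simp add: norm_sgn)
qed

lemma par_ell_res: "x \<in> par_ell I c t \<Longrightarrow> res I x = x"
  by (auto simp: par_ell_def)

lemma supp_fun_mono:
  assumes "\<And>i. i \<in> I \<Longrightarrow> 0 \<le> c i" "\<And>i. i \<in> I \<Longrightarrow> c i \<le> c' i"
  shows "supp_fun I c t w \<le> supp_fun I c' t w"
  unfolding supp_fun_def norm_res_scl
  using assms by (auto intro!: sum_mono real_sqrt_le_mono simp: power_mult_distrib mult_right_mono
      power_mono)

lemma par_ell_mono:
  assumes "\<And>i. i \<in> I \<Longrightarrow> 0 \<le> c i" "\<And>i. i \<in> I \<Longrightarrow> c i \<le> c' i" "0 \<le> t"
  shows "par_ell I c t \<subseteq> par_ell I c' t"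
proof
  fix x assume x: "x \<in> par_ell I c t"
  show "x \<in> par_ell I c' t"
  proof (rule ccontr)
    assume "x \<notin> par_ell I c' t"
    then obtain w where "supp_fun I c' t w < x \<bullet> w"
      using not_par_ell_separated[OF _ par_ell_res[OF x] assms(3)] by metis
    then show False
      using supp_fun_mono[of I c c' t w, OF assms(1,2)] par_ell_le_supp_fun[OF x assms(3), of w]
          by simp
  qed
qed

lemma supp_fun_strict_mono:
  assumes "l \<in> I" "w $ l \<noteq> 0" "0 \<le> s" "s < s'"
  shows "supp_fun I (c(l := s)) t w < supp_fun I (c(l := s')) t w"
proof -
  have "(\<Sum>i\<in>I. ((c(l := s)) i * w $ i)\<^sup>2) < (\<Sum>i\<in>I. ((c(l := s')) i * w $ i)\<^sup>2)"
  proof (rule sum_strict_mono_ex1)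
    show "\<exists>i\<in>I. ((c(l := s)) i * w $ i)\<^sup>2 < ((c(l := s')) i * w $ i)\<^sup>2"
      using assms by (intro bexI[of _ l]) (auto simp: power_mult_distrib power_strict_mono)
  qed (use assms in \<open>auto simp: power_mult_distrib mult_right_mono power_mono\<close>)
  then show ?thesis by (simp add: supp_fun_def norm_res_scl)
qed

lemma supp_pt_nth:
  "supp_pt I c t w $ i = (if i \<in> I then
     ((c i)\<^sup>2 / norm (res I (scl c w)) + t / norm (res I w)) * w $ i else 0)"
  by (simp add: supp_pt_def sgn_div_norm power2_eq_square divide_inverse algebra_simps)

lemma supp_pt_scaleR: "0 < r \<Longrightarrow> supp_pt I c t (r *\<^sub>R w) = supp_pt I c t w"
  by (simp add: supp_pt_def scl_scaleR res_scaleR sgn_scaleR)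

text \<open>
  Parallel bodies of two different intermediate ellipsoids have no boundary point with a normal of
  this kind in common, as their support functions differ at every normal whose \<open>l\<close>-th coordinate is
  nonzero. Within one of them, two normals at the same point make the triangle inequality for the
  norm \<open>norm \<circ> res I \<circ> scl c\<close> an equality, so they are parallel.
\<close>

lemma supp_pt_inj:
  fixes w w' :: "real ^ 'm"
  assumes l: "l \<in> I" and c: "\<And>i. i \<in> I \<Longrightarrow> 0 < c i" and ss: "0 < s" "0 < s'" and t: "0 \<le> t"
    and w: "w $ l = 1" "res I w = w" and w': "w' $ l = 1" "res I w' = w'"
    and eq: "supp_pt I (c(l := s)) t w = supp_pt I (c(l := s')) t w'"
  shows "s = s'" "w = w'"
proof -
  have le: False if ss: "0 < s" "s < s'" and w': "w' $ l = 1"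
    and eq: "supp_pt I (c(l := s)) t w = supp_pt I (c(l := s')) t w'" for s s'
        and w w' :: "real ^ 'm"
  proof -
    have "supp_fun I (c(l := s')) t w' \<le> supp_fun I (c(l := s)) t w'"
      using par_ell_le_supp_fun[OF supp_pt_mem t, of I "c(l := s)" w w'] eq supp_pt_inner by metis
    then show False using supp_fun_strict_mono[of l I w' s s' c t] l ss w' by simp
  qed
  show s: "s = s'" using le[of s s' w' w] le[of s' s w w'] eq ss w w' by force
  let ?c = "c(l := s)" let ?T = "\<lambda>w. res I (scl ?c w)"
  have "supp_fun I ?c t w + supp_fun I ?c t w' \<le> supp_fun I ?c t (w + w')"
    using par_ell_le_supp_fun[OF supp_pt_mem t, of I ?c w "w + w'"] eq s
      supp_pt_inner[of I ?c t w] supp_pt_inner[of I ?c t w'] by (simp add: inner_add_right)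
  moreover have "t * norm (res I (w + w')) \<le> t * norm (res I w) + t * norm (res I w')"
    using t by (metis res_add norm_triangle_ineq distrib_left mult_left_mono)
  moreover have T: "?T (w + w') = ?T w + ?T w'" by (simp add: scl_add res_add)
  ultimately have "norm (?T w + ?T w') = norm (?T w) + norm (?T w')"
    using norm_triangle_ineq[of "?T w" "?T w'"] by (simp add: supp_fun_def)
  then have par: "norm (?T w) *\<^sub>R ?T w' = norm (?T w') *\<^sub>R ?T w"
    by (simp add: norm_triangle_eq)
  then have nn: "norm (?T w) = norm (?T w')"
    using l w w' ss by (auto simp: vec_eq_iff dest!: spec[of _ l])
  have "?T w $ l \<noteq> 0" using l w ss by simp
  then have "?T w \<noteq> 0" by (metis zero_index)
  then have "norm (?T w') \<noteq> 0" unfolding nn[symmetric] norm_eq_zero .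
  then have "?T w = ?T w'" using par unfolding nn by (simp del: norm_eq_zero)
  then have "(c(l := s)) i * w $ i = (c(l := s)) i * w' $ i" if "i \<in> I" for i
    using that by (metis res_nth scl_nth)
  then have "w $ i = w' $ i" if "i \<in> I" for i
    using that c[OF that] ss by (fastforce split: if_splits)
  then have "res I w = res I w'" by (simp add: vec_eq_iff)
  then show "w = w'" using w w' by simp
qed
lemma has_derivative_supp_fun:
  assumes "res I (scl c w) \<noteq> 0" "res I w \<noteq> 0"
  shows "(supp_fun I c t has_derivative (\<lambda>v. supp_pt I c t w \<bullet> v)) (at w)"
proof -
  have "(supp_fun I c t has_derivative (\<lambda>v. res I (scl c v) \<bullet> sgn (res I (scl c w)) +
      t * (res I v \<bullet> sgn (res I w)))) (at w)"
    unfolding supp_fun_def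
    by (intro derivative_intros has_derivative_compose[OF _ has_derivative_norm]
        linear_imp_has_derivative linear_res linear_compose[OF linear_scl linear_res, unfolded
            comp_def] assms)
  moreover have "res I (scl c v) \<bullet> sgn (res I (scl c w)) + t * (res I v \<bullet> sgn (res I w)) =
      supp_pt I c t w \<bullet> v" for v
    unfolding supp_pt_def inner_res_scl_add by (simp add: inner_commute)
  ultimately show ?thesis by simp
qed

lemma continuous_on_supp_fun:
  fixes I :: "'m::finite set"
  shows "continuous_on UNIV (\<lambda>(s, w). supp_fun I (c(l := s)) t w)"
proof -
  have "continuous_on UNIV (\<lambda>x::real \<times> (real ^ 'm). res I (scl (c(l := fst x)) (snd x)))"
    unfolding res_def scl_def vec_lambda_beta
  proof (rule continuous_on_vec_lambda)
    fix i
    show "continuous_on UNIV (\<lambda>x::real \<times> (real ^ 'm).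
        if i \<in> I then (c(l := fst x)) i * snd x $ i else 0)"
      by (cases "i \<in> I"; cases "i = l") (auto intro!: continuous_intros)
  qed
  moreover have "continuous_on UNIV (\<lambda>x::real \<times> (real ^ 'm). res I (snd x))"
    by (intro linear_continuous_on_compose[OF _ linear_res] continuous_intros)
  ultimately show ?thesis
    unfolding supp_fun_def case_prod_unfold by (intro continuous_intros)
qed

text \<open>
  Consider all pairs \<open>(s, w)\<close> for which the hyperplane with normal \<open>w\<close> shows that \<open>x\<close> is not
  interior to the body with parameter \<open>s\<close>. They form a compact set. At a pair with the largest \<open>s\<close>
  the point lies on the boundary: otherwise it would still be separated for a slightly larger \<open>s\<close>.
  So \<open>x \<bullet> w\<close> minus the support function is maximal at \<open>w\<close>, and its derivative, which is
  \<open>x\<close> minus the support point, vanishes.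
\<close>

lemma supp_pt_cover:
  fixes x :: "real ^ 'm"
  assumes l: "l \<in> I" and c: "\<And>i. i \<in> I \<Longrightarrow> 0 < c i" and \<beta>: "c l < \<beta>" and t: "0 \<le> t"
    and x: "x \<in> par_ell I (c(l := \<beta>)) t" "x \<notin> par_ell I c t" "0 < x $ l"
  obtains s w where "c l < s" "s \<le> \<beta>" "res I w = w" "w $ l = 1" "x = supp_pt I (c(l := s)) t w"
proof -
  have rx: "res I x = x" using par_ell_res[OF x(1)] .
  define h where "h s w = supp_fun I (c(l := s)) t w" for s w
  have conth: "continuous_on UNIV (\<lambda>p. h (fst p) (snd p))"
    using continuous_on_supp_fun[of I c l t] by (simp add: h_def case_prod_unfold)
  \<comment> \<open>Normals are restricted to unit vectors for the sake of compactness.\<close>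
  define C where "C = {p \<in> {c l..\<beta>} \<times> sphere 0 1. res I (snd p) = snd p \<and> h (fst p) (snd p) \<le>
      x \<bullet> snd p}"
  have "closed {p::real \<times> (real ^ 'm). res I (snd p) = snd p \<and> h (fst p) (snd p) \<le> x \<bullet> snd p}"
    by (intro closed_Collect_conj closed_Collect_eq closed_Collect_le conth continuous_intros
        linear_continuous_on_compose[OF _ linear_res])
  from compact_Int_closed[OF compact_Times[OF compact_Icc compact_sphere] this]
  have "compact C"
    unfolding C_def Collect_conj_eq[of "\<lambda>p. p \<in> _"] Collect_mem_eq .
  moreover obtain w0 where "res I w0 = w0" "norm w0 = 1" "supp_fun I c t w0 < x \<bullet> w0"
    using not_par_ell_separated[OF x(2) rx t] .
  then have "(c l, w0) \<in> C" using \<beta> by (simp add: C_def h_def)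
  ultimately obtain p where p: "p \<in> C" "\<And>q. q \<in> C \<Longrightarrow> fst q \<le> fst p"
    using continuous_attains_sup[of C fst] continuous_on_fst[OF continuous_on_id] by blast
  obtain s w where sw: "p = (s, w)" by force
  have s: "c l \<le> s" "s \<le> \<beta>" and w: "norm w = 1" "res I w = w" "h s w \<le> x \<bullet> w"
    using p(1) by (auto simp: C_def sw)
  have s0: "0 < s" using c[OF l] s by simp
  have out: "s' \<le> s" if "c l \<le> s'" "s' \<le> \<beta>" "norm w' = 1" "res I w' = w'" "h s' w' \<le> x \<bullet> w'"
      for s' w'
    using p(2)[of "(s', w')"] that by (simp add: C_def sw)
  have mem: "x \<in> par_ell I (c(l := s)) t"
  proof (rule ccontr)
    assume n: "x \<notin> par_ell I (c(l := s)) t"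
    then obtain w' where w': "res I w' = w'" "norm w' = 1" "h s w' < x \<bullet> w'"
      using not_par_ell_separated[OF _ rx t] unfolding h_def by metis
    have "s < \<beta>" using n x(1) s(2) by (cases "s = \<beta>") auto
    have "continuous_on UNIV (\<lambda>s. h s w')"
      using continuous_on_compose2[OF conth, of UNIV "\<lambda>s. (s, w')"] by
          (simp add: continuous_on_Pair)
    then have "((\<lambda>s. h s w') \<longlongrightarrow> h s w') (at_right s)"
      by (meson UNIV_I continuous_on_def tendsto_within_subset subset_UNIV)
    then have "\<forall>\<^sub>F s' in at_right s. h s' w' < x \<bullet> w'"
      by (rule order_tendstoD) (rule w')
    moreover have "\<forall>\<^sub>F s' in at_right s. s' \<in> {s<..<\<beta>}"
      using \<open>s < \<beta>\<close> by (rule eventually_at_right_real)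
    ultimately have "\<forall>\<^sub>F s' in at_right s. h s' w' < x \<bullet> w' \<and> s' \<in> {s<..<\<beta>}"
      by eventually_elim simp
    then obtain s' where "h s' w' < x \<bullet> w'" "s' \<in> {s<..<\<beta>}"
      using eventually_happens'[OF trivial_limit_at_right_real] by blast
    then show False using out[of s' w'] s w' by auto
  qed
  have "res I (scl (c(l := s)) w) \<noteq> 0"
  proof
    assume "res I (scl (c(l := s)) w) = 0"
    then have "(if i \<in> I then (c(l := s)) i * w $ i else 0) = 0" for i
      by (metis res_nth scl_nth zero_index)
    then have "w $ i = 0" if "i \<in> I" for i 
      using \<open>(if i \<in> I then (c(l := s)) i * w $ i else 0) = 0\<close> that c[OF that] s0
      by (auto split: if_splits)
    then have "res I w = 0" by (simp add: vec_eq_iff)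
    then show False using w by auto
  qed
  then have "((\<lambda>w. x \<bullet> w - h s w) has_derivative (\<lambda>v. x \<bullet> v - supp_pt I (c(l :=
      s)) t w \<bullet> v)) (at w)"
    unfolding h_def using w by (intro derivative_intros has_derivative_supp_fun) auto
  moreover have "x \<bullet> w' - h s w' \<le> x \<bullet> w - h s w" for w'
    using par_ell_le_supp_fun[OF mem t, of w'] w(3) by (simp add: h_def)
  ultimately have "(\<lambda>v. x \<bullet> v - supp_pt I (c(l := s)) t w \<bullet> v) = (\<lambda>v. 0)"
    using differential_zero_maxmin[of w UNIV] by simp
  then have "(x - supp_pt I (c(l := s)) t w) \<bullet> v = 0" for v
    by (auto simp: inner_diff_left dest: fun_cong[of _ _ v])
  then have xeq: "x = supp_pt I (c(l := s)) t w"
    using inner_eq_zero_iff by (metis right_minus_eq)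
  have "0 < w $ l"
  proof (rule ccontr)
    assume "\<not> 0 < w $ l"
    then have "supp_pt I (c(l := s)) t w $ l \<le> 0"
      using t by (simp add: supp_pt_nth mult_nonneg_nonpos)
    then show False using x(3) xeq by simp
  qed
  moreover have "s \<noteq> c l" using mem x(2) by auto
  ultimately show ?thesis
    using that[of s "(1 / w $ l) *\<^sub>R w"] s w xeq supp_pt_scaleR[of "1 / w $ l" I "c(l := s)" t w]
    by (simp add: res_scaleR)
qed

section \<open>Sweeping out the region gained by enlarging one semi-axis\<close>

text \<open>
  The normal with \<open>l\<close>-th coordinate 1 whose other coordinates in \<open>I\<close> are those of \<open>x\<close>. The slot
  \<open>x $ l\<close>, which is thereby free, carries the length of the varying semi-axis.
\<close>

definition chart :: "'m set \<Rightarrow> 'm \<Rightarrow> real ^ 'm \<Rightarrow> real ^ 'm" where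
  "chart I l x = (\<chi> i. if i = l then 1 else if i \<in> I then x $ i else 0)"

text \<open>
  The boundary point belonging to semi-axis \<open>x $ l\<close> and normal \<open>chart I l x\<close>. Coordinates outside
  \<open>I\<close> are those of the unit cube and are kept.
\<close>

definition sweep :: "'m set \<Rightarrow> ('m \<Rightarrow> real) \<Rightarrow> 'm \<Rightarrow> real \<Rightarrow> real ^ 'm \<Rightarrow> real ^ 'm" where
  "sweep I c l t x = supp_pt I (c(l := x $ l)) t (chart I l x) + res (- I) x"

text \<open>
  The square of the support function of the ellipsoid at \<open>chart I l x\<close>, when its \<open>l\<close>-th semi-axis is
  \<open>x $ l\<close>.
\<close>

definition ell_sq :: "'m set \<Rightarrow> ('m \<Rightarrow> real) \<Rightarrow> 'm \<Rightarrow> real ^ 'm \<Rightarrow> real" where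
  "ell_sq I c l x = (x $ l)\<^sup>2 + (\<Sum>i\<in>I - {l}. (c i * x $ i)\<^sup>2)"

definition chart_sq :: "'m set \<Rightarrow> 'm \<Rightarrow> real ^ 'm \<Rightarrow> real" where
  "chart_sq I l x = 1 + (\<Sum>i\<in>I - {l}. (x $ i)\<^sup>2)"

definition sweep_deriv ::
  "'m set \<Rightarrow> ('m \<Rightarrow> real) \<Rightarrow> 'm \<Rightarrow> real \<Rightarrow> real ^ 'm \<Rightarrow> real ^ 'm \<Rightarrow> real ^ 'm" where
  "sweep_deriv I c l t x h = (let r = sqrt (ell_sq I c l x); q = sqrt (chart_sq I l x);
      dr = - (x $ l * h $ l + (\<Sum>j\<in>I - {l}. (c j)\<^sup>2 * x $ j * h $ j)) / r ^ 3;
      dq = - (\<Sum>j\<in>I - {l}. x $ j * h $ j) / q ^ 3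
    in (\<chi> i. if i = l then 2 * x $ l * h $ l / r + (x $ l)\<^sup>2 * dr + t * dq
        else if i \<in> I then (c i)\<^sup>2 * (h $ i / r + x $ i * dr) + t * (h $ i / q + x $ i * dq)
        else h $ i))"

lemma chart_sq_pos: "0 < chart_sq I l x"
  unfolding chart_sq_def by (smt (verit) sum_nonneg zero_le_power2)

lemma ell_sq_pos: "0 < x $ l \<Longrightarrow> 0 < ell_sq I c l x"
  unfolding ell_sq_def by (smt (verit) sum_nonneg zero_le_power2 zero_less_power2)

lemma sweep_nth:
  fixes x :: "real ^ 'm"
  assumes "l \<in> I"
  shows "sweep I c l t x $ i = (if i = l then
      (x $ l)\<^sup>2 * (1 / sqrt (ell_sq I c l x)) + t * (1 / sqrt (chart_sq I l x))
    else if i \<in> I then (c i)\<^sup>2 * (x $ i * (1 / sqrt (ell_sq I c l x))) + t * (x $ i * (1 / sqrt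
        (chart_sq I l x)))
    else x $ i)"
proof -
  have "norm (res I (scl (c(l := x $ l)) (chart I l x))) = sqrt (ell_sq I c l x)"
    unfolding norm_res_scl ell_sq_def using assms by (simp add: sum.remove[of I l] chart_def)
  moreover have "norm (res I (chart I l x)) = sqrt (chart_sq I l x)"
    unfolding norm_res chart_sq_def using assms by (simp add: sum.remove[of I l] chart_def)
  ultimately show ?thesis
    using assms by (simp add: sweep_def supp_pt_nth) (simp add: chart_def algebra_simps)
qed

lemma has_derivative_inverse_sqrt:
  assumes "(g has_derivative g') (at x within S)" "0 < g x"
  shows "((\<lambda>x. 1 / sqrt (g x)) has_derivative (\<lambda>h. - (g' h / 2) / sqrt (g x) ^ 3)) (at x within S)"
proof -
  have "((\<lambda>u. 1 / sqrt u) has_field_derivative - (1 / 2) / sqrt (g x) ^ 3) (at (g x))"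
    using assms(2)
    by (auto intro!: derivative_eq_intros simp: field_simps power2_eq_square power3_eq_cube)
  from DERIV_compose_FDERIV[OF this assms(1)] show ?thesis by simp
qed

lemma has_derivative_sweep:
  fixes x :: "real ^ 'm"
  assumes l: "l \<in> I" and x: "0 < x $ l"
  shows "(sweep I c l t has_derivative sweep_deriv I c l t x) (at x within S)"
proof -
  have n: "((\<lambda>x. x $ i) has_derivative (\<lambda>h. h $ i)) (at x within S)" for i :: 'm
    by (rule bounded_linear_imp_has_derivative) auto
  have "(ell_sq I c l has_derivative (\<lambda>h. 2 * (x $ l * h $ l + (\<Sum>j\<in>I - {l}. (c j)\<^sup>2 * x $ j *
      h $ j)))) (at x within S)"
    unfolding ell_sq_def
    by (rule derivative_eq_intros n refl ext)+
        (simp add: algebra_simps sum_distrib_left power2_eq_square)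
  from has_derivative_inverse_sqrt[OF this ell_sq_pos[OF x]]
  have r: "((\<lambda>x. 1 / sqrt (ell_sq I c l x)) has_derivative
     (\<lambda>h. - (x $ l * h $ l + (\<Sum>j\<in>I - {l}. (c j)\<^sup>2 * x $ j * h $ j)) / sqrt (ell_sq I c l x) ^ 3))
         (at x within S)"
    unfolding nonzero_mult_div_cancel_left[OF zero_neq_numeral[symmetric]] .
  have "(chart_sq I l has_derivative (\<lambda>h. 2 * (\<Sum>j\<in>I - {l}. x $ j * h $ j))) (at x within S)"
    unfolding chart_sq_def
    by (rule derivative_eq_intros n refl ext)+ (simp add: algebra_simps sum_distrib_left)
  from has_derivative_inverse_sqrt[OF this chart_sq_pos]
  have q: "((\<lambda>x. 1 / sqrt (chart_sq I l x)) has_derivative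
     (\<lambda>h. - (\<Sum>j\<in>I - {l}. x $ j * h $ j) / sqrt (chart_sq I l x) ^ 3)) (at x within S)"
    unfolding nonzero_mult_div_cancel_left[OF zero_neq_numeral[symmetric]] .
  have gen: "((\<lambda>x. (x $ l)\<^sup>2 * u x + t * v x) has_derivative
        (\<lambda>h. 2 * x $ l * h $ l * u x + (x $ l)\<^sup>2 * u' h + t * v' h)) (at x within S)"
      "((\<lambda>x. a * (x $ i * u x) + t * (x $ i * v x)) has_derivative
        (\<lambda>h. a * (h $ i * u x + x $ i * u' h) + t * (h $ i * v x + x $ i * v' h))) (at x within S)"
    if "(u has_derivative u') (at x within S)" "(v has_derivative v') (at x within S)"
        for u u' v v' a i
    by (rule derivative_eq_intros n that refl ext | simp add: algebra_simps)+
  have "((\<lambda>x. sweep I c l t x $ i) has_derivative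
      (\<lambda>h. sweep_deriv I c l t x h $ i)) (at x within S)" for i
    unfolding sweep_nth[OF l] sweep_deriv_def Let_def vec_lambda_beta
    using gen(1)[OF r q] gen(2)[OF r q, of "(c i)\<^sup>2" i] n[of i]
    by (cases "i = l"; cases "i \<in> I") simp_all
  then show ?thesis
    unfolding has_derivative_componentwise_within[of "sweep I c l t"]
    by (auto simp: Basis_vec_def inner_axis)
qed

text \<open>
  The vectors whose rank-one matrices generate the Jacobian. An off-diagonal pair \<open>(p, q)\<close> in
  \<open>I\<close> gives \<open>w q * axis p - w p * axis q\<close> with the \<open>l\<close>-th coordinate removed, where \<open>w\<close> is the normal. The
  diagonal pairs with index \<open>l\<close> or outside \<open>I\<close> complete the matrix by ones on the diagonal.
\<close>

definition pair_vec :: "'m set \<Rightarrow> 'm \<Rightarrow> real ^ 'm \<Rightarrow> 'm \<times> 'm \<Rightarrow> real ^ 'm" where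
  "pair_vec I l x = (\<lambda>(p, q). if p = q then (if p \<in> I - {l} then 0 else axis p 1)
     else if p \<in> I \<and> q \<in> I then (\<chi> i. if i = l then 0 else
       (if i = p then chart I l x $ q else 0) - (if i = q then chart I l x $ p else 0))
     else 0)"

text \<open>
  Lagrange's identity: with \<open>r\<^sup>2 = (\<Sum>p\<in>I. (c p * w p)\<^sup>2)\<close>, the Hessian of \<open>r\<close> as a function of \<open>w\<close> is
  the sum of the rank-one matrices of all pairs \<open>(p, q)\<close> with weights
  \<open>(c p)\<^sup>2 * (c q)\<^sup>2 / (2 * r ^ 3)\<close>. The factor 2 accounts for \<open>(p, q)\<close> and \<open>(q, p)\<close>. The weights
  of the Hessian of the norm are the case \<open>c p = 1\<close>. The diagonal weights, 1 here and 0 in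
  \<open>ball_wt\<close>, keep the completing ones free of \<open>t\<close>.
\<close>

definition ell_wt :: "'m set \<Rightarrow> ('m \<Rightarrow> real) \<Rightarrow> 'm \<Rightarrow> real ^ 'm \<Rightarrow> 'm \<times> 'm \<Rightarrow> real" where
  "ell_wt I c l x = (\<lambda>(p, q). if p = q then 1
     else ((c(l := x $ l)) p)\<^sup>2 * ((c(l := x $ l)) q)\<^sup>2 / (2 * sqrt (ell_sq I c l x) ^ 3))"

definition ball_wt :: "'m set \<Rightarrow> 'm \<Rightarrow> real ^ 'm \<Rightarrow> 'm \<times> 'm \<Rightarrow> real" where
  "ball_wt I l x = (\<lambda>(p, q). if p = q then 0 else 1 / (2 * sqrt (chart_sq I l x) ^ 3))"

lemma sum_pair_products:
  fixes w g :: "'m::finite \<Rightarrow> real"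
  assumes "i \<in> I" "j \<in> I"
  shows "(\<Sum>p\<in>I. \<Sum>q\<in>I. g p * g q *
      ((if i = p then w q else 0) - (if i = q then w p else 0)) *
      ((if j = p then w q else 0) - (if j = q then w p else 0))) =
    2 * ((if i = j then g i * (\<Sum>q\<in>I. g q * (w q)\<^sup>2) else 0) - g i * g j * w i * w j)"
proof -
  have "g p * g q * ((if i = p then w q else 0) - (if i = q then w p else 0)) *
      ((if j = p then w q else 0) - (if j = q then w p else 0)) =
    (if i = p then if i = j then g i * (g q * (w q)\<^sup>2) else 0 else 0)
    - (if i = p then if j = q then g i * g j * w i * w j else 0 else 0)
    - (if j = p then if i = q then g i * g j * w i * w j else 0 else 0)
    + (if i = q then if i = j then g i * (g p * (w p)\<^sup>2) else 0 else 0)" for p q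
    by (auto simp: algebra_simps power2_eq_square)
  moreover have "(\<Sum>p\<in>I. \<Sum>q\<in>I. (if i = p then if i = j then g i * (g q * (w q)\<^sup>2) else 0 else 0)) =
      (if i = j then g i * (\<Sum>q\<in>I. g q * (w q)\<^sup>2) else 0)"
    using assms by (subst sum.swap) (simp add: sum_distrib_left)
  moreover have "(\<Sum>p\<in>I. \<Sum>q\<in>I. (if i = q then if i = j then g i * (g p * (w p)\<^sup>2) else 0 else 0)) =
      (if i = j then g i * (\<Sum>q\<in>I. g q * (w q)\<^sup>2) else 0)"
    using assms by (simp add: sum_distrib_left)
  moreover have "(\<Sum>p\<in>I. \<Sum>q\<in>I. (if i = p then if j = q then g i * g j * w i * w j else 0 else 0)) =
      g i * g j * w i * w j"
    using assms by (subst sum.swap) simp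
  moreover have "(\<Sum>p\<in>I. \<Sum>q\<in>I. (if j = p then if i = q then g i * g j * w i * w j else 0 else 0)) =
      g i * g j * w i * w j"
    using assms by (subst sum.swap) simp
  ultimately show ?thesis by (simp add: sum.distrib sum_subtractf)
qed

text \<open>
  The matrix \<open>P + t * Q\<close> of the two Hessians, with row and column \<open>l\<close> and those outside \<open>I\<close> replaced
  by the ones of the identity matrix.
\<close>

definition sweep_gram :: "'m set \<Rightarrow> ('m \<Rightarrow> real) \<Rightarrow> 'm \<Rightarrow> real \<Rightarrow> real ^ 'm \<Rightarrow> real ^ 'm ^ 'm" where
  "sweep_gram I c l t x = (\<chi> i j. \<Sum>m\<in>UNIV. (ell_wt I c l x m + t * ball_wt I l x m) *
     pair_vec I l x m $ i * pair_vec I l x m $ j)"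

lemma sweep_gram_nth:
  fixes x :: "real ^ 'm"
  assumes l: "l \<in> I" and x: "0 < x $ l"
  shows "sweep_gram I c l t x $ i $ j =
    (if i \<in> I - {l} \<and> j \<in> I - {l} then
      (if i = j then (c i)\<^sup>2 / sqrt (ell_sq I c l x) + t / sqrt (chart_sq I l x) else 0)
       - (c i)\<^sup>2 * (c j)\<^sup>2 * x $ i * x $ j / sqrt (ell_sq I c l x) ^ 3
       - t * x $ i * x $ j / sqrt (chart_sq I l x) ^ 3
     else if i = j then 1 else 0)"
proof -
  define r where "r = sqrt (ell_sq I c l x)"
  define q where "q = sqrt (chart_sq I l x)"
  define w where "w p = chart I l x $ p" for p
  define d where "d = c(l := x $ l)"
  have pos: "0 < r" "0 < q" using ell_sq_pos[OF x] chart_sq_pos by (simp_all add: r_def q_def)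
  have r2: "(\<Sum>p\<in>I. (d p)\<^sup>2 * (w p)\<^sup>2) = r\<^sup>2"
    using l pos ell_sq_pos[where I=I and c=c, OF x]
    by (simp add: r_def ell_sq_def sum.remove[of I l] d_def w_def chart_def power_mult_distrib)
  have q2: "(\<Sum>p\<in>I. 1 * (w p)\<^sup>2) = q\<^sup>2"
    using l pos chart_sq_pos[of I l x]
    by (simp add: q_def chart_sq_def sum.remove[of I l] w_def chart_def)
  define E where "E i p q = (if i = p then w q else 0) - (if i = q then w p else 0)" for i p q :: 'm
  let ?f = "\<lambda>p q. (ell_wt I c l x (p, q) + t * ball_wt I l x (p, q)) *
     pair_vec I l x (p, q) $ i * pair_vec I l x (p, q) $ j"
  have diag: "?f p p = (if p \<in> I - {l} then 0 else if i = p \<and> j = p then 1 else 0)" for p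
    by (auto simp: ell_wt_def ball_wt_def pair_vec_def axis_def)
  have off: "?f p p' = (if p \<in> I \<and> p' \<in> I \<and> i \<noteq> l \<and> j \<noteq> l then
      ((d p)\<^sup>2 * (d p')\<^sup>2 * E i p p' * E j p p') / (2 * r ^ 3) + t * (1 * 1 * E i p p' * E j p p')
          / (2 * q ^ 3) else 0)"
    if "p \<noteq> p'" for p p'
    using that pos
    by (simp add: ell_wt_def ball_wt_def pair_vec_def E_def d_def w_def r_def q_def field_simps)
  have E0: "E i p p = 0" for i p by (simp add: E_def)
  have "sweep_gram I c l t x $ i $ j = (\<Sum>p\<in>UNIV. \<Sum>p'\<in>UNIV. ?f p p')"
    unfolding sweep_gram_def vec_lambda_beta UNIV_Times_UNIV[symmetric]
    by (subst sum.cartesian_product) (simp add: case_prod_unfold)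
  also have "\<dots> = (\<Sum>p\<in>UNIV. \<Sum>p'\<in>UNIV.
      (if p = p' then if p \<in> I - {l} then 0 else if i = p \<and> j = p then 1 else 0 else 0) +
      (if p \<in> I then if p' \<in> I then if i \<noteq> l \<and> j \<noteq> l then
      ((d p)\<^sup>2 * (d p')\<^sup>2 * E i p p' * E j p p') / (2 * r ^ 3) + t * (1 * 1 * E i p p' * E j p p')
          / (2 * q ^ 3) else 0 else 0 else 0))"
  proof (intro sum.cong refl)
    fix p p'
    show "?f p p' = (if p = p' then if p \<in> I - {l} then 0 else if i = p \<and> j = p then 1 else 0 else
        0) +
      (if p \<in> I then if p' \<in> I then if i \<noteq> l \<and> j \<noteq> l then
      ((d p)\<^sup>2 * (d p')\<^sup>2 * E i p p' * E j p p') / (2 * r ^ 3) + t * (1 * 1 * E i p p' * E j p p')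
          / (2 * q ^ 3) else 0 else 0 else 0)"
    proof (cases "p = p'")
      case True
      then show ?thesis unfolding True diag by (simp add: E0)
    next
      case False
      then show ?thesis unfolding off[OF False] by auto
    qed
  qed
  also have "\<dots> = (if i = j \<and> i \<notin> I - {l} then 1 else 0) +
     (\<Sum>p\<in>I. \<Sum>p'\<in>I. if i \<noteq> l \<and> j \<noteq> l then
      ((d p)\<^sup>2 * (d p')\<^sup>2 * E i p p' * E j p p') / (2 * r ^ 3) + t * (1 * 1 * E i p p' * E j p p')
          / (2 * q ^ 3) else 0)"
  proof -
    have [simp]: "(if i = p \<and> j = p then 1 else 0) = (if i = p then if i = j then 1 else 0 else
        (0::real))" for p
      by auto
    have "(\<Sum>p\<in>UNIV. \<Sum>p'\<in>UNIV.
      (if p = p' then if p \<in> I - {l} then 0 else if i = p \<and> j = p then 1 else 0 else 0)) =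
      (\<Sum>p\<in>UNIV. if i = p then if i = j \<and> i \<notin> I - {l} then 1 else 0 else (0::real))"
      by (intro sum.cong) auto
    moreover have "(\<Sum>p\<in>UNIV. \<Sum>p'\<in>UNIV. (if p \<in> I then if p' \<in> I then g p p' else 0 else 0)) =
       (\<Sum>p\<in>I. \<Sum>p'\<in>I. g p p')" for g :: "'m \<Rightarrow> 'm \<Rightarrow> real"
    proof -
      have "(\<Sum>p\<in>UNIV. \<Sum>p'\<in>UNIV. (if p \<in> I then if p' \<in> I then g p p' else 0 else 0)) =
         (\<Sum>p\<in>UNIV. if p \<in> I then \<Sum>p'\<in>UNIV. if p' \<in> I then g p p' else 0 else 0)"
        by (intro sum.cong) auto
      then show ?thesis by (simp flip: sum.inter_restrict add: sum.If_cases)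
    qed
    ultimately show ?thesis by (simp only: sum.distrib) simp
  qed
  also have "\<dots> = (if i \<in> I - {l} \<and> j \<in> I - {l} then
      (if i = j then (c i)\<^sup>2 / r + t / q else 0)
       - (c i)\<^sup>2 * (c j)\<^sup>2 * x $ i * x $ j / r ^ 3 - t * x $ i * x $ j / q ^ 3
     else if i = j then 1 else 0)"
  proof (cases "i \<in> I - {l} \<and> j \<in> I - {l}")
    case True
    then have ij: "i \<in> I" "j \<in> I" "i \<noteq> l" "j \<noteq> l" by auto
    note S = sum_pair_products[OF ij(1,2), of "\<lambda>p. (d p)\<^sup>2" w, folded E_def, unfolded r2]
      sum_pair_products[OF ij(1,2), of "\<lambda>p. 1" w, folded E_def, unfolded q2]
    have "(\<Sum>p\<in>I. \<Sum>p'\<in>I. if i \<noteq> l \<and> j \<noteq> l then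
      ((d p)\<^sup>2 * (d p')\<^sup>2 * E i p p' * E j p p') / (2 * r ^ 3) + t * (1 * 1 * E i p p' * E j p p')
          / (2 * q ^ 3) else 0) =
      (\<Sum>p\<in>I. \<Sum>p'\<in>I. (d p)\<^sup>2 * (d p')\<^sup>2 * E i p p' * E j p p') / (2 * r ^ 3) +
      t * (\<Sum>p\<in>I. \<Sum>p'\<in>I. 1 * 1 * E i p p' * E j p p') / (2 * q ^ 3)"
      using ij by (simp add: sum.distrib sum_divide_distrib sum_distrib_left)
    also have "\<dots> = (if i = j then (c i)\<^sup>2 / r + t / q else 0)
       - (c i)\<^sup>2 * (c j)\<^sup>2 * x $ i * x $ j / r ^ 3 - t * x $ i * x $ j / q ^ 3"
      unfolding S using ij pos
      by (simp add: d_def w_def chart_def field_simps power2_eq_square power3_eq_cube)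
    finally show ?thesis using True by simp
  next
    case False
    have Z: "E i p p' = 0" if "i \<notin> I" "p \<in> I" "p' \<in> I" for i p p'
      using that by (auto simp: E_def)
    show ?thesis using False by (auto intro!: sum.neutral simp: Z)
  qed
  finally show ?thesis unfolding r_def q_def .
qed

section \<open>The Jacobian as a polynomial in the distance\<close>

lemma det_cong_axis_row:
  fixes A B :: "real ^ 'm ^ 'm"
  assumes "A $ l = axis l 1" "\<And>i j. i \<noteq> l \<Longrightarrow> j \<noteq> l \<Longrightarrow> A $ i $ j = B $ i $ j"
    and "B $ l = axis l 1"
  shows "det A = det B"
  unfolding det_def
proof (intro sum.cong refl)
  fix p assume "p \<in> {p. p permutes (UNIV :: 'm set)}"
  then have p: "inj p" by (simp add: permutes_inj)
  show "of_int (sign p) * (\<Prod>i\<in>UNIV. A $ i $ p i) = of_int (sign p) * (\<Prod>i\<in>UNIV. B $ i $ p i)"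
  proof (cases "p l = l")
    case True
    have "A $ i $ p i = B $ i $ p i" for i
    proof (cases "i = l")
      case True
      then show ?thesis using assms by simp
    next
      case False
      then have "p i \<noteq> l" using p True by (metis injD)
      then show ?thesis using assms(2) False by blast
    qed
    then show ?thesis by simp
  next
    case False
    then have "(\<Prod>i\<in>UNIV. A $ i $ p i) = 0" "(\<Prod>i\<in>UNIV. B $ i $ p i) = 0"
      using assms by (auto intro!: prod_zero[OF finite] exI[of _ l] simp: axis_def)
    then show ?thesis by (simp only:)
  qed
qed

lemma matrix_sweep_deriv_nth:
  fixes x :: "real ^ 'm"
  assumes l: "l \<in> I"
  shows "matrix (sweep_deriv I c l t x) $ i $ j =
   (let r = sqrt (ell_sq I c l x); q = sqrt (chart_sq I l x);
      dr = (if j = l then - x $ l else if j \<in> I then - (c j)\<^sup>2 * x $ j else 0) / r ^ 3;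
      dq = (if j \<in> I - {l} then - x $ j else 0) / q ^ 3
    in if i = l then (if j = l then 2 * x $ l / r else 0) + (x $ l)\<^sup>2 * dr + t * dq
       else if i \<in> I then (c i)\<^sup>2 * ((if i = j then 1 / r else 0) + x $ i * dr)
          + t * ((if i = j then 1 / q else 0) + x $ i * dq)
       else if i = j then 1 else 0)"
proof -
  have s: "(\<Sum>k\<in>I - {l}. f k * (axis j 1 :: real ^ 'm) $ k) = (if j \<in> I - {l} then f j else 0)" for f
  proof -
    have "(\<Sum>k\<in>I - {l}. f k * (axis j 1 :: real ^ 'm) $ k) = (\<Sum>k\<in>I - {l}. if k = j then f k else 0)"
      by (intro sum.cong) (auto simp: axis_def)
    also have "\<dots> = (if j \<in> I - {l} then f j else 0)"
      by (rule sum.delta) simp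
    finally show ?thesis .
  qed
  show ?thesis
    unfolding matrix_def sweep_deriv_def vec_lambda_beta Let_def s
    using l by (auto simp: axis_def)
qed

text \<open>
  The support function is homogeneous of degree 1, so its gradient is homogeneous of degree 0 and
  every derivative of the support point along the chart is orthogonal to the normal \<open>w\<close>, whereas
  differentiating \<open>supp_pt \<bullet> w = supp_fun w\<close> in the semi-axis leaves the derivative \<open>x $ l / r\<close> of
  the support function. Adding to row \<open>l\<close> the other rows with weights \<open>w i\<close> therefore clears
  that row up to the entry \<open>x $ l / r\<close>.
\<close>

lemma det_sweep_deriv:
  fixes x :: "real ^ 'm"
  assumes l: "l \<in> I" and x: "0 < x $ l"
  shows "det (matrix (sweep_deriv I c l t x)) =
    x $ l / sqrt (ell_sq I c l x) * det (sweep_gram I c l t x)"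
proof -
  define J where "J = matrix (sweep_deriv I c l t x)"
  define r where "r = sqrt (ell_sq I c l x)"
  define q where "q = sqrt (chart_sq I l x)"
  have pos: "0 < r" "0 < q" using ell_sq_pos[OF x] chart_sq_pos by (simp_all add: r_def q_def)
  have r2: "(\<Sum>i\<in>I - {l}. (c i)\<^sup>2 * (x $ i)\<^sup>2) = r\<^sup>2 - (x $ l)\<^sup>2"
    using ell_sq_pos[where I=I and c=c, OF x] by (simp add: r_def ell_sq_def power_mult_distrib)
  have q2: "(\<Sum>i\<in>I - {l}. (x $ i)\<^sup>2) = q\<^sup>2 - 1"
    using chart_sq_pos[of I l x] by (simp add: q_def chart_sq_def)
  have Jnth: "J $ i $ j = (let dr = (if j = l then - x $ l else if j \<in> I then
      - (c j)\<^sup>2 * x $ j else 0) / r ^ 3;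
      dq = (if j \<in> I - {l} then - x $ j else 0) / q ^ 3
    in if i = l then (if j = l then 2 * x $ l / r else 0) + (x $ l)\<^sup>2 * dr + t * dq
       else if i \<in> I then (c i)\<^sup>2 * ((if i = j then 1 / r else 0) + x $ i * dr)
          + t * ((if i = j then 1 / q else 0) + x $ i * dq)
       else if i = j then 1 else 0)" for i j
    unfolding J_def matrix_sweep_deriv_nth[OF l] Let_def r_def q_def ..
  define y where "y = (\<Sum>i\<in>I - {l}. x $ i *s row i J)"
  have "y \<in> vec.span {row j J |j. j \<noteq> l}"
    unfolding y_def by (intro vec.span_sum vec.span_scale vec.span_base) auto
  from det_row_span[OF this]
  have "det J = det (\<chi> k. if k = l then row l J + y else row k J)" ..
  also have "row l J + y = (x $ l / r) *s axis l 1"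
  proof (rule vec_eq_iff[THEN iffD2], rule allI)
    fix j
    define dr where "dr = (if j = l then - x $ l else if j \<in> I then - (c j)\<^sup>2 * x $ j else
        0) / r ^ 3"
    define dq where "dq = (if j \<in> I - {l} then - x $ j else 0) / q ^ 3"
    have "y $ j = (\<Sum>i\<in>I - {l}. x $ i * ((c i)\<^sup>2 * ((if i = j then 1 / r else 0) + x $ i * dr)
          + t * ((if i = j then 1 / q else 0) + x $ i * dq)))"
      unfolding y_def sum_component vector_smult_component row_def vec_lambda_beta Jnth Let_def
          dr_def dq_def
      by (intro sum.cong) auto
    also have "\<dots> = (\<Sum>i\<in>I - {l}. (if i = j then x $ i * ((c i)\<^sup>2 / r + t / q) else 0)
         + (dr * ((c i)\<^sup>2 * (x $ i)\<^sup>2) + t * dq * (x $ i)\<^sup>2))"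
      by (intro sum.cong) (auto simp: algebra_simps power2_eq_square)
    also have "\<dots> = (if j \<in> I - {l} then x $ j * ((c j)\<^sup>2 / r + t / q) else 0)
        + dr * (r\<^sup>2 - (x $ l)\<^sup>2) + t * dq * (q\<^sup>2 - 1)"
      unfolding sum.distrib by (simp flip: sum_distrib_left add: r2 q2)
    finally have y: "y $ j = \<dots>" .
    have "(row l J + y) $ j = (if j = l then 2 * x $ l / r else
        0) + (x $ l)\<^sup>2 * dr + t * dq + y $ j"
      by (simp add: row_def Jnth Let_def dr_def dq_def)
    also have "\<dots> = (if j = l then x $ l / r else 0)"
      unfolding y dr_def dq_def using pos
      by (auto simp: field_simps power2_eq_square power3_eq_cube)
    finally show "(row l J + y) $ j = ((x $ l / r) *s axis l 1) $ j"
      by (simp add: axis_def)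
  qed
  also have "det (\<chi> k. if k = l then (x $ l / r) *s axis l 1 else row k J) =
      x $ l / r * det (\<chi> k. if k = l then axis l 1 else row k J)"
    by (rule det_row_mul)
  also have "det (\<chi> k. if k = l then axis l 1 else row k J) = det (sweep_gram I c l t x)"
  proof (rule det_cong_axis_row[of _ l])
    show "sweep_gram I c l t x $ l = axis l 1"
      unfolding vec_eq_iff sweep_gram_nth[OF l x] by (auto simp: axis_def)
  next
    fix i j assume "i \<noteq> l" "j \<noteq> l"
    then show "(\<chi> k. if k = l then axis l 1 else row k J) $ i $ j = sweep_gram I c l t x $ i $ j"
      unfolding sweep_gram_nth[OF l x] by (auto simp: row_def Jnth Let_def r_def q_def
          algebra_simps)
  qed simp
  finally show ?thesis by (simp add: J_def r_def)
qed

text \<open>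
  The coefficient of \<open>t ^ j\<close> in the Jacobian determinant: \<open>X\<close> is the set of rows for which the weight
  with the factor \<open>t\<close> is chosen.
\<close>

definition jac_coeff ::
  "'m set \<Rightarrow> ('m \<Rightarrow> real) \<Rightarrow> 'm \<Rightarrow> nat \<Rightarrow> real ^ 'm \<Rightarrow> real" where
  "jac_coeff I c l j x = x $ l / sqrt (ell_sq I c l x) / fact CARD('m) *
    (\<Sum>f\<in>UNIV. \<Sum>X | card X = j. (\<Prod>i\<in>X. ball_wt I l x (f i)) *
      (\<Prod>i\<in>- X. ell_wt I c l x (f i)) * (det (\<chi> i. pair_vec I l x (f i)))\<^sup>2)"

lemma det_sweep_deriv_poly:
  fixes x :: "real ^ 'm"
  assumes l: "l \<in> I" and x: "0 < x $ l"
  shows "det (matrix (sweep_deriv I c l t x)) = (\<Sum>j\<le>CARD('m). jac_coeff I c l j x * t ^ j)"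
proof -
  have "(\<Prod>i\<in>UNIV. ell_wt I c l x (f i) + t * ball_wt I l x (f i)) =
    (\<Sum>j\<le>CARD('m). t ^ j * (\<Sum>X | card X = j. (\<Prod>i\<in>X. ball_wt I l x (f i)) *
      (\<Prod>i\<in>- X. ell_wt I c l x (f i))))" for f :: "'m \<Rightarrow> 'm \<times> 'm"
  proof -
    have "(\<Prod>i\<in>UNIV. ell_wt I c l x (f i) + t * ball_wt I l x (f i)) =
      (\<Sum>X\<in>UNIV. (\<Prod>i\<in>X. t * ball_wt I l x (f i)) * (\<Prod>i\<in>- X. ell_wt I c l x (f i)))"
      using prod_add[of UNIV "\<lambda>i. t * ball_wt I l x (f i)" "\<lambda>i. ell_wt I c l x (f i)"]
      by (simp add: add.commute Compl_eq_Diff_UNIV)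
    also have "\<dots> = (\<Sum>X\<in>UNIV. t ^ card X * ((\<Prod>i\<in>X. ball_wt I l x (f i)) *
        (\<Prod>i\<in>- X. ell_wt I c l x (f i))))"
      by (simp add: prod.distrib mult.assoc)
    also have "\<dots> = (\<Sum>j\<le>CARD('m). \<Sum>X | X \<in> UNIV \<and> card X = j.
        t ^ card X * ((\<Prod>i\<in>X. ball_wt I l x (f i)) * (\<Prod>i\<in>- X. ell_wt I c l x (f i))))"
      by (rule sum.group[symmetric]) (auto intro: card_mono)
    finally show ?thesis by (simp add: sum_distrib_left)
  qed
  then have "fact CARD('m) * det (sweep_gram I c l t x) = (\<Sum>f\<in>UNIV.
    (\<Sum>j\<le>CARD('m). t ^ j * (\<Sum>X | card X = j. (\<Prod>i\<in>X. ball_wt I l x (f i)) *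
      (\<Prod>i\<in>- X. ell_wt I c l x (f i)))) * (det (\<chi> i. pair_vec I l x (f i)))\<^sup>2)"
    unfolding sweep_gram_def by (subst det_weighted_sum_rank_one) auto
  also have "\<dots> = (\<Sum>j\<le>CARD('m). t ^ j * (\<Sum>f\<in>UNIV. \<Sum>X | card X = j. (\<Prod>i\<in>X. ball_wt I l x (f i)) *
      (\<Prod>i\<in>- X. ell_wt I c l x (f i)) * (det (\<chi> i. pair_vec I l x (f i)))\<^sup>2))"
    unfolding sum_distrib_left sum_distrib_right by (subst sum.swap) (simp add: mult.assoc)
  finally have "det (sweep_gram I c l t x) = (\<Sum>j\<le>CARD('m). t ^ j * (\<Sum>f\<in>UNIV. \<Sum>X | card X =
      j. (\<Prod>i\<in>X. ball_wt I l x (f i)) *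
      (\<Prod>i\<in>- X. ell_wt I c l x (f i)) * (det (\<chi> i. pair_vec I l x (f i)))\<^sup>2)) / fact CARD('m)"
    by (simp add: field_simps)
  then show ?thesis
    unfolding det_sweep_deriv[OF l x] jac_coeff_def
    by (simp add: sum_distrib_left sum_divide_distrib ac_simps)
qed

lemma jac_coeff_nonneg:
  assumes "0 < x $ l"
  shows "0 \<le> jac_coeff I c l j x"
proof -
  have "0 \<le> ell_wt I c l x m" "0 \<le> ball_wt I l x m" for m
    using ell_sq_pos[where I=I and c=c, OF assms] chart_sq_pos[of I l x]
    by (auto simp: ell_wt_def ball_wt_def split: prod.split)
  then show ?thesis
    unfolding jac_coeff_def using assms ell_sq_pos[where I=I and c=c, OF assms]
    by (intro mult_nonneg_nonneg sum_nonneg prod_nonneg) auto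
qed

text \<open>
  A nonzero determinant needs each of the diagonal vectors, since no other one has a nonzero
  coordinate at that place. These have no \<open>t\<close> in their weight and take up all but at most
  \<open>card I - 1\<close> rows.
\<close>

lemma jac_coeff_eq_0:
  fixes x :: "real ^ 'm"
  assumes l: "l \<in> I" and j: "card I \<le> j"
  shows "jac_coeff I c l j x = 0"
proof -
  have "(\<Prod>i\<in>X. ball_wt I l x (f i)) = 0 \<or> det (\<chi> i. pair_vec I l x (f i)) = 0"
    if X: "card X = j" for X and f :: "'m \<Rightarrow> 'm \<times> 'm"
  proof (rule disjCI)
    assume d: "det (\<chi> i. pair_vec I l x (f i)) \<noteq> 0"
    have "\<exists>i. f i = (p, p)" if p: "p \<notin> I - {l}" for p
    proof (rule ccontr)
      assume n: "\<nexists>i. f i = (p, p)"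
      have "pair_vec I l x m $ p = 0" if "m \<noteq> (p, p)" for m
        using p that by (auto simp: pair_vec_def axis_def split: prod.split)
      then have "column p (\<chi> i. pair_vec I l x (f i)) = 0"
        using n by (simp add: column_def vec_eq_iff)
      then show False using d det_zero_column(2) by blast
    qed
    then obtain g where g: "f (g p) = (p, p)" if "p \<notin> I - {l}" for p by metis
    have "X \<inter> g ` (- (I - {l})) \<noteq> {}"
    proof
      assume "X \<inter> g ` (- (I - {l})) = {}"
      then have "card X + card (g ` (- (I - {l}))) \<le> CARD('m)"
        by (subst card_Un_disjoint[symmetric]) (auto intro: card_mono)
      moreover have "inj_on g (- (I - {l}))"
        by (rule inj_onI) (metis ComplD g prod.inject)
      then have "card (g ` (- (I - {l}))) = CARD('m) - (card I - 1)"
        using l by (simp add: card_image Compl_eq_Diff_UNIV card_Diff_subset card_Diff_singleton)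
      moreover have "0 < card I" "card I \<le> CARD('m)" using l by
          (auto simp: card_gt_0_iff intro: card_mono)
      ultimately show False using X j by linarith
    qed
    then obtain p where "p \<notin> I - {l}" "g p \<in> X" by auto
    then show "(\<Prod>i\<in>X. ball_wt I l x (f i)) = 0"
      using g by (intro prod_zero) (auto simp: ball_wt_def intro!: bexI[of _ "g p"])
  qed
  then have "(\<Prod>i\<in>X. ball_wt I l x (f i)) * (\<Prod>i\<in>- X. ell_wt I c l x (f i)) *
      (det (\<chi> i. pair_vec I l x (f i)))\<^sup>2 = 0" if "card X = j" for X and f :: "'m \<Rightarrow> 'm \<times> 'm"
    using that by (metis mult_zero_left mult_zero_right power_zero_numeral)
  then have "(\<Sum>f\<in>UNIV. \<Sum>X | card X = j. (\<Prod>i\<in>X. ball_wt I l x (f i)) *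
      (\<Prod>i\<in>- X. ell_wt I c l x (f i)) * (det (\<chi> i. pair_vec I l x (f i)))\<^sup>2) = 0"
    by (intro sum.neutral ballI) (simp only: mem_Collect_eq)
  then show ?thesis unfolding jac_coeff_def by (simp only: mult_zero_right)
qed

lemma continuous_on_jac_coeff:
  fixes I :: "'m::finite set"
  shows "continuous_on {x :: real ^ 'm. 0 < x $ l} (jac_coeff I c l j)"
proof -
  let ?S = "{x :: real ^ 'm. 0 < x $ l}"
  have r: "continuous_on ?S (ell_sq I c l)" and q: "continuous_on ?S (chart_sq I l)"
    unfolding ell_sq_def chart_sq_def by (intro continuous_intros)+
  have r0: "ell_sq I c l x \<noteq> 0" if "x \<in> ?S" for x
    using ell_sq_pos[of x l I c] that by simp
  have q0: "chart_sq I l x \<noteq> 0" for x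
    using chart_sq_pos[of I l x] by simp
  have cx: "continuous_on ?S (\<lambda>x. (c(l := x $ l)) p)" for p
    by (cases "p = l") (auto intro!: continuous_intros)
  have ch: "continuous_on ?S (\<lambda>x. chart I l x $ p)" for p
    by (cases "p = l"; cases "p \<in> I") (auto simp: chart_def intro!: continuous_intros)
  have e: "continuous_on ?S (\<lambda>x. ell_wt I c l x m)" for m
    using r0 by (cases m; cases "fst m = snd m")
        (auto simp: ell_wt_def simp del: fun_upd_apply intro!: continuous_intros r cx)
  have b: "continuous_on ?S (\<lambda>x. ball_wt I l x m)" for m
    using q0 by (cases m; cases "fst m = snd m")
        (auto simp: ball_wt_def intro!: continuous_intros q)
  have v: "continuous_on ?S (\<lambda>x. pair_vec I l x m $ i)" for m i
  proof -
    obtain p q where m: "m = (p, q)" by force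
    show ?thesis
      by (cases "p = q"; cases "p \<in> I \<and> q \<in> I"; cases "i = l"; cases "i = p"; cases "i = q")
         (auto simp: m pair_vec_def intro!: continuous_intros ch)
  qed
  show ?thesis
    unfolding jac_coeff_def det_def vec_lambda_beta using r0
    by (intro continuous_intros e b v r) auto
qed

section \<open>Steiner polynomials of ellipsoids\<close>

text \<open>
  Multiplying by a unit cube turns volume in the coordinate subspace of \<open>I\<close> into volume in the whole
  space.
\<close>

definition cyl :: "'m set \<Rightarrow> (real ^ 'm) set \<Rightarrow> (real ^ 'm) set" where
  "cyl I Y = {x. res I x \<in> Y \<and> (\<forall>i. i \<notin> I \<longrightarrow> 0 \<le> x $ i \<and> x $ i \<le> 1)}"

definition cyl_vol :: "'m::finite set \<Rightarrow> ('m \<Rightarrow> real) \<Rightarrow> real \<Rightarrow> real" where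
  "cyl_vol I c t = measure lebesgue (cyl I (par_ell I c t))"

lemma res_compl_add: "res I x + res (- I) x = x"
  by (simp add: vec_eq_iff)

lemma continuous_on_res: "continuous_on S (res I)" for I :: "'m::finite set"
  by (rule linear_continuous_on_compose[OF continuous_on_id linear_res, unfolded id_def])

lemma compact_cyl:
  fixes Y :: "(real ^ 'm) set"
  assumes "compact Y"
  shows "compact (cyl I Y)"
proof -
  have "closed (res I -` Y \<inter> (\<Inter>i\<in>- I. {x :: real ^ 'm. 0 \<le> x $ i \<and> x $ i \<le> 1}))"
    by (intro closed_Int closed_INT ballI closed_vimage compact_imp_closed[OF assms]
        continuous_on_res closed_Collect_conj closed_Collect_le continuous_intros)
  also have "res I -` Y \<inter> (\<Inter>i\<in>- I. {x. 0 \<le> x $ i \<and> x $ i \<le> 1}) = cyl I Y"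
    by (auto simp: cyl_def)
  finally have cl: "closed (cyl I Y)" .
  have "cyl I Y \<subseteq> (\<lambda>(y, z). y + z) ` (Y \<times> cbox 0 1)"
  proof
    fix x assume x: "x \<in> cyl I Y"
    have "res (- I) x \<in> cbox 0 1" using x by (auto simp: mem_box_cart cyl_def)
    then show "x \<in> (\<lambda>(y, z). y + z) ` (Y \<times> cbox 0 1)"
      using x res_compl_add[of I x] by (force simp: cyl_def)
  qed
  moreover have "compact ((\<lambda>(y, z). y + z) ` (Y \<times> cbox 0 (1 :: real ^ 'm)))"
    by (intro compact_continuous_image compact_Times assms compact_cbox)
       (simp add: case_prod_unfold, intro continuous_intros)
  ultimately have "bounded (cyl I Y)" using bounded_subset compact_imp_bounded by blast
  then show ?thesis using cl compact_eq_bounded_closed by blast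
qed

lemma lmeasurable_cyl_par_ell: "cyl I (par_ell I c t) \<in> lmeasurable"
  by (intro lmeasurable_compact compact_cyl compact_par_ell)

lemma par_ell_cong:
  assumes "\<And>i. i \<in> I \<Longrightarrow> c i = c' i"
  shows "par_ell I c t = par_ell I c' t"
proof -
  have "res I (scl c z + t *\<^sub>R v) = res I (scl c' z + t *\<^sub>R v)" for z v
    using assms by (simp add: vec_eq_iff)
  then show ?thesis by (simp add: par_ell_def)
qed

lemma sets_lebesgue_halfspace: "{x :: real ^ 'm. 0 < x $ l} \<in> sets lebesgue"
  by (simp add: borel_open open_Collect_less continuous_intros)

text \<open>
  Reflection in the hyperplane \<open>x $ l = 0\<close>. The sweep reaches only points with \<open>x $ l > 0\<close>,
  because normals are scaled to have \<open>l\<close>-th coordinate 1.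
\<close>

lemma cyl_vol_half:
  fixes I :: "'m::{finite,wellorder} set"
  assumes l: "l \<in> I"
  shows "cyl_vol I c t = 2 * measure lebesgue (cyl I (par_ell I c t) \<inter> {x. 0 < x $ l})"
proof -
  define f :: "real ^ 'm::_ \<Rightarrow> real ^ 'm::_" where "f = scl (\<lambda>i. if i = l then - 1 else 1)"
  let ?S = "cyl I (par_ell I c t)"
  let ?P = "?S \<inter> {x. 0 < x $ l}" and ?N = "?S \<inter> {x. x $ l < 0}" and ?Z = "?S \<inter> {x. x $ l = 0}"
  have fnth: "f x $ i = (if i = l then - x $ i else x $ i)" for x i by (simp add: f_def)
  have ff: "f (f x) = x" for x by (simp add: vec_eq_iff fnth)
  have nf: "norm (f x) = norm x" for x
    unfolding norm_vec_def by (intro L2_set_cong refl) (simp add: fnth)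
  have of: "orthogonal_transformation f"
    using linear_scl nf by (auto simp: orthogonal_transformation f_def)
  have pf: "f y \<in> par_ell I c t" if y_mem: "y \<in> par_ell I c t" for y
  proof -
    obtain z v where y: "y = res I (scl c z + t *\<^sub>R v)" and zv: "norm z \<le> 1" "norm v \<le> 1"
      using y_mem by (auto simp: par_ell_def)
    have "f y = res I (scl c (f z) + t *\<^sub>R f v)"
      by (simp add: y vec_eq_iff fnth)
    then show ?thesis unfolding par_ell_def
      by (intro image_eqI[where x="(f z, f v)"]) (auto simp: nf zv)
  qed
  have Sf: "f x \<in> ?S" if "x \<in> ?S" for x
  proof -
    have "res I (f x) = f (res I x)" by (simp add: vec_eq_iff fnth)
    then show ?thesis using that pf l by (auto simp: cyl_def fnth)
  qed
  have mS: "?S \<in> lmeasurable" by (rule lmeasurable_cyl_par_ell)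
  have mP: "?P \<in> lmeasurable"
    by (rule fmeasurable_Int_fmeasurable[OF mS sets_lebesgue_halfspace])
  have N: "?N = f ` ?P"
  proof (intro equalityI subsetI)
    fix x assume "x \<in> ?N"
    then show "x \<in> f ` ?P" using Sf by (intro image_eqI[of _ _ "f x"]) (auto simp: ff fnth)
  qed (use Sf in \<open>auto simp: fnth\<close>)
  have negZ: "negligible ?Z"
    by (rule negligible_subset[OF negligible_standard_hyperplane_cart[of l]]) auto
  have "measure lebesgue ?S = measure lebesgue ?P + measure lebesgue ?N + measure lebesgue ?Z"
  proof (rule measure_Un3_negligible[OF mP _ negligible_imp_measurable[OF negZ]])
    show "?N \<in> lmeasurable" unfolding N by (rule measurable_orthogonal_image[OF of mP])
    have "?P \<inter> ?N = {}" "?P \<inter> ?Z = {}" "?N \<inter> ?Z = {}" by auto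
    then show "negligible (?P \<inter> ?N)" "negligible (?P \<inter> ?Z)" "negligible (?N \<inter> ?Z)"
      by (simp_all only: negligible_empty)
    show "?P \<union> ?N \<union> ?Z = ?S" by auto
  qed
  then show ?thesis
    using negligible_imp_measure0[OF negZ] measure_orthogonal_image[OF of mP]
    by (simp add: N cyl_vol_def)
qed

definition sweep_dom :: "'m set \<Rightarrow> ('m \<Rightarrow> real) \<Rightarrow> 'm \<Rightarrow> real \<Rightarrow> (real ^ 'm) set" where
  "sweep_dom I c l \<beta> = {x. c l < x $ l \<and> x $ l \<le> \<beta> \<and> (\<forall>i. i \<notin> I \<longrightarrow> 0 \<le> x $ i \<and> x $ i \<le> 1)}"

lemma sets_lebesgue_sweep_dom: "sweep_dom I c l \<beta> \<in> sets lebesgue" for I :: "'m::finite set"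
proof -
  have "closed ({x. x $ l \<le> \<beta>} \<inter> (\<Inter>i\<in>- I. {x :: real ^ 'm. 0 \<le> x $ i \<and> x $ i \<le> 1}))"
    by (intro closed_Int closed_INT ballI closed_Collect_conj closed_Collect_le continuous_intros)
  then have 1: "{x. x $ l \<le> \<beta>} \<inter> (\<Inter>i\<in>- I. {x :: real ^ 'm. 0 \<le> x $ i \<and> x $ i \<le> 1}) \<in> sets lebesgue"
    by (simp add: borel_closed)
  have "open {x :: real ^ 'm. c l < x $ l}"
    by (intro open_Collect_less continuous_intros)
  then have 2: "{x :: real ^ 'm. c l < x $ l} \<in> sets lebesgue"
    by (simp add: borel_open)
  have "sweep_dom I c l \<beta> = {x. c l < x $ l} \<inter> ({x. x $ l \<le> \<beta>} \<inter>
      (\<Inter>i\<in>- I. {x :: real ^ 'm. 0 \<le> x $ i \<and> x $ i \<le> 1}))"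
    by (auto simp: sweep_dom_def)
  then show ?thesis using sets.Int[OF 2 1] by simp
qed

lemma res_sweep: "l \<in> I \<Longrightarrow> res I (sweep I c l t x) = supp_pt I (c(l := x $ l)) t (chart I l x)"
  by (simp add: sweep_def supp_pt_def vec_eq_iff)

lemma sweep_nth_out: "i \<notin> I \<Longrightarrow> sweep I c l t x $ i = x $ i"
  by (simp add: sweep_def supp_pt_def)

lemma res_chart: "l \<in> I \<Longrightarrow> res I (chart I l x) = chart I l x"
  by (auto simp: vec_eq_iff chart_def)

lemma chart_nth_self [simp]: "chart I l x $ l = 1"
  by (simp add: chart_def)

lemma inj_on_sweep:
  assumes l: "l \<in> I" and c: "\<And>i. i \<in> I \<Longrightarrow> 0 < c i" and t: "0 \<le> t"
  shows "inj_on (sweep I c l t) (sweep_dom I c l \<beta>)"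
proof (rule inj_onI)
  fix x y assume x: "x \<in> sweep_dom I c l \<beta>" and y: "y \<in> sweep_dom I c l \<beta>"
    and eq: "sweep I c l t x = sweep I c l t y"
  have pos: "0 < x $ l" "0 < y $ l" using x y c[OF l] by (auto simp: sweep_dom_def)
  have "supp_pt I (c(l := x $ l)) t (chart I l x) = supp_pt I (c(l := y $ l)) t (chart I l y)"
    using eq res_sweep[OF l] by metis
  note * = supp_pt_inj[OF l c pos t chart_nth_self res_chart[OF l] chart_nth_self res_chart[OF l]
      this]
  have "x $ i = y $ i" for i
  proof (cases "i \<in> I")
    case True
    then show ?thesis
      using *(1) arg_cong[OF *(2), of "\<lambda>w. w $ i"] by (cases "i = l") (auto simp: chart_def)
  next
    case False
    then show ?thesis using eq sweep_nth_out by metis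
  qed
  then show "x = y" by (simp add: vec_eq_iff)
qed

lemma sweep_image:
  assumes l: "l \<in> I" and c: "\<And>i. i \<in> I \<Longrightarrow> 0 < c i" and \<beta>: "c l < \<beta>" and t: "0 \<le> t"
  shows "sweep I c l t ` sweep_dom I c l \<beta> =
    (cyl I (par_ell I (c(l := \<beta>)) t) - cyl I (par_ell I c t)) \<inter> {x. 0 < x $ l}"
proof (intro equalityI subsetI)
  fix y assume "y \<in> sweep I c l t ` sweep_dom I c l \<beta>"
  then obtain x where x: "x \<in> sweep_dom I c l \<beta>" and y: "y = sweep I c l t x" by auto
  have s: "0 < c l" "c l < x $ l" "x $ l \<le> \<beta>" using x c[OF l] by (auto simp: sweep_dom_def)
  have "supp_pt I (c(l := x $ l)) t (chart I l x) \<in> par_ell I (c(l := \<beta>)) t"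
  proof (rule subsetD[OF par_ell_mono supp_pt_mem])
    show "0 \<le> (c(l := x $ l)) i" "(c(l := x $ l)) i \<le> (c(l := \<beta>)) i" if "i \<in> I" for i
      using c[OF that] s by auto
  qed (rule t)
  then have "y \<in> cyl I (par_ell I (c(l := \<beta>)) t)"
    using x sweep_nth_out[of _ I c l t x] by (simp add: y cyl_def res_sweep[OF l] sweep_dom_def)
  moreover have "y \<notin> cyl I (par_ell I c t)"
  proof
    assume "y \<in> cyl I (par_ell I c t)"
    then have "supp_pt I (c(l := x $ l)) t (chart I l x) \<in> par_ell I c t"
      by (simp add: y cyl_def res_sweep[OF l])
    from par_ell_le_supp_fun[OF this t, of "chart I l x"]
    show False
      using supp_fun_strict_mono[of l I "chart I l x" "c l" "x $ l" c t] l s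
      by (simp add: supp_pt_inner)
  qed
  moreover have "0 < y $ l"
  proof -
    have "0 < x $ l" using s by simp
    from ell_sq_pos[where I=I and c=c, OF this] chart_sq_pos[of I l x] this t
    show ?thesis unfolding y sweep_nth[OF l] by (simp add: add_pos_nonneg)
  qed
  ultimately show "y \<in> (cyl I (par_ell I (c(l := \<beta>)) t) - cyl I (par_ell I c t)) \<inter> {x. 0 < x $ l}"
    by simp
next
  fix y assume y: "y \<in> (cyl I (par_ell I (c(l := \<beta>)) t) - cyl I (par_ell I c t)) \<inter> {x. 0 < x $ l}"
  then have "res I y \<in> par_ell I (c(l := \<beta>)) t" "res I y \<notin> par_ell I c t" "0 < res I y $ l"
    using l by (auto simp: cyl_def)
  then obtain s w where s: "c l < s" "s \<le> \<beta>" and w: "res I w = w" "w $ l = 1"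
    and eq: "res I y = supp_pt I (c(l := s)) t w"
    using supp_pt_cover[where c=c and l=l, OF l c \<beta> t] by metis
  define x where "x = (\<chi> i. if i = l then s else if i \<in> I then w $ i else y $ i)"
  have "chart I l x = w"
    using w(2) arg_cong[OF w(1), of "\<lambda>w. w $ i" for i]
    by (auto simp: vec_eq_iff chart_def x_def split: if_splits) (metis res_nth w(1))
  moreover have "x $ l = s" "res (- I) x = res (- I) y" using l by (auto simp: x_def vec_eq_iff)
  ultimately have "sweep I c l t x = y"
    using eq res_compl_add[of I y] by (simp add: sweep_def)
  moreover have "x \<in> sweep_dom I c l \<beta>"
    using s y l by (auto simp: sweep_dom_def x_def cyl_def)
  ultimately show "y \<in> sweep I c l t ` sweep_dom I c l \<beta>" by blast
qed

lemma cyl_mono: "Y \<subseteq> Z \<Longrightarrow> cyl I Y \<subseteq> cyl I Z"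
  by (auto simp: cyl_def)

text \<open>
  Change of variables along \<open>sweep\<close>: half of the volume gained is the integral of the Jacobian
  determinant, and the coefficients \<open>jac_coeff\<close> can be integrated one by one.
\<close>

lemma cyl_vol_enlarge_axis:
  fixes I :: "'m::{finite,wellorder} set"
  assumes l: "l \<in> I" and c: "\<And>i. i \<in> I \<Longrightarrow> 0 < c i" and \<beta>: "c l < \<beta>"
  obtains d where "\<And>j. 0 \<le> d j"
    "\<And>t. 0 \<le> t \<Longrightarrow> cyl_vol I (c(l := \<beta>)) t = cyl_vol I c t + (\<Sum>j\<le>card I. d j * t ^ j)"
proof -
  define D where "D = sweep_dom I c l \<beta>"
  define g where "g j = jac_coeff I c l j" for j
  have D: "D \<in> sets lebesgue" by (simp add: D_def sets_lebesgue_sweep_dom)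
  have Dpos: "0 < x $ l" if "x \<in> D" for x using that c[OF l] by (auto simp: D_def sweep_dom_def)
  have g0: "0 \<le> g j x" if "x \<in> D" for j x using jac_coeff_nonneg[OF Dpos[OF that]] by
      (simp add: g_def)
  have detJ: "det (matrix (sweep_deriv I c l t x)) = (\<Sum>j\<le>card I. g j x * t ^ j)" if "x \<in> D" for x t
  proof -
    have "(\<Sum>j\<le>CARD('m). g j x * t ^ j) = (\<Sum>j\<le>card I. g j x * t ^ j)"
      using jac_coeff_eq_0[OF l] by (intro sum.mono_neutral_right)
          (auto simp: g_def intro: card_mono)
    then show ?thesis using det_sweep_deriv_poly[OF l Dpos[OF that]] by (simp add: g_def)
  qed
  have int: "((\<lambda>x. \<Sum>j\<le>card I. g j x * t ^ j) has_integral
      (cyl_vol I (c(l := \<beta>)) t - cyl_vol I c t) / 2) D" if t: "0 \<le> t" for t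
  proof -
    let ?A = "cyl I (par_ell I (c(l := \<beta>)) t)" and ?B = "cyl I (par_ell I c t)"
    let ?H = "{x :: real ^ 'm::_. 0 < x $ l}"
    have mA: "?A \<inter> ?H \<in> lmeasurable" and mB: "?B \<inter> ?H \<in> lmeasurable"
      by (intro fmeasurable_Int_fmeasurable lmeasurable_cyl_par_ell sets_lebesgue_halfspace)+
    have "?B \<subseteq> ?A"
    proof (intro cyl_mono par_ell_mono t)
      show "0 \<le> c i" "c i \<le> (c(l := \<beta>)) i" if "i \<in> I" for i using c[OF that] \<beta> by auto
    qed
    then have sub: "?B \<inter> ?H \<subseteq> ?A \<inter> ?H" by auto
    have im: "sweep I c l t ` D = ?A \<inter> ?H - ?B \<inter> ?H"
    proof -
      have "?A \<inter> ?H - ?B \<inter> ?H = (?A - ?B) \<inter> ?H" by auto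
      then show ?thesis
        using sweep_image[where c=c and l=l, OF l c \<beta> t] by (simp only: D_def)
    qed
    have "sweep I c l t ` D \<in> lmeasurable \<and>
        measure lebesgue (sweep I c l t ` D) = (cyl_vol I (c(l := \<beta>)) t - cyl_vol I c t) / 2"
      unfolding im cyl_vol_half[OF l] measurable_measure_Diff[OF mA fmeasurableD[OF mB] sub]
      using fmeasurable.Diff[OF mA mB] by simp
    then have "((\<lambda>x. \<bar>det (matrix (sweep_deriv I c l t x))\<bar>) has_integral
        (cyl_vol I (c(l := \<beta>)) t - cyl_vol I c t) / 2) D"
      by (subst (asm) has_measure_differentiable_image[OF D])
         (use l Dpos inj_on_sweep[OF l c t] in \<open>auto intro: has_derivative_sweep simp: D_def\<close>)
    moreover have "\<bar>det (matrix (sweep_deriv I c l t x))\<bar> = (\<Sum>j\<le>card I. g j x * t ^ j)" if "x \<in> D"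
        for x
      unfolding detJ[OF that] using g0[OF that] t by (intro abs_of_nonneg sum_nonneg) simp
    ultimately show ?thesis by (simp cong: has_integral_cong)
  qed
  have gint: "g j integrable_on D" for j
  proof (cases "j \<le> card I")
    case True
    have "g j \<in> borel_measurable (lebesgue_on D)"
      unfolding g_def
      by (rule continuous_imp_measurable_on_sets_lebesgue[OF continuous_on_subset[OF
          continuous_on_jac_coeff] D])
         (use Dpos in auto)
    \<comment> \<open>The Jacobian at \<open>t = 1\<close> dominates each of its coefficients, as they are all nonnegative.\<close>
    moreover have "(\<lambda>x. \<Sum>j\<le>card I. g j x) integrable_on D"
      using has_integral_integrable[OF int[of 1]] by simp
    moreover have "\<bar>g j x\<bar> \<le> (\<Sum>j\<le>card I. g j x)" if "x \<in> D" for x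
      using True g0[OF that] member_le_sum[of j "{..card I}" "\<lambda>j. g j x"] by simp
    ultimately show ?thesis
      using D by (rule measurable_bounded_by_integrable_imp_integrable_real)
  next
    case False
    then have "g j = (\<lambda>x. 0)" using jac_coeff_eq_0[OF l] by (auto simp: g_def)
    then show ?thesis using integrable_0[of D] by simp
  qed
  show ?thesis
  proof (rule that[of "\<lambda>j. 2 * integral D (g j)"])
    show "0 \<le> 2 * integral D (g j)" for j
      using integral_nonneg[OF gint] g0 by simp
    show "cyl_vol I (c(l := \<beta>)) t = cyl_vol I c t + (\<Sum>j\<le>card I. 2 * integral D (g j) * t ^ j)"
      if t: "0 \<le> t" for t
    proof -
      have "((\<lambda>x. \<Sum>j\<le>card I. g j x * t ^ j) has_integral (\<Sum>j\<le>card I. integral D (g j) * t ^ j)) D"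
        using gint by (intro has_integral_sum has_integral_mult_left)
            (auto simp: has_integral_integral)
      from has_integral_unique[OF this int[OF t]]
      show ?thesis by (simp add: sum_distrib_left algebra_simps flip: sum_divide_distrib)
    qed
  qed
qed

lemma cyl_vol_cong: "(\<And>i. i \<in> I \<Longrightarrow> c i = c' i) \<Longrightarrow> cyl_vol I c t = cyl_vol I c' t"
  unfolding cyl_vol_def using par_ell_cong[of I c c' t] by simp

lemma cyl_vol_enlarge:
  fixes I :: "'m::{finite,wellorder} set"
  assumes c: "\<And>i. i \<in> I \<Longrightarrow> 0 < c i" and c': "\<And>i. i \<in> I \<Longrightarrow> c i \<le> c' i"
  shows "\<exists>d. (\<forall>j. 0 \<le> d j) \<and>
    (\<forall>t\<ge>0. cyl_vol I c' t = cyl_vol I c t + (\<Sum>j\<le>card I. d j * t ^ j))"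
proof -
  have "\<exists>d. (\<forall>j. 0 \<le> d j) \<and> (\<forall>t\<ge>0. cyl_vol I (\<lambda>i. if i \<in> J then c' i else c i) t =
      cyl_vol I c t + (\<Sum>j\<le>card I. d j * t ^ j))" if "J \<subseteq> I" for J
    using finite[of J] that
  proof (induction J rule: finite_induct)
    case empty
    show ?case by (intro exI[of _ "\<lambda>_. 0"]) simp
  next
    case (insert l J)
    define b where "b i = (if i \<in> J then c' i else c i)" for i
    obtain d where d: "\<And>j. 0 \<le> d j"
      "\<And>t. 0 \<le> t \<Longrightarrow> cyl_vol I b t = cyl_vol I c t + (\<Sum>j\<le>card I. d j * t ^ j)"
      using insert unfolding b_def by auto
    have upd: "(\<lambda>i. if i \<in> insert l J then c' i else c i) = b(l := c' l)"
      by (auto simp: b_def)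
    have l: "l \<in> I" and bl: "b l = c l" using insert by (auto simp: b_def)
    have b: "0 < b i" if "i \<in> I" for i using c[OF that] c'[OF that] by (simp add: b_def)
    show ?case
    proof (cases "c' l = c l")
      case True
      then have "b(l := c' l) = b" using bl by auto
      then show ?thesis unfolding upd using d by auto
    next
      case False
      then have "b l < c' l" using c'[OF l] bl by simp
      then obtain d' where "\<And>j. 0 \<le> d' j"
        "\<And>t. 0 \<le> t \<Longrightarrow> cyl_vol I (b(l := c' l)) t = cyl_vol I b t + (\<Sum>j\<le>card I. d' j * t ^ j)"
        using cyl_vol_enlarge_axis[where c=b and l=l and \<beta>="c' l", OF l b] by metis
      then show ?thesis unfolding upd using d
        by (intro exI[of _ "\<lambda>j. d j + d' j"]) (simp add: sum.distrib algebra_simps)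
    qed
  qed
  from this[OF subset_refl] show ?thesis
    using cyl_vol_cong[of I "\<lambda>i. if i \<in> I then c' i else c i" c'] by simp
qed

lemma cyl_vol_ball:
  fixes I :: "'m::{finite,wellorder} set"
  assumes r: "0 < r" and t: "0 \<le> t"
  shows "cyl_vol I (\<lambda>_. r) t = cyl_vol I (\<lambda>_. 1) 0 * (r + t) ^ card I"
proof -
  define f :: "real ^ 'm::_ \<Rightarrow> real ^ 'm::_" where "f = scl (\<lambda>i. if i \<in> I then r + t else 1)"
  have fnth: "f x $ i = (if i \<in> I then (r + t) * x $ i else x $ i)" for x i by (simp add: f_def)
  have par1: "par_ell I (\<lambda>_. 1) 0 = res I ` cball 0 1"
    by (force simp: par_ell_def scl_def)
  have par: "par_ell I (\<lambda>_. r) t = (\<lambda>z. (r + t) *\<^sub>R res I z) ` cball 0 1"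
  proof (intro equalityI subsetI)
    fix y assume "y \<in> par_ell I (\<lambda>_. r) t"
    then obtain z v where y: "y = res I (scl (\<lambda>_. r) z + t *\<^sub>R v)" and zv: "norm z \<le> 1" "norm v \<le> 1"
      by (auto simp: par_ell_def)
    have "norm (r *\<^sub>R z + t *\<^sub>R v) \<le> r * 1 + t * 1"
      using r t zv by (intro norm_triangle_le add_mono) (auto simp: mult_left_le)
    then have "(1 / (r + t)) *\<^sub>R (r *\<^sub>R z + t *\<^sub>R v) \<in> cball 0 1"
      unfolding mem_cball_0 norm_scaleR using r t by
          (simp only: abs_of_pos divide_pos_pos add_pos_nonneg zero_less_one) simp
    moreover have "y = (r + t) *\<^sub>R res I ((1 / (r + t)) *\<^sub>R (r *\<^sub>R z + t *\<^sub>R v))"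
      using r t by (simp add: y vec_eq_iff)
    ultimately show "y \<in> (\<lambda>z. (r + t) *\<^sub>R res I z) ` cball 0 1" by blast
  next
    fix y assume "y \<in> (\<lambda>z. (r + t) *\<^sub>R res I z) ` cball 0 1"
    then obtain z where z: "z \<in> cball 0 1" "y = (r + t) *\<^sub>R res I z" by blast
    then have "y = res I (scl (\<lambda>_. r) z + t *\<^sub>R z)" by (simp add: vec_eq_iff algebra_simps)
    with z(1) show "y \<in> par_ell I (\<lambda>_. r) t"
      unfolding par_ell_def by (intro image_eqI[where x="(z, z)"]) auto
  qed
  have "cyl I (par_ell I (\<lambda>_. r) t) = f ` cyl I (par_ell I (\<lambda>_. 1) 0)"
  proof (intro equalityI subsetI)
    fix x assume x: "x \<in> cyl I (par_ell I (\<lambda>_. r) t)"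
    then obtain z where z: "z \<in> cball 0 1" "res I x = (r + t) *\<^sub>R res I z"
      unfolding cyl_def par by auto
    define y where "y = (\<chi> i. if i \<in> I then z $ i else x $ i)"
    have "x $ i = (r + t) * z $ i" if "i \<in> I" for i
      using arg_cong[OF z(2), of "\<lambda>v. v $ i"] that by simp
    then have "f y = x" by (auto simp: vec_eq_iff fnth y_def)
    moreover have "res I y = res I z" by (simp add: vec_eq_iff y_def)
    then have "y \<in> cyl I (par_ell I (\<lambda>_. 1) 0)"
      using x z(1) unfolding par1 by (auto simp: cyl_def y_def)
    ultimately show "x \<in> f ` cyl I (par_ell I (\<lambda>_. 1) 0)" by blast
  next
    fix x assume "x \<in> f ` cyl I (par_ell I (\<lambda>_. 1) 0)"
    then obtain y where y: "x = f y" "y \<in> cyl I (par_ell I (\<lambda>_. 1) 0)" by blast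
    have "res I x = (r + t) *\<^sub>R res I y" by (simp add: y vec_eq_iff fnth)
    then show "x \<in> cyl I (par_ell I (\<lambda>_. r) t)"
      using y unfolding par1 par by (auto simp: cyl_def fnth)
  qed
  moreover have "det (matrix f) = (r + t) ^ card I"
  proof -
    have "det (matrix f) = (\<Prod>i\<in>UNIV. matrix f $ i $ i)"
      by (rule det_diagonal) (simp add: matrix_def fnth axis_def)
    also have "\<dots> = (\<Prod>i\<in>UNIV. if i \<in> I then r + t else 1)"
      by (intro prod.cong refl) (simp add: matrix_def fnth axis_def)
    finally show ?thesis by (simp flip: prod.inter_restrict add: prod.If_cases)
  qed
  moreover have "linear f" by (simp add: f_def linear_scl)
  ultimately show ?thesis
    using measure_linear_image[OF _ lmeasurable_cyl_par_ell, of f I "\<lambda>_. 1" 0] r t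
    by (simp add: cyl_vol_def)
qed

text \<open>
  The Steiner polynomial of a ball is explicit, and each ellipsoid arises from a small ball by
  enlarging semi-axes. A ball of positive radius rather than a point is the start, since at \<open>t = 0\<close>
  the map \<open>sweep\<close> is injective only if the semi-axes other than the varying one are positive.
\<close>

lemma cyl_vol_poly:
  fixes I :: "'m::{finite,wellorder} set"
  assumes c: "\<And>i. i \<in> I \<Longrightarrow> 0 < c i"
  shows "\<exists>w. \<forall>t\<ge>0. cyl_vol I c t = (\<Sum>j\<le>card I. w j * t ^ j)"
proof -
  \<comment> \<open>The 1 keeps the minimum meaningful for empty \<open>I\<close>.\<close>
  define r where "r = Min (insert 1 (c ` I))"
  have r: "0 < r" "\<And>i. i \<in> I \<Longrightarrow> r \<le> c i" using c by (auto simp: r_def)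
  obtain d where d: "\<And>t. 0 \<le> t \<Longrightarrow> cyl_vol I c t = cyl_vol I (\<lambda>_. r) t + (\<Sum>j\<le>card I. d j * t ^ j)"
    using cyl_vol_enlarge[of I "\<lambda>_. r" c] r by auto
  have "(r + t) ^ card I = (\<Sum>j\<le>card I. of_nat (card I choose j) * r ^ (card I - j) * t ^ j)" for t
    using binomial_ring[of t r "card I"] by (simp add: algebra_simps)
  then show ?thesis
    using d cyl_vol_ball[OF r(1), of _ I]
    by (intro exI[of _ "\<lambda>j. cyl_vol I (\<lambda>_. 1) 0 * (of_nat (card I choose j) * r ^ (card I - j)) +
        d j"])
       (simp add: sum.distrib sum_distrib_left algebra_simps)
qed

section \<open>Volumes in subspaces and monotonicity of quermassintegrals\<close>

definition orthonormal_on :: "'i set \<Rightarrow> ('i \<Rightarrow> 'a::euclidean_space) \<Rightarrow> bool" where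
  "orthonormal_on I f \<longleftrightarrow> (\<forall>i\<in>I. \<forall>j\<in>I. f i \<bullet> f j = (if i = j then 1 else 0))"

lemma PiM_lborel_reindex:
  assumes I: "finite I" and h: "bij_betw h I B"
  shows "(\<Pi>\<^sub>M b\<in>B. lborel :: real measure) =
    distr (\<Pi>\<^sub>M i\<in>I. lborel) (\<Pi>\<^sub>M b\<in>B. lborel) (\<lambda>x. \<lambda>b\<in>B. x (the_inv_into I h b))"
proof -
  interpret product_sigma_finite "\<lambda>_. lborel :: real measure" by standard
  have g: "bij_betw (the_inv_into I h) B I" using bij_betw_the_inv_into[OF h] .
  have gI: "the_inv_into I h b \<in> I" if "b \<in> B" for b using g that by (auto simp: bij_betw_def)
  have [measurable]: "(\<lambda>x. \<lambda>b\<in>B. x (the_inv_into I h b)) \<in>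
      (\<Pi>\<^sub>M i\<in>I. lborel) \<rightarrow>\<^sub>M (\<Pi>\<^sub>M b\<in>B. lborel :: real measure)"
    by (intro measurable_restrict measurable_component_singleton gI)
  have hg: "h (the_inv_into I h b) = b" if "b \<in> B" for b
    using f_the_inv_into_f_bij_betw[OF h] that by blast
  have gh: "the_inv_into I h (h i) = i" if "i \<in> I" for i
    using the_inv_into_f_f bij_betw_imp_inj_on[OF h] that by metis
  have hB: "h i \<in> B" if "i \<in> I" for i using h that by (auto simp: bij_betw_def)
  have "distr (\<Pi>\<^sub>M i\<in>I. lborel) (\<Pi>\<^sub>M b\<in>B. lborel) (\<lambda>x. \<lambda>b\<in>B. x (the_inv_into I h b)) =
      (\<Pi>\<^sub>M b\<in>B. lborel :: real measure)"
  proof (rule PiM_eqI)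
    show "finite B" using I h bij_betw_finite by blast
    fix A :: "'b \<Rightarrow> real set" assume A: "\<And>b. b \<in> B \<Longrightarrow> A b \<in> sets lborel"
    have "emeasure (distr (\<Pi>\<^sub>M i\<in>I. lborel) (\<Pi>\<^sub>M b\<in>B. lborel) (\<lambda>x. \<lambda>b\<in>B. x (the_inv_into I h b))) (Pi\<^sub>E B A) =
        emeasure (\<Pi>\<^sub>M i\<in>I. lborel) ((\<lambda>x. \<lambda>b\<in>B. x (the_inv_into I h b)) -` Pi\<^sub>E B A \<inter> space (\<Pi>\<^sub>M
            i\<in>I. lborel))"
      using \<open>finite B\<close> A by (intro emeasure_distr sets_PiM_I_finite) auto
    also have "(\<lambda>x. \<lambda>b\<in>B. x (the_inv_into I h b)) -` Pi\<^sub>E B A \<inter> space (\<Pi>\<^sub>M i\<in>I. lborel :: real measure) =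
        (\<Pi>\<^sub>E i\<in>I. A (h i))"
    proof (intro equalityI subsetI)
      fix x assume x: "x \<in> (\<lambda>x. \<lambda>b\<in>B. x (the_inv_into I h b)) -` Pi\<^sub>E B A \<inter> space (\<Pi>\<^sub>M i\<in>I. lborel :: real measure)"
      have "x i \<in> A (h i)" if "i \<in> I" for i
      proof -
        have "(\<lambda>b\<in>B. x (the_inv_into I h b)) \<in> Pi\<^sub>E B A"
          using x by (simp only: Int_iff vimage_eq)
        from PiE_mem[OF this hB[OF that]] show ?thesis using hB[OF that] gh[OF that] by simp
      qed
      then show "x \<in> (\<Pi>\<^sub>E i\<in>I. A (h i))" using x by (simp add: space_PiM PiE_iff)
    next
      fix x assume x: "x \<in> (\<Pi>\<^sub>E i\<in>I. A (h i))"
      have "x (the_inv_into I h b) \<in> A b" if "b \<in> B" for b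
        using PiE_mem[OF x gI[OF that]] hg[OF that] by simp
      then show "x \<in> (\<lambda>x. \<lambda>b\<in>B. x (the_inv_into I h b)) -` Pi\<^sub>E B A \<inter> space (\<Pi>\<^sub>M i\<in>I. lborel :: real measure)"
        using x by (simp add: space_PiM PiE_iff)
    qed
    also have "emeasure (\<Pi>\<^sub>M i\<in>I. lborel) (\<Pi>\<^sub>E i\<in>I. A (h i)) = (\<Prod>i\<in>I. emeasure lborel (A (h i)))"
      using A hB by (intro emeasure_PiM I) auto
    also have "\<dots> = (\<Prod>b\<in>B. emeasure lborel (A b))"
      by (rule prod.reindex_bij_betw[OF h])
    finally show "emeasure (distr (\<Pi>\<^sub>M i\<in>I. lborel) (\<Pi>\<^sub>M b\<in>B. lborel)
        (\<lambda>x. \<lambda>b\<in>B. x (the_inv_into I h b))) (Pi\<^sub>E B A) = (\<Prod>b\<in>B. emeasure lborel (A b))" .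
  qed simp
  then show ?thesis by simp
qed

text \<open>
  Indexes the product measure behind \<open>subspace_lborel\<close> by \<open>I\<close> instead of by the basis vectors
  themselves.
\<close>

lemma distr_PiM_lborel_linear:
  fixes h :: "'i \<Rightarrow> 'a::euclidean_space"
  assumes I: "finite I" and h: "bij_betw h I B"
  shows "distr (\<Pi>\<^sub>M b\<in>B. lborel) borel (\<lambda>f. \<Sum>b\<in>B. f b *\<^sub>R b) =
    distr (\<Pi>\<^sub>M i\<in>I. lborel) borel (\<lambda>x. \<Sum>i\<in>I. x i *\<^sub>R h i)"
proof -
  have g: "bij_betw (the_inv_into I h) B I" using bij_betw_the_inv_into[OF h] .
  have gI: "the_inv_into I h b \<in> I" if "b \<in> B" for b using g that by (auto simp: bij_betw_def)
  have "distr (\<Pi>\<^sub>M b\<in>B. lborel) borel (\<lambda>f. \<Sum>b\<in>B. f b *\<^sub>R b) =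
      distr (\<Pi>\<^sub>M i\<in>I. lborel) borel ((\<lambda>f. \<Sum>b\<in>B. f b *\<^sub>R b) \<circ> (\<lambda>x. \<lambda>b\<in>B. x (the_inv_into I h b)))"
    by (subst PiM_lborel_reindex[OF I h], rule distr_distr)
       (auto intro!: measurable_restrict measurable_component_singleton gI)
  also have "((\<lambda>f. \<Sum>b\<in>B. f b *\<^sub>R b) \<circ> (\<lambda>x. \<lambda>b\<in>B. x (the_inv_into I h b))) =
      (\<lambda>x. \<Sum>i\<in>I. x i *\<^sub>R h i)"
  proof
    fix x :: "'i \<Rightarrow> real"
    have "(\<Sum>i\<in>I. x i *\<^sub>R h i) = (\<Sum>i\<in>I. x (the_inv_into I h (h i)) *\<^sub>R h i)"
      using the_inv_into_f_f[OF bij_betw_imp_inj_on[OF h]] by (intro sum.cong) auto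
    also have "\<dots> = (\<Sum>b\<in>B. x (the_inv_into I h b) *\<^sub>R b)"
      by (rule sum.reindex_bij_betw[OF h, of "\<lambda>b. x (the_inv_into I h b) *\<^sub>R b"])
    finally show "((\<lambda>f. \<Sum>b\<in>B. f b *\<^sub>R b) \<circ> (\<lambda>x. \<lambda>b\<in>B. x (the_inv_into I h b))) x =
      (\<Sum>i\<in>I. x i *\<^sub>R h i)" by simp
  qed
  finally show ?thesis .
qed

lemma vec_lambda_eq_sum_axis: "(\<chi> i. x i) = (\<Sum>i\<in>UNIV. x i *\<^sub>R axis i 1 :: real ^ 'm)"
  by (simp add: vec_eq_iff axis_def if_distrib[of "\<lambda>z. _ * z"] cong: if_cong)

lemma lborel_eq_PiM_vec:
  "(lborel :: (real ^ 'm) measure) = distr (\<Pi>\<^sub>M i\<in>UNIV. lborel) borel (\<lambda>x. \<chi> i. x i)"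
proof -
  have bij: "bij_betw (\<lambda>i. axis i 1) UNIV (Basis :: (real ^ 'm) set)"
    by (rule bij_betwI') (auto simp: axis_eq_axis Basis_vec_def)
  have "(lborel :: (real ^ 'm) measure) =
      distr (\<Pi>\<^sub>M i\<in>UNIV. lborel) borel (\<lambda>x. \<Sum>i\<in>UNIV. x i *\<^sub>R axis i 1)"
    by (rule trans[OF lborel_eq distr_PiM_lborel_linear[OF finite bij]])
  also have "(\<lambda>x. \<Sum>i\<in>UNIV. x i *\<^sub>R axis i 1) = (\<lambda>x. \<chi> i. x i :: real ^ 'm)"
    by (simp add: fun_eq_iff vec_lambda_eq_sum_axis)
  finally show ?thesis .
qed

lemma emeasure_distr_PiM_cylinder:
  fixes h :: "'m::finite \<Rightarrow> 'a::euclidean_space" and X :: "'a set"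
  assumes X: "X \<in> sets borel"
  shows "emeasure (distr (\<Pi>\<^sub>M i\<in>I. lborel) borel (\<lambda>x. \<Sum>i\<in>I. x i *\<^sub>R h i)) X =
    emeasure lborel {x :: real ^ 'm. (\<Sum>i\<in>I. x $ i *\<^sub>R h i) \<in> X \<and> (\<forall>i. i \<notin> I \<longrightarrow> 0 \<le> x $ i \<and> x $ i \<le>
        1)}"
    (is "_ = emeasure lborel ?S")
proof -
  interpret product_sigma_finite "\<lambda>_::'m. lborel :: real measure" by standard
  interpret J: finite_product_sigma_finite "\<lambda>_::'m. lborel :: real measure" "- I" by standard simp
  let ?M = "\<lambda>I::'m set. \<Pi>\<^sub>M i\<in>I. lborel :: real measure"
  define A where "A = (\<lambda>x. \<Sum>i\<in>I. x i *\<^sub>R h i) -` X \<inter> space (?M I)"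
  define C where "C = (\<Pi>\<^sub>E i\<in>- I. {0..1::real})"
  have mF: "(\<lambda>x. \<Sum>i\<in>I. x i *\<^sub>R h i) \<in> ?M I \<rightarrow>\<^sub>M borel" by measurable
  have A: "A \<in> sets (?M I)" unfolding A_def by (rule measurable_sets[OF mF X])
  have C: "C \<in> sets (?M (- I))" unfolding C_def by (intro sets_PiM_I_finite) auto
  have mS: "?S \<in> sets borel"
  proof -
    have 1: "(\<lambda>x :: real ^ 'm. \<Sum>i\<in>I. x $ i *\<^sub>R h i) \<in> borel \<rightarrow>\<^sub>M borel"
      by (intro borel_measurable_continuous_onI continuous_intros)
    have "closed (\<Inter>i\<in>- I. {x :: real ^ 'm. 0 \<le> x $ i \<and> x $ i \<le> 1})"
      by (intro closed_INT ballI closed_Collect_conj closed_Collect_le continuous_intros)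
    then have 2: "(\<Inter>i\<in>- I. {x :: real ^ 'm. 0 \<le> x $ i \<and> x $ i \<le> 1}) \<in> sets borel"
      by (rule borel_closed)
    have "?S = ((\<lambda>x. \<Sum>i\<in>I. x $ i *\<^sub>R h i) -` X \<inter> space borel) \<inter> (\<Inter>i\<in>- I. {x. 0 \<le> x $ i \<and> x $ i \<le>
        1})"
      by auto
    then show ?thesis using sets.Int[OF measurable_sets[OF 1 X] 2] by simp
  qed
  have mv: "(\<lambda>x. \<chi> i. x i :: real ^ 'm) \<in> ?M UNIV \<rightarrow>\<^sub>M borel"
    unfolding vec_lambda_eq_sum_axis by measurable
  have "emeasure lborel ?S = emeasure (?M UNIV) ((\<lambda>x. \<chi> i. x i) -` ?S \<inter> space (?M UNIV))"
    unfolding lborel_eq_PiM_vec by (rule emeasure_distr[OF mv mS])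
  also have "?M UNIV = distr (?M I \<Otimes>\<^sub>M ?M (- I)) (?M (I \<union> - I)) (merge I (- I))"
    using distr_merge[of I "- I"] by simp
  also have "emeasure \<dots> ((\<lambda>x. \<chi> i. x i) -` ?S \<inter> space \<dots>) =
      emeasure (?M I \<Otimes>\<^sub>M ?M (- I)) (merge I (- I) -` ((\<lambda>x. \<chi> i. x i) -` ?S \<inter> space (?M UNIV)) \<inter>
          space (?M I \<Otimes>\<^sub>M ?M (- I)))"
    using measurable_sets[OF mv mS] measurable_merge[of I "- I" "\<lambda>_. lborel :: real measure"]
    by (subst emeasure_distr) (auto simp: space_PiM)
  also have "merge I (- I) -` ((\<lambda>x. \<chi> i. x i) -` ?S \<inter> space (?M UNIV)) \<inter> space (?M I \<Otimes>\<^sub>M ?M (- I)) = A \<times> C"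
  proof -
    have "(\<Sum>i\<in>I. merge I (- I) p i *\<^sub>R h i) = (\<Sum>i\<in>I. fst p i *\<^sub>R h i)" for p
      by (intro sum.cong) (auto simp: merge_def split: prod.split)
    then show ?thesis
      by (auto simp: space_pair_measure space_PiM A_def C_def PiE_iff merge_def)
  qed
  also have "emeasure (?M I \<Otimes>\<^sub>M ?M (- I)) (A \<times> C) = emeasure (?M I) A * emeasure (?M (- I)) C"
    by (rule J.emeasure_pair_measure_Times[OF A C])
  also have "emeasure (?M (- I)) C = 1"
    unfolding C_def by (subst emeasure_PiM) auto
  finally show ?thesis
    using emeasure_distr[OF mF X] by (simp add: A_def)
qed

lemma orthonormal_on_sum_inner:
  assumes "orthonormal_on I f" "finite I" "j \<in> I"
  shows "(\<Sum>i\<in>I. x i *\<^sub>R f i) \<bullet> f j = x j"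
proof -
  have "(\<Sum>i\<in>I. x i *\<^sub>R f i) \<bullet> f j = (\<Sum>i\<in>I. if i = j then x i else 0)"
    unfolding inner_sum_left using assms by (intro sum.cong) (auto simp: orthonormal_on_def)
  then show ?thesis using assms by simp
qed

lemma orthonormal_on_expand:
  assumes f: "orthonormal_on I f" "finite I" and u: "u \<in> span (f ` I)"
  shows "(\<Sum>i\<in>I. (u \<bullet> f i) *\<^sub>R f i) = u"
  using u
proof (induction rule: span_induct_alt)
  case base
  show ?case by simp
next
  case (step c x y)
  then obtain j where j: "j \<in> I" "x = f j" by auto
  have "(\<Sum>i\<in>I. (x \<bullet> f i) *\<^sub>R f i) = (\<Sum>i\<in>I. if j = i then f i else 0)"
    using f j by (intro sum.cong) (auto simp: orthonormal_on_def)
  then have "(\<Sum>i\<in>I. (x \<bullet> f i) *\<^sub>R f i) = x" using j f by simp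
  then show ?case
    using step by (simp add: inner_add_left scaleR_add_left sum.distrib flip: scaleR_scaleR
        scaleR_sum_right)
qed

lemma orthonormal_on_norm_sum:
  assumes "orthonormal_on I f" "finite I"
  shows "(norm (\<Sum>i\<in>I. x i *\<^sub>R f i))\<^sup>2 = (\<Sum>i\<in>I. (x i)\<^sup>2)"
proof -
  have "(norm (\<Sum>i\<in>I. x i *\<^sub>R f i))\<^sup>2 = (\<Sum>j\<in>I. x j * ((\<Sum>i\<in>I. x i *\<^sub>R f i) \<bullet> f j))"
    unfolding power2_norm_eq_inner inner_sum_right by simp
  also have "\<dots> = (\<Sum>j\<in>I. (x j)\<^sup>2)"
    by (intro sum.cong) (simp_all add: orthonormal_on_sum_inner[OF assms] power2_eq_square)
  finally show ?thesis .
qed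

lemma orthonormal_on_inj: "orthonormal_on I f \<Longrightarrow> inj_on f I"
  unfolding orthonormal_on_def by (intro inj_onI) (metis zero_neq_one)

lemma orthonormal_on_nonzero: "orthonormal_on K f \<Longrightarrow> i \<in> K \<Longrightarrow> f i \<noteq> 0"
  unfolding orthonormal_on_def by (metis inner_zero_left zero_neq_one)

lemma orthonormal_on_reindex:
  "orthonormal_on L f \<Longrightarrow> inj_on \<phi> K \<Longrightarrow> \<phi> ` K \<subseteq> L \<Longrightarrow> orthonormal_on K (f \<circ> \<phi>)"
  by (auto simp: orthonormal_on_def inj_on_def image_subset_iff)

lemma orthonormal_on_dim:
  assumes "orthonormal_on I f" "finite I"
  shows "dim (span (f ` I)) = card I"
proof -
  have "independent (f ` I)"
  proof (rule pairwise_orthogonal_independent)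
    show "pairwise orthogonal (f ` I)"
      using assms(1) by (auto simp: pairwise_def orthogonal_def orthonormal_on_def)
    show "0 \<notin> f ` I" using orthonormal_on_nonzero[OF assms(1)] by auto
  qed
  then show ?thesis
    by (simp add: dim_eq_card_independent card_image orthonormal_on_inj[OF assms(1)])
qed

text \<open>
  A basis given as a set is turned into an indexed family.
\<close>

lemma orthonormal_basis_of_orthonormal_on:
  assumes "orthonormal_basis_of H B" "bij_betw h I B"
  shows "orthonormal_on I h"
proof -
  have "h i \<bullet> h j = (if i = j then 1 else 0)" if ij: "i \<in> I" "j \<in> I" for i j
  proof (cases "i = j")
    case True
    then show ?thesis using assms ij
      by (auto simp: orthonormal_basis_of_def bij_betw_def norm_eq_1)
  next
    case False
    then have "h i \<noteq> h j" using assms(2) ij by (auto simp: bij_betw_def inj_on_def)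
    then show ?thesis using assms ij False
      by (auto simp: orthonormal_basis_of_def bij_betw_def pairwise_def orthogonal_def)
  qed
  then show ?thesis by (simp add: orthonormal_on_def)
qed

definition frame_map :: "'m::finite set \<Rightarrow> ('m \<Rightarrow> 'a) \<Rightarrow> real ^ 'm \<Rightarrow> 'a::euclidean_space" where
  "frame_map I f x = (\<Sum>i\<in>I. x $ i *\<^sub>R f i)"

lemma linear_frame_map: "linear (frame_map I f)"
  by (rule linearI) (simp_all add: frame_map_def scaleR_add_left sum.distrib scaleR_sum_right)

lemma frame_map_res: "frame_map I f (res I x) = frame_map I f x"
  by (simp add: frame_map_def)

text \<open>
  The measure is defined by an unknown orthonormal basis, here the family \<open>h\<close>. The matrix
  of the change from \<open>h\<close> to \<open>f\<close>, extended by the identity on the remaining coordinates, is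
  orthogonal on the whole model space and so preserves volume.
\<close>

lemma measure_subspace_lborel_frame:
  fixes I :: "'m::{finite,wellorder} set" and f :: "'m \<Rightarrow> 'a::euclidean_space"
  assumes f: "orthonormal_on I f" and Y: "compact Y" "\<And>y. y \<in> Y \<Longrightarrow> res I y = y"
  shows "measure (subspace_lborel (span (f ` I))) (frame_map I f ` Y) = measure lebesgue (cyl I Y)"
proof -
  define H where "H = span (f ` I)"
  define B where "B = (SOME B. orthonormal_basis_of H B)"
  have B: "orthonormal_basis_of H B"
    unfolding B_def by (rule someI_ex[OF ex_orthonormal_basis_of]) (simp add: H_def)
  have "independent B"
  proof (rule pairwise_orthogonal_independent)
    show "0 \<notin> B" using B by (auto simp: orthonormal_basis_of_def)
  qed (use B in \<open>auto simp: orthonormal_basis_of_def\<close>)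
  then have "finite B" "card B = dim (span B)"
    by (simp_all add: independent_imp_finite dim_eq_card_independent)
  moreover have "dim (span B) = card I"
    using orthonormal_on_dim[OF f] B by (simp add: H_def orthonormal_basis_of_def)
  ultimately obtain h where h: "bij_betw h I B"
    using finite_same_card_bij[of I B] by auto
  have oh: "orthonormal_on I h" by (rule orthonormal_basis_of_orthonormal_on[OF B h])
  have hH: "span (h ` I) = H" using B h by (auto simp: orthonormal_basis_of_def bij_betw_def)
  have "compact (frame_map I f ` Y)"
    using Y(1) linear_frame_map by (intro compact_continuous_image linear_continuous_on
        linear_conv_bounded_linear[THEN iffD1])
  then have X: "frame_map I f ` Y \<in> sets borel" by (simp add: compact_imp_closed borel_closed)
  define S where "S = {x :: real ^ 'm::_. frame_map I h x \<in> frame_map I f ` Y \<and>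
      (\<forall>i. i \<notin> I \<longrightarrow> 0 \<le> x $ i \<and> x $ i \<le> 1)}"
  have "emeasure (subspace_lborel H) (frame_map I f ` Y) = emeasure lborel S"
    unfolding subspace_lborel_def Let_def B_def[symmetric] distr_PiM_lborel_linear[OF finite h]
      emeasure_distr_PiM_cylinder[OF X] S_def by (simp add: frame_map_def)
  then have m: "measure (subspace_lborel H) (frame_map I f ` Y) = measure lborel S"
    by (simp add: measure_def)
  define Q :: "real ^ 'm::_ \<Rightarrow> real ^ 'm::_" where
    "Q x = (\<chi> j. if j \<in> I then frame_map I h x \<bullet> f j else x $ j)" for x
  have FQ: "frame_map I f (Q x) = frame_map I h x" for x
  proof -
    have "frame_map I h x \<in> span (f ` I)"
      unfolding hH[unfolded H_def, symmetric] frame_map_def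
          by (intro span_sum span_scale span_base) auto
    from orthonormal_on_expand[OF f finite this] show ?thesis by
        (simp add: frame_map_def[of I f] Q_def)
  qed
  have norm_split: "(norm x)\<^sup>2 = (\<Sum>i\<in>I. (x $ i)\<^sup>2) + (\<Sum>i\<in>- I. (x $ i)\<^sup>2)" for x :: "real ^ 'm::_"
  proof -
    have "(norm x)\<^sup>2 = (\<Sum>i\<in>UNIV. (x $ i)\<^sup>2)"
      unfolding norm_vec_def L2_set_def by (simp add: sum_nonneg)
    also have "\<dots> = (\<Sum>i\<in>I. (x $ i)\<^sup>2) + (\<Sum>i\<in>- I. (x $ i)\<^sup>2)"
      using sum.union_disjoint[of I "- I" "\<lambda>i. (x $ i)\<^sup>2"] by simp
    finally show ?thesis .
  qed
  have "(norm (Q x))\<^sup>2 = (norm x)\<^sup>2" for x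
  proof -
    have "(\<Sum>i\<in>I. (Q x $ i)\<^sup>2) = (norm (frame_map I f (Q x)))\<^sup>2"
      unfolding frame_map_def orthonormal_on_norm_sum[OF f finite] ..
    also have "\<dots> = (\<Sum>i\<in>I. (x $ i)\<^sup>2)"
      unfolding FQ unfolding frame_map_def orthonormal_on_norm_sum[OF oh finite] ..
    finally show ?thesis unfolding norm_split by (simp add: Q_def)
  qed
  then have nQ: "norm (Q x) = norm x" for x by simp
  have "linear Q"
    by (rule linearI) (simp_all add: Q_def vec_eq_iff linear_add[OF linear_frame_map]
        linear_cmul[OF linear_frame_map] inner_add_left)
  then have oQ: "orthogonal_transformation Q" using nQ by (simp add: orthogonal_transformation)
  have S: "x \<in> S \<longleftrightarrow> Q x \<in> cyl I Y" for x
  proof -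
    have "frame_map I f (Q x) \<in> frame_map I f ` Y \<longleftrightarrow> res I (Q x) \<in> Y"
    proof
      assume "frame_map I f (Q x) \<in> frame_map I f ` Y"
      then obtain y where y: "y \<in> Y" "frame_map I f (Q x) = frame_map I f y" by auto
      then have "Q x $ i = y $ i" if "i \<in> I" for i
        using orthonormal_on_sum_inner[OF f finite that] unfolding frame_map_def by metis
      then have "res I (Q x) = res I y" by (simp add: vec_eq_iff)
      then show "res I (Q x) \<in> Y" using y Y(2) by simp
    qed (use frame_map_res in \<open>metis imageI\<close>)
    then show ?thesis by (simp add: S_def cyl_def FQ) (simp add: Q_def)
  qed
  have mc: "cyl I Y \<in> lmeasurable" by (intro lmeasurable_compact compact_cyl Y)
  have "S = Q -` cyl I Y" using S by auto
  then have "S = inv Q ` cyl I Y"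
    using bij_vimage_eq_inv_image[OF orthogonal_transformation_bij[OF oQ]] by simp
  then have "measure lebesgue S = measure lebesgue (cyl I Y)" and "S \<in> lmeasurable"
    using measure_orthogonal_image[OF orthogonal_transformation_inv[OF oQ] mc]
      measurable_orthogonal_image[OF orthogonal_transformation_inv[OF oQ] mc] by simp_all
  moreover have "S \<in> sets borel"
  proof -
    have "S = Q -` cyl I Y" using S by auto
    moreover have "closed (Q -` cyl I Y)"
      by (intro closed_vimage compact_imp_closed compact_cyl Y linear_continuous_on
          linear_conv_bounded_linear[THEN iffD1] \<open>linear Q\<close>)
    ultimately show ?thesis by (simp add: borel_closed)
  qed
  ultimately show ?thesis using m by (simp add: H_def)
qed

lemma frame_map_mem_span: "frame_map I f x \<in> span (f ` I)"
  unfolding frame_map_def by (intro span_sum span_scale span_base) auto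

lemma parallel_body_frame:
  assumes f: "orthonormal_on I f"
  shows "parallel_body (span (f ` I)) (frame_map I f ` par_ell I c 0) t =
    frame_map I f ` par_ell I c t"
proof (intro equalityI subsetI)
  fix y assume "y \<in> parallel_body (span (f ` I)) (frame_map I f ` par_ell I c 0) t"
  then obtain z u where z: "norm z \<le> 1" and u: "u \<in> span (f ` I)" "norm u \<le> 1"
    and y: "y = frame_map I f (res I (scl c z)) + t *\<^sub>R u"
    by (auto simp: parallel_body_def par_ell_def)
  define v where "v = (\<chi> i. if i \<in> I then u \<bullet> f i else 0)"
  have Fv: "frame_map I f v = u"
    using orthonormal_on_expand[OF f finite u(1)] by (simp add: frame_map_def v_def)
  have "(norm v)\<^sup>2 = (\<Sum>i\<in>I. (v $ i)\<^sup>2)"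
    using norm_res[of I v] by (simp add: v_def res_def sum_nonneg cong: if_cong)
  then have "(norm v)\<^sup>2 = (norm u)\<^sup>2"
    using orthonormal_on_norm_sum[OF f finite, of "\<lambda>i. v $ i"] Fv by (simp add: frame_map_def)
  then have "norm v \<le> 1" using u by simp
  moreover have "y = frame_map I f (res I (scl c z + t *\<^sub>R v))"
    by (simp add: y frame_map_res linear_add[OF linear_frame_map] linear_cmul[OF linear_frame_map]
        Fv)
  ultimately show "y \<in> frame_map I f ` par_ell I c t"
    using z unfolding par_ell_def image_image by (intro image_eqI[where x="(z, v)"]) auto
next
  fix y assume "y \<in> frame_map I f ` par_ell I c t"
  then obtain z v where z: "norm z \<le> 1" "norm v \<le> 1"
    and y: "y = frame_map I f (res I (scl c z + t *\<^sub>R v))"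
    by (auto simp: par_ell_def)
  have "(norm (frame_map I f v))\<^sup>2 = (norm (res I v))\<^sup>2"
    unfolding frame_map_def orthonormal_on_norm_sum[OF f finite] by (simp add: norm_res sum_nonneg)
  also have "\<dots> \<le> (norm v)\<^sup>2"
    by (intro power_mono norm_le_componentwise_cart) auto
  finally have "norm (frame_map I f v) \<le> norm v" by (simp add: abs_le_square_iff[symmetric])
  then have "norm (frame_map I f v) \<le> 1" using z by simp
  moreover have "y = frame_map I f (res I (scl c z)) + t *\<^sub>R frame_map I f v"
    by (simp add: y frame_map_res linear_add[OF linear_frame_map] linear_cmul[OF linear_frame_map])
  moreover have "res I (scl c z) \<in> par_ell I c 0"
    using z unfolding par_ell_def by (intro image_eqI[where x="(z, 0)"]) auto
  ultimately show "y \<in> parallel_body (span (f ` I)) (frame_map I f ` par_ell I c 0) t"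
    unfolding parallel_body_def using frame_map_mem_span by fastforce
qed

lemma steiner_coeffs_frame:
  fixes I :: "'m::{finite,wellorder} set"
  assumes f: "orthonormal_on I f"
    and w: "\<And>t. 0 \<le> t \<Longrightarrow> cyl_vol I c t = (\<Sum>j\<le>card I. w j * t ^ j)"
  shows "steiner_coeffs (span (f ` I)) (frame_map I f ` par_ell I c 0)
    (\<lambda>j. if j \<le> card I then w j / real (card I choose j) else 0)"
proof -
  have "measure (subspace_lborel (span (f ` I))) (frame_map I f ` par_ell I c t) = cyl_vol I c t"
      for t
    unfolding cyl_vol_def by (rule measure_subspace_lborel_frame[OF f compact_par_ell par_ell_res])
  then show ?thesis
    unfolding steiner_coeffs_def orthonormal_on_dim[OF f finite] parallel_body_frame[OF f]
    by (auto simp: w atMost_atLeast0 intro!: sum.cong)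
qed

text \<open>
  Both Steiner polynomials are those of the model bodies, and the second exceeds the first by a
  polynomial with nonnegative coefficients.
\<close>

lemma quermassintegral_frame_mono:
  fixes I :: "'m::{finite,wellorder} set"
    and f :: "'m \<Rightarrow> 'a::euclidean_space" and f' :: "'m \<Rightarrow> 'b::euclidean_space"
  assumes f: "orthonormal_on I f" "orthonormal_on I f'"
    and c: "\<And>i. i \<in> I \<Longrightarrow> 0 < c i" "\<And>i. i \<in> I \<Longrightarrow> c i \<le> c' i"
  shows "quermassintegral (span (f ` I)) j (frame_map I f ` par_ell I c 0) \<le>
    quermassintegral (span (f' ` I)) j (frame_map I f' ` par_ell I c' 0)"
proof -
  obtain w where w: "\<And>t. 0 \<le> t \<Longrightarrow> cyl_vol I c t = (\<Sum>j\<le>card I. w j * t ^ j)"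
    using cyl_vol_poly[of I c, OF c(1)] by auto
  obtain d where d: "\<And>j. 0 \<le> d j"
    "\<And>t. 0 \<le> t \<Longrightarrow> cyl_vol I c' t = cyl_vol I c t + (\<Sum>j\<le>card I. d j * t ^ j)"
    using cyl_vol_enlarge[of I c c', OF c] by auto
  have w': "cyl_vol I c' t = (\<Sum>j\<le>card I. (w j + d j) * t ^ j)" if "0 \<le> t" for t
    using w d(2) that by (simp add: sum.distrib algebra_simps)
  have "quermassintegral (span (f ` I)) j (frame_map I f ` par_ell I c 0) =
      (if j \<le> card I then w j / real (card I choose j) else 0)"
    by (rule quermassintegral_eqI, rule steiner_coeffs_frame[OF f(1)], rule w)
  moreover have "quermassintegral (span (f' ` I)) j (frame_map I f' ` par_ell I c' 0) =
      (if j \<le> card I then (w j + d j) / real (card I choose j) else 0)"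
    by (rule quermassintegral_eqI, rule steiner_coeffs_frame[OF f(2)], rule w')
  ultimately show ?thesis
    using d(1) by (simp add: divide_right_mono)
qed

text \<open>
  The ellipsoid with centre 0 and semi-axes of length \<open>c i\<close> along the vectors \<open>f i\<close>.
\<close>

definition axis_ell :: "'i set \<Rightarrow> ('i \<Rightarrow> 'a::euclidean_space) \<Rightarrow> ('i \<Rightarrow> real) \<Rightarrow> 'a set" where
  "axis_ell K f c = {\<Sum>i\<in>K. (c i * z i) *\<^sub>R f i | z. (\<Sum>i\<in>K. (z i)\<^sup>2) \<le> 1}"

lemma axis_ellI: "(\<Sum>i\<in>K. (z i)\<^sup>2) \<le> 1 \<Longrightarrow> (\<Sum>i\<in>K. (c i * z i) *\<^sub>R f i) \<in> axis_ell K f c"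
  unfolding axis_ell_def by blast

lemma axis_ell_cong:
  assumes "\<And>i. i \<in> K \<Longrightarrow> c i = c' i"
  shows "axis_ell K f c = axis_ell K f c'"
proof -
  have "(\<Sum>i\<in>K. (c i * z i) *\<^sub>R f i) = (\<Sum>i\<in>K. (c' i * z i) *\<^sub>R f i)" for z
    by (intro sum.cong) (simp_all add: assms)
  then show ?thesis by (simp add: axis_ell_def)
qed

lemma frame_map_par_ell:
  fixes I :: "'m::finite set"
  shows "frame_map I f ` par_ell I c 0 = axis_ell I f c"
proof (intro equalityI subsetI)
  fix y assume "y \<in> frame_map I f ` par_ell I c 0"
  then obtain z where z: "norm z \<le> 1" and y: "y = frame_map I f (res I (scl c z))"
    by (auto simp: par_ell_def)
  have "norm (res I z) \<le> norm z"
    by (rule norm_le_componentwise_cart) auto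
  then have "norm (res I z) \<le> 1" using z by simp
  then have "(\<Sum>i\<in>I. (z $ i)\<^sup>2) \<le> 1" by (simp add: norm_res)
  then show "y \<in> axis_ell I f c"
    unfolding axis_ell_def y frame_map_res by (auto simp: frame_map_def)
next
  fix y assume "y \<in> axis_ell I f c"
  then obtain z where z: "(\<Sum>i\<in>I. (z i)\<^sup>2) \<le> 1" and y: "y = (\<Sum>i\<in>I. (c i * z i) *\<^sub>R f i)"
    by (auto simp: axis_ell_def)
  define u where "u = res I (\<chi> i. z i)"
  have "norm u \<le> 1" using z by (simp add: u_def norm_res)
  moreover have "y = frame_map I f (res I (scl c u))"
    by (simp add: y frame_map_def u_def)
  ultimately show "y \<in> frame_map I f ` par_ell I c 0"
    unfolding par_ell_def by (intro image_eqI[where x="res I (scl c u)"] image_eqI[where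
        x="(u, 0)"]) auto
qed

lemma axis_ell_reindex:
  assumes "bij_betw \<phi> I K"
  shows "axis_ell K f c = axis_ell I (f \<circ> \<phi>) (c \<circ> \<phi>)"
proof (intro equalityI subsetI)
  fix y assume "y \<in> axis_ell K f c"
  then obtain z where z: "(\<Sum>i\<in>K. (z i)\<^sup>2) \<le> 1" and y: "y = (\<Sum>i\<in>K. (c i * z i) *\<^sub>R f i)"
    by (auto simp: axis_ell_def)
  show "y \<in> axis_ell I (f \<circ> \<phi>) (c \<circ> \<phi>)"
    unfolding axis_ell_def using z
    by (auto intro!: exI[of _ "z \<circ> \<phi>"] simp: y sum.reindex_bij_betw[OF assms, symmetric])
next
  fix y assume "y \<in> axis_ell I (f \<circ> \<phi>) (c \<circ> \<phi>)"
  then obtain z where z: "(\<Sum>i\<in>I. (z i)\<^sup>2) \<le> 1" and y: "y = (\<Sum>i\<in>I. (c (\<phi> i) * z i) *\<^sub>R f (\<phi> i))"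
    by (auto simp: axis_ell_def)
  let ?g = "the_inv_into I \<phi>"
  have g: "?g (\<phi> i) = i" if "i \<in> I" for i
    using that assms by (simp add: bij_betw_def the_inv_into_f_f)
  show "y \<in> axis_ell K f c"
    unfolding axis_ell_def using z
    by (auto intro!: exI[of _ "z \<circ> ?g"] sum.cong simp: y sum.reindex_bij_betw[OF assms, symmetric]
        g)
qed

text \<open>
  The type \<open>'m\<close> only provides a model space that is large enough.
\<close>

lemma quermassintegral_axis_ell_mono:
  fixes K :: "'i set" and f :: "'i \<Rightarrow> 'a::euclidean_space" and f' :: "'i \<Rightarrow> 'b::euclidean_space"
  assumes K: "finite K" "card K \<le> CARD('m::{finite,wellorder})"
    and f: "orthonormal_on K f" "orthonormal_on K f'"
    and c: "\<And>i. i \<in> K \<Longrightarrow> 0 < c i" "\<And>i. i \<in> K \<Longrightarrow> c i \<le> c' i"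
  shows "quermassintegral (span (f ` K)) j (axis_ell K f c) \<le>
    quermassintegral (span (f' ` K)) j (axis_ell K f' c')"
proof -
  obtain I :: "'m set" where "card I = card K"
    using K(2) obtain_subset_with_card_n by blast
  then obtain \<phi> where \<phi>: "bij_betw \<phi> I K"
    using K(1) finite_same_card_bij[of I K] by auto
  have im: "\<phi> ` I = K" and inj: "inj_on \<phi> I" using \<phi> by (auto simp: bij_betw_def)
  note o = orthonormal_on_reindex[OF _ inj equalityD1[OF im]]
  have "quermassintegral (span ((f \<circ> \<phi>) ` I)) j (frame_map I (f \<circ> \<phi>) ` par_ell I (c \<circ> \<phi>) 0) \<le>
    quermassintegral (span ((f' \<circ> \<phi>) ` I)) j (frame_map I (f' \<circ> \<phi>) ` par_ell I (c' \<circ> \<phi>) 0)"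
    using c im by (intro quermassintegral_frame_mono o f) auto
  then show ?thesis
    unfolding frame_map_par_ell axis_ell_reindex[OF \<phi>, symmetric] image_comp[symmetric] im .
qed

section \<open>Principal axes of sections and projections\<close>

text \<open>
  The first-order condition for a maximum of \<open>norm (T x)\<close> on the unit sphere of \<open>H\<close>.
\<close>

lemma orthogonal_image_of_norm_maximizer:
  fixes T :: "'a::euclidean_space \<Rightarrow> 'b::euclidean_space"
  assumes T: "linear T" and H: "subspace H" and u: "u \<in> H" "norm u = 1"
    and max: "\<And>x. x \<in> H \<Longrightarrow> norm x = 1 \<Longrightarrow> norm (T x) \<le> norm (T u)"
    and y: "y \<in> H" "u \<bullet> y = 0"
  shows "T u \<bullet> T y = 0"
proof -
  have bound: "norm (T x) \<le> norm (T u) * norm x" if "x \<in> H" for x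
  proof (cases "x = 0")
    case True
    then show ?thesis using linear_0[OF T] by simp
  next
    case False
    then have "norm (T (x /\<^sub>R norm x)) \<le> norm (T u)"
      using that by (intro max subspace_scale[OF H]) auto
    then show ?thesis using False by (simp add: linear_cmul[OF T] field_simps)
  qed
  define b where "b = T u \<bullet> T y"
  define C where "C = (norm (T u))\<^sup>2 * (norm y)\<^sup>2 + 1"
  have C: "0 < C" by (simp add: C_def add_nonneg_pos)
  \<comment> \<open>Any small positive multiple of \<open>b\<close> would contradict maximality if \<open>b\<close> were nonzero; this one
    makes the quadratic term at most half of the linear one.\<close>
  define s where "s = b / C"
  have "(norm (T (u + s *\<^sub>R y)))\<^sup>2 \<le> (norm (T u) * norm (u + s *\<^sub>R y))\<^sup>2"
    using u y by (intro power_mono bound subspace_add[OF H] subspace_scale[OF H]) auto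
  moreover have "(norm (T (u + s *\<^sub>R y)))\<^sup>2 = (norm (T u))\<^sup>2 + 2 * s * b + s\<^sup>2 * (norm (T y))\<^sup>2"
    unfolding linear_add[OF T] linear_cmul[OF T] power2_norm_eq_inner b_def
    by (simp add: inner_add_left inner_add_right inner_commute algebra_simps power2_eq_square)
  moreover have "(norm (u + s *\<^sub>R y))\<^sup>2 = 1 + s\<^sup>2 * (norm y)\<^sup>2"
    using u(2) y(2) unfolding power2_norm_eq_inner norm_eq_1
    by (simp add: inner_add_left inner_add_right inner_commute algebra_simps power2_eq_square)
  ultimately have "2 * s * b + s\<^sup>2 * (norm (T y))\<^sup>2 \<le> s\<^sup>2 * (C - 1)"
    by (simp add: power_mult_distrib C_def algebra_simps)
  moreover have "0 \<le> s\<^sup>2 * (norm (T y))\<^sup>2" "s\<^sup>2 * (C - 1) \<le> s\<^sup>2 * C" by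
      (simp_all add: mult_left_mono)
  ultimately have "2 * s * b \<le> s\<^sup>2 * C" by linarith
  then have "2 * (b\<^sup>2 / C) \<le> b\<^sup>2 / C" using C by (simp add: s_def power2_eq_square)
  then have "b\<^sup>2 / C \<le> 0" by linarith
  then have "b = 0" using divide_pos_pos[of "b\<^sup>2" C] C by (metis not_le zero_less_power2)
  then show ?thesis by (simp add: b_def)
qed

text \<open>
  The orthonormal family of a singular value decomposition: the vectors \<open>f i\<close> are orthonormal and
  their images are orthogonal, so that \<open>norm (T (f i))\<close> are the singular values.
\<close>

definition principal_frame :: "('a::euclidean_space \<Rightarrow> 'b::euclidean_space) \<Rightarrow> 'i set \<Rightarrow> ('i \<Rightarrow> 'a) \<Rightarrow> bool" where
  "principal_frame T K f \<longleftrightarrow> finite K \<and> orthonormal_on K f \<and>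
     (\<forall>i\<in>K. \<forall>j\<in>K. i \<noteq> j \<longrightarrow> T (f i) \<bullet> T (f j) = 0)"

lemma principal_frame_subset: "principal_frame T K f \<Longrightarrow> J \<subseteq> K \<Longrightarrow> principal_frame T J f"
  unfolding principal_frame_def orthonormal_on_def by (meson finite_subset subsetD)

text \<open>
  The last vector is a unit vector of \<open>H\<close> at which \<open>norm (T x)\<close> is maximal; the others come from its
  orthogonal complement in \<open>H\<close>, which \<open>T\<close> maps into the orthogonal complement of the image of that
  vector.
\<close>

lemma ex_principal_frame:
  fixes T :: "'a::euclidean_space \<Rightarrow> 'b::euclidean_space"
  assumes T: "linear T" and H: "subspace H" "dim H = k"
  shows "\<exists>f. principal_frame T {1..k} f \<and> span (f ` {1..k}) = H \<and>
    (\<forall>i j. 1 \<le> i \<longrightarrow> i \<le> j \<longrightarrow> j \<le> k \<longrightarrow> norm (T (f i)) \<le> norm (T (f j)))"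
  using H
proof (induction k arbitrary: H)
  case 0
  then have "H = {0}" using dim_eq_0[of H] subspace_0 by blast
  then show ?case by (simp add: principal_frame_def orthonormal_on_def)
next
  case (Suc k)
  have "compact (sphere 0 1 \<inter> H)"
    using Suc.prems by (intro compact_Int_closed closed_subspace) auto
  moreover obtain x where "x \<in> H" "x \<noteq> 0"
    using Suc.prems dim_eq_0[of H] by auto
  then have "x /\<^sub>R norm x \<in> sphere 0 1 \<inter> H"
    using Suc.prems by (simp add: subspace_scale)
  moreover have "continuous_on (sphere 0 1 \<inter> H) (\<lambda>x. norm (T x))"
    by (intro continuous_on_norm linear_continuous_on linear_conv_bounded_linear[THEN iffD1] T)
  ultimately obtain u where "u \<in> sphere 0 1 \<inter> H" "\<forall>x\<in>sphere 0 1 \<inter> H. norm (T x) \<le> norm (T u)"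
    using continuous_attains_sup[of "sphere 0 1 \<inter> H" "\<lambda>x. norm (T x)"] by blast
  then have u: "u \<in> H" "norm u = 1"
    and max: "\<And>x. x \<in> H \<Longrightarrow> norm x = 1 \<Longrightarrow> norm (T x) \<le> norm (T u)" by auto
  define H' where "H' = {y \<in> H. \<forall>x\<in>span {u}. orthogonal x y}"
  have H'_iff: "y \<in> H' \<longleftrightarrow> y \<in> H \<and> u \<bullet> y = 0" for y
    unfolding H'_def by (auto simp: orthogonal_def span_singleton)
  have subH': "subspace H'"
    using Suc.prems(1) by (auto simp: subspace_def H'_iff inner_add_right)
  have "dim H' + dim (span {u}) = dim H"
    unfolding H'_def using Suc.prems(1) u(1)
    by (intro dim_subspace_orthogonal_to_vectors) (auto simp: span_minimal)
  moreover have "dim (span {u}) = 1" using u(2) by (auto simp: dim_insert)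
  ultimately have "dim H' = k" using Suc.prems by simp
  from Suc.IH[OF subH' this] obtain f where f: "principal_frame T {1..k} f" "span (f ` {1..k}) = H'"
    "\<And>i j. 1 \<le> i \<Longrightarrow> i \<le> j \<Longrightarrow> j \<le> k \<Longrightarrow> norm (T (f i)) \<le> norm (T (f j))" by auto
  define g where "g = f(Suc k := u)"
  have "f ` {1..k} \<subseteq> H'" unfolding f(2)[symmetric] by (rule span_superset)
  then have fH': "f i \<in> H'" if "i \<in> {1..k}" for i using that by auto
  have g: "g i = f i" if "i \<in> {1..k}" for i using that by (simp add: g_def)
  have gS: "g (Suc k) = u" by (simp add: g_def)
  have insert: "{1..Suc k} = insert (Suc k) {1..k}" by auto
  have "principal_frame T {1..Suc k} g"
  proof -
    have "u \<bullet> f i = 0" "T u \<bullet> T (f i) = 0" "norm (f i) = 1" if "i \<in> {1..k}" for i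
      using fH'[OF that] f(1) that orthogonal_image_of_norm_maximizer[OF T Suc.prems(1) u max]
      by (auto simp: H'_iff principal_frame_def orthonormal_on_def norm_eq_1)
    then show ?thesis
      using f(1) u(2) unfolding principal_frame_def orthonormal_on_def insert
      by (auto simp: g gS inner_commute norm_eq_1)
  qed
  moreover have "span (g ` {1..Suc k}) = H"
  proof (rule antisym)
    have "g ` {1..Suc k} \<subseteq> H" unfolding insert using u fH' H'_iff by (auto simp: g gS)
    then show "span (g ` {1..Suc k}) \<subseteq> H" using Suc.prems(1) by (rule span_minimal)
  next
    show "H \<subseteq> span (g ` {1..Suc k})"
    proof
      fix x assume x: "x \<in> H"
      have "x - (u \<bullet> x) *\<^sub>R u \<in> H'"
        using x u Suc.prems(1) by (simp add: H'_iff subspace_diff subspace_scale inner_diff_right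
            norm_eq_1)
      then have "x - (u \<bullet> x) *\<^sub>R u \<in> span (g ` {1..Suc k})"
        unfolding f(2)[symmetric] using g by (elim span_mono[THEN subsetD, rotated]) force
      moreover have "(u \<bullet> x) *\<^sub>R u \<in> span (g ` {1..Suc k})"
        unfolding insert using gS by (intro span_scale span_base) auto
      ultimately show "x \<in> span (g ` {1..Suc k})" using span_add by fastforce
    qed
  qed
  moreover have "norm (T (g i)) \<le> norm (T (g j))" if "1 \<le> i" "i \<le> j" "j \<le> Suc k" for i j
  proof (cases "j = Suc k")
    case True
    then show ?thesis
      using that fH'[of i] max[of "f i"] f(1)
      by (cases "i = Suc k") (auto simp: gS g H'_iff principal_frame_def orthonormal_on_def
          norm_eq_1)
  next
    case False
    then show ?thesis using that f(3)[of i j] by (simp add: g)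
  qed
  ultimately show ?case by blast
qed

lemma ex_principal_frame_antimono:
  fixes T :: "'a::euclidean_space \<Rightarrow> 'b::euclidean_space"
  assumes T: "linear T" and H: "subspace H" "dim H = k"
  shows "\<exists>f. principal_frame T {1..k} f \<and> span (f ` {1..k}) = H \<and>
    (\<forall>i j. 1 \<le> i \<longrightarrow> i \<le> j \<longrightarrow> j \<le> k \<longrightarrow> norm (T (f j)) \<le> norm (T (f i)))"
proof -
  obtain f where f: "principal_frame T {1..k} f" "span (f ` {1..k}) = H"
    "\<And>i j. 1 \<le> i \<Longrightarrow> i \<le> j \<Longrightarrow> j \<le> k \<Longrightarrow> norm (T (f i)) \<le> norm (T (f j))"
    using ex_principal_frame[OF assms] by auto
  define r where "r i = k + 1 - i" for i :: nat
  have r: "r i \<in> {1..k}" "r (r i) = i" if "i \<in> {1..k}" for i using that by (auto simp: r_def)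
  then have im: "r ` {1..k} = {1..k}" by (metis image_eqI image_subsetI subsetI subset_antisym)
  have inj: "r i = r j \<longleftrightarrow> i = j" if "i \<in> {1..k}" "j \<in> {1..k}" for i j using r that by metis
  have "principal_frame T {1..k} (f \<circ> r)"
    using f(1) r inj unfolding principal_frame_def orthonormal_on_def by simp
  moreover have "span ((f \<circ> r) ` {1..k}) = H" by (simp only: image_comp[symmetric] im f(2))
  moreover have "norm (T ((f \<circ> r) j)) \<le> norm (T ((f \<circ> r) i))" if "1 \<le> i" "i \<le> j" "j \<le> k" for i j
    using that by (auto simp: r_def intro!: f(3))
  ultimately show ?thesis by blast
qed

lemma principal_frame_norm_image:
  assumes T: "linear T" and f: "principal_frame T K f"
  shows "(norm (T (\<Sum>i\<in>K. x i *\<^sub>R f i)))\<^sup>2 = (\<Sum>i\<in>K. (x i * norm (T (f i)))\<^sup>2)"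
proof -
  have K: "finite K" using f by (simp add: principal_frame_def)
  have "(norm (T (\<Sum>i\<in>K. x i *\<^sub>R f i)))\<^sup>2 = (\<Sum>i\<in>K. \<Sum>j\<in>K. x i * x j * (T (f i) \<bullet> T (f j)))"
    unfolding power2_norm_eq_inner linear_sum[OF T] linear_cmul[OF T]
    by (subst inner_sum_left, subst inner_sum_right) (simp add: mult.assoc mult.left_commute)
  also have "\<dots> = (\<Sum>i\<in>K. \<Sum>j\<in>K. if j = i then (x i * norm (T (f i)))\<^sup>2 else 0)"
    using f by (intro sum.cong refl)
      (auto simp: principal_frame_def power_mult_distrib dot_square_norm power2_eq_square)
  finally show ?thesis using K by simp
qed

lemma principal_frame_norm_bounds:
  assumes T: "linear T" and f: "principal_frame T K f" and x: "x \<in> span (f ` K)" and m: "0 \<le> m"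
  shows "(\<And>i. i \<in> K \<Longrightarrow> norm (T (f i)) \<le> m) \<Longrightarrow> norm (T x) \<le> m * norm x"
    and "(\<And>i. i \<in> K \<Longrightarrow> m \<le> norm (T (f i))) \<Longrightarrow> m * norm x \<le> norm (T x)"
proof -
  have K: "finite K" "orthonormal_on K f" using f by (simp_all add: principal_frame_def)
  have x': "(\<Sum>i\<in>K. (x \<bullet> f i) *\<^sub>R f i) = x" by (rule orthonormal_on_expand[OF K(2,1) x])
  have Tx: "(norm (T x))\<^sup>2 = (\<Sum>i\<in>K. (x \<bullet> f i)\<^sup>2 * (norm (T (f i)))\<^sup>2)"
    using principal_frame_norm_image[OF T f, of "\<lambda>i. x \<bullet> f i"] by (simp add: x' power_mult_distrib)
  have nx: "(m * norm x)\<^sup>2 = (\<Sum>i\<in>K. (x \<bullet> f i)\<^sup>2 * m\<^sup>2)"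
    using orthonormal_on_norm_sum[OF K(2,1), of "\<lambda>i. x \<bullet> f i"]
    by (simp add: x' power_mult_distrib sum_distrib_right[symmetric])
  show "norm (T x) \<le> m * norm x" if "\<And>i. i \<in> K \<Longrightarrow> norm (T (f i)) \<le> m"
  proof (rule power2_le_imp_le)
    show "(norm (T x))\<^sup>2 \<le> (m * norm x)\<^sup>2"
      unfolding Tx nx by (intro sum_mono mult_left_mono power_mono that) auto
  qed (use m in simp)
  show "m * norm x \<le> norm (T x)" if "\<And>i. i \<in> K \<Longrightarrow> m \<le> norm (T (f i))"
  proof (rule power2_le_imp_le)
    show "(m * norm x)\<^sup>2 \<le> (norm (T x))\<^sup>2"
      unfolding Tx nx by (intro sum_mono mult_left_mono power_mono that m) auto
  qed simp
qed

lemma unit_preimage_section: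
  assumes T: "linear T" and f: "principal_frame T K f" and nz: "\<And>i. i \<in> K \<Longrightarrow> T (f i) \<noteq> 0"
  shows "{x. norm (T x) \<le> 1} \<inter> span (f ` K) = axis_ell K f (\<lambda>i. 1 / norm (T (f i)))"
proof (intro equalityI subsetI)
  have K: "finite K" "orthonormal_on K f" using f by (simp_all add: principal_frame_def)
  fix x assume "x \<in> {x. norm (T x) \<le> 1} \<inter> span (f ` K)"
  then have x: "norm (T x) \<le> 1" "(\<Sum>i\<in>K. (x \<bullet> f i) *\<^sub>R f i) = x"
    using orthonormal_on_expand[OF K(2,1)] by auto
  have "(\<Sum>i\<in>K. ((x \<bullet> f i) * norm (T (f i)))\<^sup>2) \<le> 1"
    using x principal_frame_norm_image[OF T f, of "\<lambda>i. x \<bullet> f i"] power_le_one[of "norm (T x)" 2]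
    by simp
  moreover have "x = (\<Sum>i\<in>K. (1 / norm (T (f i)) * ((x \<bullet> f i) * norm (T (f i)))) *\<^sub>R f i)"
    using nz by (subst x(2)[symmetric]) (auto intro!: sum.cong)
  ultimately show "x \<in> axis_ell K f (\<lambda>i. 1 / norm (T (f i)))"
    using axis_ellI[of "\<lambda>i. (x \<bullet> f i) * norm (T (f i))" K "\<lambda>i. 1 / norm (T (f i))" f] by
        (simp only:)
next
  fix x assume "x \<in> axis_ell K f (\<lambda>i. 1 / norm (T (f i)))"
  then obtain z where z: "(\<Sum>i\<in>K. (z i)\<^sup>2) \<le> 1"
      and x: "x = (\<Sum>i\<in>K. (1 / norm (T (f i)) * z i) *\<^sub>R f i)"
    unfolding axis_ell_def by blast
  have "(norm (T x))\<^sup>2 = (\<Sum>i\<in>K. (1 / norm (T (f i)) * z i * norm (T (f i)))\<^sup>2)"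
    unfolding x by (rule principal_frame_norm_image[OF T f])
  also have "\<dots> = (\<Sum>i\<in>K. (z i)\<^sup>2)" using nz by (intro sum.cong) auto
  finally have "norm (T x) \<le> 1" using z abs_square_le_1[of "norm (T x)"] by simp
  moreover have "x \<in> span (f ` K)" unfolding x by (intro span_sum span_scale span_base) auto
  ultimately show "x \<in> {x. norm (T x) \<le> 1} \<inter> span (f ` K)" by simp
qed

lemma orth_proj_span:
  assumes "orthonormal_on K f" "finite K"
  shows "orth_proj (span (f ` K)) x = (\<Sum>i\<in>K. (x \<bullet> f i) *\<^sub>R f i)"
proof (rule orth_proj_eqI)
  show "(\<Sum>i\<in>K. (x \<bullet> f i) *\<^sub>R f i) \<in> span (f ` K)" by (intro span_sum span_scale span_base) auto
  fix z assume "z \<in> span (f ` K)"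
  moreover have "orthogonal (x - (\<Sum>i\<in>K. (x \<bullet> f i) *\<^sub>R f i)) y" if "y \<in> f ` K" for y
    using that orthonormal_on_sum_inner[OF assms] by (auto simp: orthogonal_def inner_diff_left)
  ultimately show "orthogonal (x - (\<Sum>i\<in>K. (x \<bullet> f i) *\<^sub>R f i)) z"
    using orthogonal_to_span by blast
qed simp

lemma bessel_inequality:
  assumes "orthonormal_on K g" "finite K"
  shows "(\<Sum>i\<in>K. (u \<bullet> g i)\<^sup>2) \<le> (norm u)\<^sup>2"
proof -
  let ?p = "\<Sum>i\<in>K. (u \<bullet> g i) *\<^sub>R g i"
  have "u \<bullet> ?p = (\<Sum>i\<in>K. (u \<bullet> g i)\<^sup>2)"
    by (simp add: inner_sum_right power2_eq_square)
  moreover have "(norm ?p)\<^sup>2 = (\<Sum>i\<in>K. (u \<bullet> g i)\<^sup>2)"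
    by (rule orthonormal_on_norm_sum[OF assms])
  moreover have "(norm (u - ?p))\<^sup>2 = (norm u)\<^sup>2 - 2 * (u \<bullet> ?p) + (norm ?p)\<^sup>2"
    by (simp add: power2_norm_eq_inner inner_diff_left inner_diff_right inner_commute)
  moreover have "0 \<le> (norm (u - ?p))\<^sup>2" by simp
  ultimately show ?thesis by linarith
qed

text \<open>
  As \<open>T\<close> is self-adjoint, the \<open>i\<close>-th coordinate of the projection of \<open>T u\<close> is
  \<open>u \<bullet> T (f i) = norm (T (f i)) * (u \<bullet> g i)\<close> for the normalized images \<open>g i\<close>. These are
  orthonormal, so that for \<open>u\<close> in the unit ball the vectors with components \<open>u \<bullet> g i\<close> stay in the
  unit ball by Bessel's inequality and reach each of its points.
\<close>

lemma orth_proj_image_cball: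
  fixes T :: "'a::euclidean_space \<Rightarrow> 'a"
  assumes T: "\<And>x y. T x \<bullet> y = x \<bullet> T y" and f: "principal_frame T K f"
    and nz: "\<And>i. i \<in> K \<Longrightarrow> T (f i) \<noteq> 0"
  shows "orth_proj (span (f ` K)) ` T ` cball 0 1 = axis_ell K f (\<lambda>i. norm (T (f i)))"
proof -
  have K: "finite K" "orthonormal_on K f" using f by (simp_all add: principal_frame_def)
  define g where "g i = T (f i) /\<^sub>R norm (T (f i))" for i
  have g: "orthonormal_on K g"
  proof -
    have "norm (g i) = 1" if "i \<in> K" for i using nz[OF that] by (simp add: g_def)
    then show ?thesis
      using f by (auto simp: principal_frame_def orthonormal_on_def norm_eq_1) (simp add: g_def)
  qed
  have P: "orth_proj (span (f ` K)) (T u) = (\<Sum>i\<in>K. (norm (T (f i)) * (u \<bullet> g i)) *\<^sub>R f i)" for u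
    unfolding orth_proj_span[OF K(2,1)] using nz by (auto intro!: sum.cong simp: T g_def)
  show ?thesis
  proof (intro equalityI subsetI)
    fix y assume "y \<in> orth_proj (span (f ` K)) ` T ` cball 0 1"
    then obtain u where u: "norm u \<le> 1" and y: "y = orth_proj (span (f ` K)) (T u)" by auto
    have "(\<Sum>i\<in>K. (u \<bullet> g i)\<^sup>2) \<le> 1"
      using bessel_inequality[OF g K(1), of u] u by (smt (verit) norm_ge_zero power_le_one)
    then show "y \<in> axis_ell K f (\<lambda>i. norm (T (f i)))"
      unfolding y P by (rule axis_ellI)
  next
    fix y assume "y \<in> axis_ell K f (\<lambda>i. norm (T (f i)))"
    then obtain z where z: "(\<Sum>i\<in>K. (z i)\<^sup>2) \<le> 1" and y: "y = (\<Sum>i\<in>K. (norm (T (f i)) * z i) *\<^sub>R f i)"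
      unfolding axis_ell_def by blast
    define u where "u = (\<Sum>i\<in>K. z i *\<^sub>R g i)"
    have "norm u \<le> 1"
      using z orthonormal_on_norm_sum[OF g K(1), of z] abs_square_le_1[of "norm u"]
      by (simp add: u_def)
    moreover have "y = orth_proj (span (f ` K)) (T u)"
      unfolding P y using orthonormal_on_sum_inner[OF g K(1)] by (auto intro!: sum.cong simp: u_def)
    ultimately show "y \<in> orth_proj (span (f ` K)) ` T ` cball 0 1" by auto
  qed
qed

lemma subspaces_meet:
  fixes A B H :: "'a::euclidean_space set"
  assumes "subspace A" "subspace B" "subspace H" "A \<subseteq> H" "B \<subseteq> H" "dim H < dim A + dim B"
  obtains x where "x \<in> A" "x \<in> B" "x \<noteq> 0"
proof -
  have "{x + y |x y. x \<in> A \<and> y \<in> B} \<subseteq> H"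
    using assms by (auto intro: subspace_add)
  then have "dim {x + y |x y. x \<in> A \<and> y \<in> B} \<le> dim H" by (rule dim_subset)
  then have "dim (A \<inter> B) \<noteq> 0" using dim_sums_Int[OF assms(1,2)] assms(6) by linarith
  then show ?thesis using that dim_eq_0[of "A \<inter> B"] by auto
qed

section \<open>Interlacing of semi-axes\<close>

definition axis_scaling :: "nat \<Rightarrow> (nat \<Rightarrow> 'a::euclidean_space) \<Rightarrow> (nat \<Rightarrow> real) \<Rightarrow> 'a \<Rightarrow> 'a" where
  "axis_scaling n e a x = (\<Sum>i=1..n. (a i * (x \<bullet> e i)) *\<^sub>R e i)"

lemma linear_axis_scaling: "linear (axis_scaling n e a)"
  by (rule linearI) (simp_all add: axis_scaling_def inner_add_left algebra_simps sum.distrib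
      scaleR_sum_right)

lemma axis_scaling_selfadjoint: "axis_scaling n e a x \<bullet> y = x \<bullet> axis_scaling n e a y"
  by (simp add: axis_scaling_def inner_sum_left inner_sum_right inner_commute ac_simps)

lemma axis_scaling_axis:
  assumes "orthonormal_on {1..n} e" "j \<in> {1..n}"
  shows "axis_scaling n e a (e j) = a j *\<^sub>R e j"
proof -
  have "axis_scaling n e a (e j) = (\<Sum>i=1..n. if i = j then a j *\<^sub>R e j else 0)"
    unfolding axis_scaling_def using assms
    by (intro sum.cong refl) (auto simp: orthonormal_on_def)
  then show ?thesis using assms(2) by simp
qed

lemma axis_scaling_compose:
  assumes e: "orthonormal_on {1..n} e" "n = DIM('a)" and ab: "\<And>i. i \<in> {1..n} \<Longrightarrow> a i * b i = 1"
  shows "axis_scaling n e a (axis_scaling n e b x) = (x::'a::euclidean_space)"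
proof -
  have "span (e ` {1..n}) = UNIV"
    using orthonormal_on_dim[OF e(1)] e(2) dim_eq_full[of "e ` {1..n}"] by simp
  then have x: "(\<Sum>i=1..n. (x \<bullet> e i) *\<^sub>R e i) = x"
    by (intro orthonormal_on_expand e) auto
  have "axis_scaling n e b x \<bullet> e i = b i * (x \<bullet> e i)" if "i \<in> {1..n}" for i
    unfolding axis_scaling_def by (rule orthonormal_on_sum_inner[OF e(1) _ that]) simp
  then have "axis_scaling n e a (axis_scaling n e b x) = (\<Sum>i=1..n. (a i * b i * (x \<bullet> e i)) *\<^sub>R e i)"
    unfolding axis_scaling_def[of n e a] by (intro sum.cong refl) simp
  also have "\<dots> = (\<Sum>i=1..n. (x \<bullet> e i) *\<^sub>R e i)"
    by (intro sum.cong refl) (simp add: ab)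
  finally show ?thesis using x by simp
qed

lemma principal_frame_axes:
  assumes "orthonormal_on {1..n} e" "K \<subseteq> {1..n}"
  shows "principal_frame (axis_scaling n e a) K e"
proof -
  have "axis_scaling n e a (e i) = a i *\<^sub>R e i" if "i \<in> K" for i
    using that assms axis_scaling_axis by blast
  then show ?thesis
    using assms finite_subset[OF assms(2)]
    by (auto simp: principal_frame_def orthonormal_on_def subset_iff)
qed

text \<open>
  With all semi-axes in increasing order, each of the three inequalities between them comes from a
  nonzero vector \<open>x\<close> in the intersection of two spans. In the comparisons with the axes \<open>e i\<close> the
  length of \<open>S x\<close> or \<open>T x\<close> is bounded below by one of the two families and above by the other. The
  comparison of section and projection bounds both lengths above and uses
  \<open>x \<bullet> x = S x \<bullet> T x \<le> norm (S x) * norm (T x)\<close>. The frame \<open>f\<close> of the section is ordered by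
  decreasing \<open>norm (S (f i))\<close>, as the semi-axes are the reciprocals.
\<close>

lemma quermassintegral_ellipsoid_section_chain:
  fixes e :: "nat \<Rightarrow> real ^ 'n" and a :: "nat \<Rightarrow> real"
  assumes e: "orthonormal_on {1..CARD('n)} e"
    and pos: "\<forall>i\<in>{1..CARD('n)}. 0 < a i"
    and ordered: "mono_on {1..CARD('n)} a"
    and H: "subspace H" "dim H = k"
  shows "quermassintegral (span (e ` {1..k})) j (ellipsoid e a \<inter> span (e ` {1..k}))
      \<le> quermassintegral H j (ellipsoid e a \<inter> H)" (is ?first)
    and "quermassintegral H j (ellipsoid e a \<inter> H)
      \<le> quermassintegral H j (orth_proj H ` ellipsoid e a)" (is ?second)
    and "quermassintegral H j (orth_proj H ` ellipsoid e a)
      \<le> quermassintegral (span (e ` {CARD('n) - k + 1..CARD('n)})) j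
          (ellipsoid e a \<inter> span (e ` {CARD('n) - k + 1..CARD('n)}))" (is ?third)
proof -
  define n where "n = CARD('n)"
  note e = e[folded n_def] and pos = bspec[OF pos[folded n_def]] and ordered = ordered[folded n_def]
  have n: "n = DIM(real ^ 'n)" by (simp add: n_def)
  have kn: "k \<le> n" using H dim_subset_UNIV[of H] n by simp
  define T where "T = axis_scaling n e a"
  define S where "S = axis_scaling n e (\<lambda>i. 1 / a i)"
  have lin: "linear T" "linear S" by (simp_all add: T_def S_def linear_axis_scaling)
  have inv: "T (S x) = x" "S (T x) = x" for x
    unfolding T_def S_def using pos by (auto intro!: axis_scaling_compose[OF e n] simp:
        less_imp_neq[THEN not_sym])
  have nz: "T x \<noteq> 0" "S x \<noteq> 0" if "x \<noteq> 0" for x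
    using that inv linear_0[OF lin(1)] linear_0[OF lin(2)] by metis+
  have TS: "S x \<bullet> T x = x \<bullet> x" for x
    using axis_scaling_selfadjoint[of n e a "S x" x] inv(1) by (simp add: T_def)
  have Te: "T (e i) = a i *\<^sub>R e i" "S (e i) = (1 / a i) *\<^sub>R e i" if "i \<in> {1..n}" for i
    unfolding T_def S_def using axis_scaling_axis[OF e that] by auto
  have ne: "norm (e i) = 1" if "i \<in> {1..n}" for i
    using e that by (simp add: orthonormal_on_def norm_eq_1)
  have nTe: "norm (T (e i)) = a i" "norm (S (e i)) = 1 / a i" if "i \<in> {1..n}" for i
    using Te[OF that] ne[OF that] pos[OF that] by simp_all
  have axes: "principal_frame T K e" "principal_frame S K e" if "K \<subseteq> {1..n}" for K
    unfolding T_def S_def using principal_frame_axes[OF e that] by auto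
  have am: "a i \<le> a i'" if "i \<in> {1..n}" "i' \<in> {1..n}" "i \<le> i'" for i i'
    using ordered that by (auto simp: mono_on_def)
  have E: "ellipsoid e a = {x. norm (S x) \<le> 1}"
  proof -
    have "(\<Sum>i=1..n. ((x \<bullet> e i) / a i)\<^sup>2) = (norm (S x))\<^sup>2" for x
      unfolding S_def axis_scaling_def by (subst orthonormal_on_norm_sum[OF e]) simp_all
    then show ?thesis unfolding ellipsoid_def n_def[symmetric] by (simp add: abs_square_le_1)
  qed
  have ET: "ellipsoid e a = T ` cball 0 1"
  proof (intro equalityI subsetI)
    fix x assume "x \<in> ellipsoid e a"
    then show "x \<in> T ` cball 0 1" using inv(1)[of x] by (intro image_eqI[of _ _ "S x"])
        (auto simp: E)
  qed (auto simp: E inv)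
  obtain f where f: "principal_frame S {1..k} f" "span (f ` {1..k}) = H"
    and f_mono: "\<And>i j. 1 \<le> i \<Longrightarrow> i \<le> j \<Longrightarrow> j \<le> k \<Longrightarrow> norm (S (f j)) \<le> norm (S (f i))"
    using ex_principal_frame_antimono[OF lin(2) H] by auto
  obtain g where g: "principal_frame T {1..k} g" "span (g ` {1..k}) = H"
    and g_mono: "\<And>i j. 1 \<le> i \<Longrightarrow> i \<le> j \<Longrightarrow> j \<le> k \<Longrightarrow> norm (T (g i)) \<le> norm (T (g j))"
    using ex_principal_frame[OF lin(1) H] by auto
  have of: "orthonormal_on {1..k} f" and og: "orthonormal_on {1..k} g"
    using f g by (auto simp: principal_frame_def)
  have nzf: "S (f i) \<noteq> 0" "T (g i) \<noteq> 0" if "i \<in> {1..k}" for i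
    using orthonormal_on_nonzero[OF of that] orthonormal_on_nonzero[OF og that] nz by auto
  have dims: "dim (span (h ` J)) = card J" if "orthonormal_on K h" "J \<subseteq> K" "finite K"
      for h :: "nat \<Rightarrow> real ^ 'n" and J K
    using that by (intro orthonormal_on_dim) (auto simp: orthonormal_on_def subset_iff intro:
        finite_subset)
  have sub: "span (f ` J) \<subseteq> H" "span (g ` J) \<subseteq> H" if "J \<subseteq> {1..k}" for J
    using that f(2) g(2) by (metis image_mono span_mono)+
  define b where "b i = 1 / norm (S (f i))" for i
  define c where "c i = norm (T (g i))" for i
  have ab: "a i \<le> b i" if i: "i \<in> {1..k}" for i
  proof -
    have J: "{1..i} \<subseteq> {1..k}" "{i..n} \<subseteq> {1..n}" "i \<in> {1..n}" using i kn by auto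
    obtain x where x: "x \<in> span (f ` {1..i})" "x \<in> span (e ` {i..n})" "x \<noteq> 0"
    proof (rule subspaces_meet[of "span (f ` {1..i})" "span (e ` {i..n})" UNIV])
      show "dim (UNIV :: (real ^ 'n) set) < dim (span (f ` {1..i})) + dim (span (e ` {i..n}))"
        using dims[OF of J(1)] dims[OF e J(2)] n J by simp
    qed auto
    have "norm (S (f i)) * norm x \<le> norm (S x)"
      using J i by (intro principal_frame_norm_bounds(2)[OF lin(2) principal_frame_subset[OF f(1)
          J(1)] x(1)]) (auto intro: f_mono)
    also have "\<dots> \<le> 1 / a i * norm x"
      using J i pos[OF J(3)]
      by (intro principal_frame_norm_bounds(1)[OF lin(2) axes(2)[OF J(2)] x(2)])
         (auto simp: nTe intro!: divide_left_mono am pos mult_pos_pos)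
    finally have "norm (S (f i)) \<le> 1 / a i"
      by (rule mult_right_le_imp_le) (use x(3) in simp)
    then show ?thesis using pos[OF J(3)] nzf(1)[OF i] by (simp add: b_def field_simps)
  qed
  have bc: "b i \<le> c i" if i: "i \<in> {1..k}" for i
  proof -
    have J: "{i..k} \<subseteq> {1..k}" "{1..i} \<subseteq> {1..k}" using i by auto
    obtain x where x: "x \<in> span (f ` {i..k})" "x \<in> span (g ` {1..i})" "x \<noteq> 0"
    proof (rule subspaces_meet[of "span (f ` {i..k})" "span (g ` {1..i})" H])
      show "dim H < dim (span (f ` {i..k})) + dim (span (g ` {1..i}))"
        using dims[OF of J(1)] dims[OF og J(2)] H i by simp
    qed (use sub J H in auto)
    have Sx: "norm (S x) \<le> norm (S (f i)) * norm x"
      using J i by (intro principal_frame_norm_bounds(1)[OF lin(2) principal_frame_subset[OF f(1)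
          J(1)] x(1)]) (auto intro: f_mono)
    have Tx: "norm (T x) \<le> c i * norm x"
      using J i unfolding c_def
      by (intro principal_frame_norm_bounds(1)[OF lin(1) principal_frame_subset[OF g(1) J(2)]
          x(2)]) (auto intro: g_mono)
    have "(norm x)\<^sup>2 \<le> norm (S x) * norm (T x)"
      using norm_cauchy_schwarz[of "S x" "T x"] by (simp add: TS power2_norm_eq_inner)
    also have "\<dots> \<le> (norm (S (f i)) * norm x) * (c i * norm x)"
      by (intro mult_mono Sx Tx) auto
    finally have "1 * (norm x)\<^sup>2 \<le> (norm (S (f i)) * c i) * (norm x)\<^sup>2"
      by (simp add: power2_eq_square ac_simps)
    then have "1 \<le> norm (S (f i)) * c i" using x(3) by (subst (asm) mult_le_cancel_right_pos) auto
    then show ?thesis using nzf(1)[OF i] by (simp add: b_def field_simps)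
  qed
  have ca: "c i \<le> a (n - k + i)" if i: "i \<in> {1..k}" for i
  proof -
    have J: "{i..k} \<subseteq> {1..k}" "{1..n - k + i} \<subseteq> {1..n}" "n - k + i \<in> {1..n}" using i kn by auto
    obtain x where x: "x \<in> span (g ` {i..k})" "x \<in> span (e ` {1..n - k + i})" "x \<noteq> 0"
    proof (rule subspaces_meet[of "span (g ` {i..k})" "span (e ` {1..n - k + i})" UNIV])
      show "dim (UNIV :: (real ^ 'n) set) < dim (span (g ` {i..k})) + dim (span (e ` {1..n - k +
          i}))"
        using dims[OF og J(1)] dims[OF e J(2)] n i kn by simp
    qed auto
    have "c i * norm x \<le> norm (T x)"
      using J i unfolding c_def
      by (intro principal_frame_norm_bounds(2)[OF lin(1) principal_frame_subset[OF g(1) J(1)]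
          x(1)]) (auto intro: g_mono)
    also have "\<dots> \<le> a (n - k + i) * norm x"
      using J pos[OF J(3)]
      by (intro principal_frame_norm_bounds(1)[OF lin(1) axes(1)[OF J(2)] x(2)])
          (auto simp: nTe intro!: am)
    finally show ?thesis using x(3) by simp
  qed
  have apos: "0 < a i" "0 < b i" if "i \<in> {1..k}" for i
    using that pos kn nzf(1) by (auto simp: b_def)
  have F: "ellipsoid e a \<inter> span (e ` {1..k}) = axis_ell {1..k} e a"
  proof -
    have K: "{1..k} \<subseteq> {1..n}" using kn by auto
    have "ellipsoid e a \<inter> span (e ` {1..k}) = axis_ell {1..k} e (\<lambda>i. 1 / norm (S (e i)))"
      unfolding E using K ne by (intro unit_preimage_section[OF lin(2) axes(2)[OF K]] nz) fastforce
    also have "\<dots> = axis_ell {1..k} e a"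
      using K nTe(2) by (intro axis_ell_cong) (simp add: subset_iff)
    finally show ?thesis .
  qed
  have EH: "ellipsoid e a \<inter> H = axis_ell {1..k} f b"
    unfolding E b_def using unit_preimage_section[OF lin(2) f(1)] nzf f(2) by simp
  have PH: "orth_proj H ` ellipsoid e a = axis_ell {1..k} g c"
    unfolding ET c_def using orth_proj_image_cball[of T "{1..k}" g] axis_scaling_selfadjoint[of n
        e a] g nzf
    by (simp add: T_def)
  define e' where "e' i = e (n - k + i)" for i
  have bij: "bij_betw (\<lambda>i. n - k + i) {1..k} {n - k + 1..n}"
    using kn by (intro bij_betwI[where g="\<lambda>i. i - (n - k)"]) auto
  then have e'_im: "e' ` {1..k} = e ` {n - k + 1..n}"
    unfolding e'_def bij_betw_def by (metis image_image)
  have oe': "orthonormal_on {1..k} e'"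
  proof -
    have "e' = e \<circ> (\<lambda>i. n - k + i)" by (simp add: e'_def fun_eq_iff)
    moreover have "(\<lambda>i. n - k + i) ` {1..k} \<subseteq> {1..n}" using kn by auto
    ultimately show ?thesis
      using orthonormal_on_reindex[OF e, of "\<lambda>i. n - k + i" "{1..k}"] by (simp add: inj_on_def)
  qed
  have EE: "ellipsoid e a \<inter> span (e ` {n - k + 1..n}) = axis_ell {1..k} e' (\<lambda>i. a (n - k + i))"
  proof -
    have K: "{n - k + 1..n} \<subseteq> {1..n}" using kn by auto
    have "ellipsoid e a \<inter> span (e ` {n - k + 1..n}) =
        axis_ell {n - k + 1..n} e (\<lambda>i. 1 / norm (S (e i)))"
      unfolding E using K ne by (intro unit_preimage_section[OF lin(2) axes(2)[OF K]] nz) fastforce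
    also have "\<dots> = axis_ell {n - k + 1..n} e a"
      using K nTe(2) by (intro axis_ell_cong) (simp add: subset_iff)
    also have "\<dots> = axis_ell {1..k} e' (\<lambda>i. a (n - k + i))"
      by (simp only: axis_ell_reindex[OF bij, of e a] comp_def e'_def[abs_def])
    finally show ?thesis .
  qed
  have oe: "orthonormal_on {1..k} e" using e kn by (auto simp: orthonormal_on_def)
  \<comment> \<open>The change of variables asks for a well-ordered index type, which \<open>'n bit0\<close> is for every finite
    \<open>'n\<close>; of its \<open>2 * n\<close> elements at least \<open>k\<close> are needed.\<close>
  have card: "card {1..k} \<le> CARD('n bit0)" using kn by (simp add: n_def)
  note mono = quermassintegral_axis_ell_mono[OF finite_atLeastAtMost card]
  show ?first
    using mono[OF oe of, of a b j] apos ab unfolding F EH f(2) by simp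
  show ?second
    using mono[OF of og, of b c j] apos bc unfolding EH PH f(2) g(2) by simp
  have "0 < c i" if "i \<in> {1..k}" for i using apos(2)[OF that] bc[OF that] by simp
  then show ?third
    using mono[OF og oe', of c "\<lambda>i. a (n - k + i)" j] ca
    unfolding PH n_def[symmetric] EE g(2) e'_im by simp
qed

lemma perp_axis_eq_span:
  fixes e :: "nat \<Rightarrow> real ^ 'n"
  assumes e: "orthonormal_on {1..CARD('n)} e"
  shows "perp (e 1) = span (e ` {2..CARD('n)})"
proof -
  have "1 \<in> {1..CARD('n)}" by (simp add: Suc_leI)
  then have ne: "e 1 \<noteq> 0" by (rule orthonormal_on_nonzero[OF e])
  have "orthonormal_on {2..CARD('n)} e" using e by (auto simp: orthonormal_on_def)
  then have "dim (span (e ` {2..CARD('n)})) = CARD('n) - 1"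
      using orthonormal_on_dim[of "{2..CARD('n)}" e] by simp
  moreover have "subspace (perp (e 1))" by (auto simp: perp_def subspace_def inner_add_left)
  moreover have "dim (perp (e 1)) = CARD('n) - 1"
    using dim_hyperplane[OF ne] by (simp add: perp_def inner_commute)
  moreover have "span (e ` {2..CARD('n)}) \<subseteq> perp (e 1)"
    using e by (intro span_minimal \<open>subspace (perp (e 1))\<close>) (auto simp: perp_def orthonormal_on_def)
  ultimately show ?thesis
    by (intro subspace_dim_equal[symmetric]) auto
qed

theorem theorem4p2:
  fixes e :: "nat \<Rightarrow> real ^ 'n" and a :: "nat \<Rightarrow> real"
  assumes orthonormal:
      "\<And>i j. i \<in> {1..CARD('n)} \<Longrightarrow> j \<in> {1..CARD('n)} \<Longrightarrow>
               e i \<bullet> e j = (if i = j then 1 else 0)"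
    and pos: "\<And>i. i \<in> {1..CARD('n)} \<Longrightarrow> 0 < a i"
    and ordered: "mono_on {1..CARD('n)} a"
  shows "(\<forall>k j. \<forall>H \<in> grassmannian k.
            1 \<le> k \<and> k \<le> CARD('n) - 1 \<and> j < k \<longrightarrow>
            (let F = span (e ` {1..k}); E = span (e ` {CARD('n) - k + 1..CARD('n)}) in
              quermassintegral F j (ellipsoid e a \<inter> F)
                \<le> quermassintegral H j (ellipsoid e a \<inter> H) \<and>
              quermassintegral H j (ellipsoid e a \<inter> H)
                \<le> quermassintegral H j (orth_proj H ` ellipsoid e a) \<and>
              quermassintegral H j (orth_proj H ` ellipsoid e a)
                \<le> quermassintegral E j (ellipsoid e a \<inter> E))) \<and>
         (\<forall>\<xi> \<in> sphere 0 1.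
            surface_area (perp \<xi>) (ellipsoid e a \<inter> perp \<xi>)
              \<le> surface_area (perp \<xi>) (orth_proj (perp \<xi>) ` ellipsoid e a) \<and>
            surface_area (perp \<xi>) (orth_proj (perp \<xi>) ` ellipsoid e a)
              \<le> surface_area (perp (e 1)) (ellipsoid e a \<inter> perp (e 1)))"
proof (intro conjI allI ballI impI)
  have e: "orthonormal_on {1..CARD('n)} e"
    using orthonormal by (simp add: orthonormal_on_def)
  have "\<forall>i\<in>{1..CARD('n)}. 0 < a i"
    using pos by blast
  note chain = quermassintegral_ellipsoid_section_chain[OF e this ordered]
  fix k j and H :: "(real ^ 'n) set"
  assume "H \<in> grassmannian k"
  then have "subspace H" "dim H = k" by (simp_all add: grassmannian_def)
  then show "let F = span (e ` {1..k}); E = span (e ` {CARD('n) - k + 1..CARD('n)}) in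
              quermassintegral F j (ellipsoid e a \<inter> F)
                \<le> quermassintegral H j (ellipsoid e a \<inter> H) \<and>
              quermassintegral H j (ellipsoid e a \<inter> H)
                \<le> quermassintegral H j (orth_proj H ` ellipsoid e a) \<and>
              quermassintegral H j (orth_proj H ` ellipsoid e a)
                \<le> quermassintegral E j (ellipsoid e a \<inter> E)"
    unfolding Let_def using chain by blast
next
  have e: "orthonormal_on {1..CARD('n)} e"
    using orthonormal by (simp add: orthonormal_on_def)
  have "\<forall>i\<in>{1..CARD('n)}. 0 < a i"
    using pos by blast
  note chain = quermassintegral_ellipsoid_section_chain[OF e this ordered]
  have n: "1 \<le> CARD('n)" by (simp add: Suc_leI)
  fix \<xi> :: "real ^ 'n" assume "\<xi> \<in> sphere 0 1"
  then have "\<xi> \<noteq> 0" by auto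
  then have d: "dim (perp \<xi>) = CARD('n) - 1"
    using dim_hyperplane[of \<xi>] by (simp add: perp_def inner_commute)
  have s: "subspace (perp \<xi>)" by (auto simp: perp_def subspace_def inner_add_left)
  have "{CARD('n) - (CARD('n) - 1) + 1..CARD('n)} = {2..CARD('n)}" using n by simp
  then have span: "span (e ` {CARD('n) - (CARD('n) - 1) + 1..CARD('n)}) = perp (e 1)"
    by (simp only: perp_axis_eq_span[OF e])
  have d1: "dim (perp (e 1)) = CARD('n) - 1"
    using e unfolding perp_axis_eq_span[OF e]
    by (subst orthonormal_on_dim) (auto simp: orthonormal_on_def)
  show "surface_area (perp \<xi>) (ellipsoid e a \<inter> perp \<xi>)
      \<le> surface_area (perp \<xi>) (orth_proj (perp \<xi>) ` ellipsoid e a)"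
    unfolding surface_area_def by (intro mult_left_mono chain(2)[OF s d]) simp
  show "surface_area (perp \<xi>) (orth_proj (perp \<xi>) ` ellipsoid e a)
      \<le> surface_area (perp (e 1)) (ellipsoid e a \<inter> perp (e 1))"
    unfolding surface_area_def d d1
    using chain(3)[OF s d, of 1, unfolded span] by (intro mult_left_mono) simp_all
qed

end
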